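(* Let $\pi_{XY}:Y\to X$ be a configuration bundle over an oriented $(n+1)$-dimensional manifold $X$, let $\mathcal L:J^rY\to\Lambda^{n+1}X$ be an $r$-th order Lagrangian density, and let $\mathcal G$ be a group acting on $Y$ by vertical bundle automorphisms $\eta\mapsto\eta_Y$ (i.e. covering $\mathrm{id}_X$). Assume that $\mathcal G$ can be identified with the set of sections of a bundle $E\to X$, and let $k$ be the order of the highest derivative of $\eta\in\mathcal G$, viewed as a section $X\to E$, appearing in $\eta_Y\circ\phi$. Let $\tilde Y=E\times_XY$ and define $\tilde{\mathcal L}:J^{k+r}\tilde Y\to\Lambda^{n+1}X$ by $$\tilde{\mathcal L}\big(j^{k+r}(\eta,\phi)(x)\big)=\mathcal L\big(j^r(\eta_Y\circ\phi)(x)\big).$$ Then: (a) $\tilde{\mathcal L}$ is $\mathcal G$-invariant with respect to the action of $\mathcal G$ on $\tilde Y$ given by $\sigma_{\tilde Y}(\eta(x),\phi(x))=\big(\eta(x)\circ\sigma(x)^{-1},\sigma_Y(\phi(x))\big)$: for all $\sigma\in\mathcal G$ and $\gamma\in J^{k+r}\tilde Y$, $$\tilde{\mathcal L}\big(j^{k+r}\sigma_{\tilde Y}(\gamma)\big)=\tilde{\mathcal L}(\gamma).$$ (b) For every section $(\eta,\phi)$ of $\tilde Y$, writing $\eta\cdot\phi=\eta_Y\circ\phi$: (i) $(\eta,\phi)$ satisfies the Euler--Lagrange equations of $\tilde{\mathcal L}$ with respect to $\phi$ if and only if $\eta\cdot\phi$ satisfies the Euler--Lagrange equations of $\mathcal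 L$: $$\frac{\delta\tilde{\mathcal L}}{\delta\phi}(\eta,\phi)=0\iff\frac{\delta\mathcal L}{\delta\phi}(\eta\cdot\phi)=0;$$ (ii) if $(\eta,\phi)$ satisfies the Euler--Lagrange equations of $\tilde{\mathcal L}$ with respect to $\phi$, then the Euler--Lagrange equations of $\tilde{\mathcal L}$ with respect to $\eta$ are satisfied at $(\eta,\phi)$: $$\frac{\delta\tilde{\mathcal L}}{\delta\phi}(\eta,\phi)=0\Longrightarrow\frac{\delta\tilde{\mathcal L}}{\delta\eta}(\eta,\phi)=0.$$
   Context: All objects are smooth. $J^rY$ is the $r$-th jet bundle of $Y\to X$, $\Lambda^{n+1}X$ is the bundle of top forms on $X$, and a Lagrangian density is a bundle map $J^rY\to\Lambda^{n+1}X$ over $X$. The bundle $E\to X$ has fibers that are groups, and the group operations of $\mathcal G$ correspond to the pointwise operations on sections of $E$ (the product of elements of $E_x$ is written $\circ$). When $k=0$, $E_x\subset\operatorname{Diff}(Y_x)$ and $\eta_Y$ restricted to $Y_x$ is $\eta(x)$. In general, $\eta\mapsto\eta_Y$ is a group monomorphism into the vertical automorphisms of $Y$, and $\eta_Y$ restricted to $Y_x$ depends (smoothly) only on the $k$-jet of the section $\eta$ at $x$; for example, $f\in C^\infty(X)$, viewed as a section of $X\times\mathbb R$, acting on $Y=T^*X$ by $A_x\mapsto A_x+df(x)$ has $k=1$. Sections $\eta$ of $E$ are the covariance fields. On sections of $\tilde Y$ the action of $\sigma\in\mathcal G$ is $(\eta,\phi)\mapsto(\eta\circ\sigma^{-1},\sigma_Y\circ\phi)$,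 and $j^{k+r}\sigma_{\tilde Y}$ denotes the induced action on jets of sections. Euler--Lagrange equations are understood variationally. $\frac{\delta\mathcal L}{\delta\phi}(\phi)=0$ means $\frac{d}{d\epsilon}\big|_{\epsilon=0}\int_X\mathcal L(j^r\phi_\epsilon)=0$ for every compactly supported vertical variation $\phi_\epsilon$ of $\phi$ (a smooth family of sections with $\phi_0=\phi$ and $\phi_\epsilon=\phi$ outside a fixed compact subset of $X$; the integral may be taken over that compact set). $\frac{\delta\tilde{\mathcal L}}{\delta\phi}(\eta,\phi)=0$ is the same for $\int_X\tilde{\mathcal L}(j^{k+r}(\eta,\phi_\epsilon))$ with $\eta$ fixed, and $\frac{\delta\tilde{\mathcal L}}{\delta\eta}(\eta,\phi)=0$ is the same for $\int_X\tilde{\mathcal L}(j^{k+r}(\eta_\epsilon,\phi))$ with $\phi$ fixed and $\eta_\epsilon$ any compactly supported variation of $\eta$ through sections of $E$. *)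

theory Defs
  imports
    "HOL-Analysis.Analysis"
    "HOL-Library.Multiset"
    "HOL-Algebra.Group"
    "Jordan_Normal_Form.Determinant"
begin

section \<open>Smooth functions on open subsets of \<open>\<real>\<^sup>I\<close>\<close>

text \<open>
  Jet spaces have dimensions depending on the order, so manifolds are modelled on
  \<open>\<real>\<^sup>I = (\<Pi>\<^sub>E i\<in>I. UNIV)\<close> for a finite set \<open>I\<close> of an arbitrary index type, with the topology
  \<^term>\<open>powertop_real I\<close>. Functions are total on \<open>'i \<Rightarrow> real\<close>, but only their values on the
  (open) set \<open>U\<close> under consideration matter.
\<close>

definition partial :: "'i \<Rightarrow> (('i \<Rightarrow> real) \<Rightarrow> real) \<Rightarrow> ('i \<Rightarrow> real) \<Rightarrow> real" where
  "partial i f v = deriv (\<lambda>t. f (v(i := t))) (v i)"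

primrec Ck_on :: "nat \<Rightarrow> 'i set \<Rightarrow> ('i \<Rightarrow> real) set \<Rightarrow> (('i \<Rightarrow> real) \<Rightarrow> real) \<Rightarrow> bool" where
  "Ck_on 0 I U f \<longleftrightarrow> continuous_map (subtopology (powertop_real I) U) euclideanreal f"
| "Ck_on (Suc k) I U f \<longleftrightarrow>
     continuous_map (subtopology (powertop_real I) U) euclideanreal f \<and>
     (\<forall>i\<in>I. (\<forall>v\<in>U. (\<lambda>t. f (v(i := t))) field_differentiable (at (v i))) \<and>
             Ck_on k I U (partial i f))"

definition Cinf_on :: "'i set \<Rightarrow> ('i \<Rightarrow> real) set \<Rightarrow> (('i \<Rightarrow> real) \<Rightarrow> real) \<Rightarrow> bool" where
  "Cinf_on I U f \<longleftrightarrow> (\<forall>k. Ck_on k I U f)"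

text \<open>Multi-indices are multisets of coordinate directions; their order is the size.\<close>

definition multi_indices :: "'i set \<Rightarrow> nat \<Rightarrow> 'i multiset set" where
  "multi_indices I r = {\<alpha>. set_mset \<alpha> \<subseteq> I \<and> size \<alpha> \<le> r}"

definition partials :: "'i::linorder multiset \<Rightarrow> (('i \<Rightarrow> real) \<Rightarrow> real) \<Rightarrow> ('i \<Rightarrow> real) \<Rightarrow> real" where
  "partials \<alpha> f = foldr partial (sorted_list_of_multiset \<alpha>) f"


section \<open>Manifolds\<close>

type_synonym ('a, 'i) chart = "'a set \<times> ('a \<Rightarrow> 'i \<Rightarrow> real)"

record ('a, 'i) mfd =
  points :: "'a set"
  indices :: "'i set"
  atlas :: "('a, 'i) chart set"

definition mfd_topology :: "('a, 'i) mfd \<Rightarrow> 'a topology" where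
  "mfd_topology M = topology_generated_by
     {{p \<in> U. \<phi> p \<in> S} | U \<phi> S. (U, \<phi>) \<in> atlas M \<and> openin (powertop_real (indices M)) S}"

definition smooth_manifold :: "('a, 'i) mfd \<Rightarrow> bool" where
  "smooth_manifold M \<longleftrightarrow>
     finite (indices M) \<and>
     \<Union> (fst ` atlas M) = points M \<and>
     (\<forall>(U, \<phi>)\<in>atlas M. inj_on \<phi> U \<and> openin (powertop_real (indices M)) (\<phi> ` U)) \<and>
     (\<forall>(U, \<phi>)\<in>atlas M. \<forall>(V, \<psi>)\<in>atlas M.
        openin (powertop_real (indices M)) (\<phi> ` (U \<inter> V)) \<and>
        (\<forall>j\<in>indices M. Cinf_on (indices M) (\<phi> ` (U \<inter> V)) (\<lambda>v. \<psi> (inv_into U \<phi> v) j))) \<and>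
     Hausdorff_space (mfd_topology M) \<and>
     second_countable (mfd_topology M)"

text \<open>Smooth maps from an open subset \<open>W\<close> of \<open>M\<close> to \<open>N\<close>; the openness clause says that \<open>f\<close> is
  continuous.\<close>

definition smooth_map_on ::
  "('a, 'i) mfd \<Rightarrow> ('b, 'j) mfd \<Rightarrow> 'a set \<Rightarrow> ('a \<Rightarrow> 'b) \<Rightarrow> bool" where
  "smooth_map_on M N W f \<longleftrightarrow>
     openin (mfd_topology M) W \<and> f ` W \<subseteq> points N \<and>
     (\<forall>(U, \<phi>)\<in>atlas M. \<forall>(V, \<psi>)\<in>atlas N.
        openin (powertop_real (indices M)) (\<phi> ` (U \<inter> W \<inter> f -` V)) \<and>
        (\<forall>j\<in>indices N. Cinf_on (indices M) (\<phi> ` (U \<inter> W \<inter> f -` V))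
                           (\<lambda>v. \<psi> (f (inv_into U \<phi> v)) j)))"

definition smooth_map :: "('a, 'i) mfd \<Rightarrow> ('b, 'j) mfd \<Rightarrow> ('a \<Rightarrow> 'b) \<Rightarrow> bool" where
  "smooth_map M N f \<longleftrightarrow> smooth_map_on M N (points M) f"

definition diffeo_on ::
  "('a, 'i) mfd \<Rightarrow> ('b, 'j) mfd \<Rightarrow> 'a set \<Rightarrow> 'b set \<Rightarrow> ('a \<Rightarrow> 'b) \<Rightarrow> bool" where
  "diffeo_on M N A B f \<longleftrightarrow>
     bij_betw f A B \<and> smooth_map_on M N A f \<and> smooth_map_on N M B (inv_into A f)"

definition real_line :: "(real, unit) mfd" where
  "real_line = \<lparr>points = UNIV, indices = {()}, atlas = {(UNIV, \<lambda>t u. t)}\<rparr>"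

definition prod_mfd :: "('a, 'i) mfd \<Rightarrow> ('b, 'j) mfd \<Rightarrow> ('a \<times> 'b, 'i + 'j) mfd" where
  "prod_mfd M N = \<lparr>
     points = points M \<times> points N,
     indices = indices M <+> indices N,
     atlas = {(U \<times> V, \<lambda>(p, q). case_sum (\<phi> p) (\<psi> q)) | U \<phi> V \<psi>.
                (U, \<phi>) \<in> atlas M \<and> (V, \<psi>) \<in> atlas N}\<rparr>"

text \<open>An orientation is given by an atlas all of whose transition maps have positive Jacobian
  determinant.\<close>

definition oriented_manifold :: "nat \<Rightarrow> ('a, nat) mfd \<Rightarrow> bool" where
  "oriented_manifold d M \<longleftrightarrow>
     smooth_manifold M \<and> indices M = {..<d} \<and>
     (\<forall>(U, \<phi>)\<in>atlas M. \<forall>(V, \<psi>)\<in>atlas M. \<forall>x\<in>U \<inter> V.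
        0 < Determinant.det (Matrix.mat d d
              (\<lambda>(i, j). partial j (\<lambda>v. \<psi> (inv_into U \<phi> v) i) (\<phi> x))))"


section \<open>Tangent spaces, top forms and their integrals\<close>

definition smooth_functions :: "('a, 'i) mfd \<Rightarrow> ('a \<Rightarrow> real) set" where
  "smooth_functions M = {f. smooth_map M real_line f}"

text \<open>Tangent vectors are derivations of the smooth functions, extended by zero to all functions.\<close>

definition tangent_space :: "('a, 'i) mfd \<Rightarrow> 'a \<Rightarrow> (('a \<Rightarrow> real) \<Rightarrow> real) set" where
  "tangent_space M x = {D.
     (\<forall>f. f \<notin> smooth_functions M \<longrightarrow> D f = 0) \<and>
     (\<forall>f\<in>smooth_functions M. \<forall>g\<in>smooth_functions M. \<forall>c.
        D (\<lambda>p. c * f p + g p) = c * D f + D g \<and>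
        D (\<lambda>p. f p * g p) = D f * g x + f x * D g)}"

definition coordinate_vector ::
  "('a, 'i) mfd \<Rightarrow> ('a, 'i) chart \<Rightarrow> 'a \<Rightarrow> 'i \<Rightarrow> ('a \<Rightarrow> real) \<Rightarrow> real" where
  "coordinate_vector M c x i = (case c of (U, \<phi>) \<Rightarrow>
     (\<lambda>f. if f \<in> smooth_functions M then partial i (\<lambda>v. f (inv_into U \<phi> v)) (\<phi> x) else 0))"

text \<open>A top form at \<open>x\<close> is an alternating multilinear map in as many tangent vectors as \<open>M\<close> has
  coordinates. The slots are numbered by the coordinate indices, and the form is set to zero outside
  its domain so that equality of forms is equality of functions.\<close>

type_synonym ('a, 'i) form = "('i \<Rightarrow> ('a \<Rightarrow> real) \<Rightarrow> real) \<Rightarrow> real"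

definition top_forms_at :: "('a, 'i) mfd \<Rightarrow> 'a \<Rightarrow> ('a, 'i) form set" where
  "top_forms_at M x = {\<omega>.
     (\<forall>v. v \<notin> (indices M \<rightarrow>\<^sub>E tangent_space M x) \<longrightarrow> \<omega> v = 0) \<and>
     (\<forall>v \<in> indices M \<rightarrow>\<^sub>E tangent_space M x.
        (\<forall>i\<in>indices M. \<forall>a\<in>tangent_space M x. \<forall>b\<in>tangent_space M x. \<forall>c.
           \<omega> (v(i := (\<lambda>f. c * a f + b f))) = c * \<omega> (v(i := a)) + \<omega> (v(i := b))) \<and>
        (\<forall>i\<in>indices M. \<forall>j\<in>indices M. i \<noteq> j \<and> v i = v j \<longrightarrow> \<omega> v = 0))}"

text \<open>The coefficient of \<open>dx\<^sup>0 \<and> \<dots> \<and> dx\<^sup>n\<close> in the chart \<open>c\<close>.\<close>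

definition form_coeff :: "('a, 'i) mfd \<Rightarrow> ('a, 'i) chart \<Rightarrow> 'a \<Rightarrow> ('a, 'i) form \<Rightarrow> real" where
  "form_coeff M c x \<omega> = \<omega> (\<lambda>i\<in>indices M. coordinate_vector M c x i)"

definition top_forms :: "('a, 'i) mfd \<Rightarrow> ('a \<times> ('a, 'i) form, 'i + unit) mfd" where
  "top_forms M = \<lparr>
     points = (SIGMA x : points M. top_forms_at M x),
     indices = indices M <+> {()},
     atlas = {(SIGMA x : U. top_forms_at M x,
               \<lambda>(x, \<omega>). case_sum (\<phi> x) (\<lambda>u. form_coeff M (U, \<phi>) x \<omega>)) | U \<phi>.
                (U, \<phi>) \<in> atlas M}\<rparr>"

text \<open>Integral over a compact set \<open>K\<close>, by a partition of unity on \<open>K\<close> subordinate to the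
  (oriented) atlas.\<close>

definition has_form_integral ::
  "('a, 'i) mfd \<Rightarrow> 'a set \<Rightarrow> ('a \<Rightarrow> 'a \<times> ('a, 'i) form) \<Rightarrow> real \<Rightarrow> bool" where
  "has_form_integral M K \<omega> I \<longleftrightarrow>
     (\<exists>C \<rho>. finite C \<and> C \<subseteq> atlas M \<and>
        (\<forall>c\<in>C. \<rho> c \<in> smooth_functions M \<and> (\<forall>x\<in>points M. 0 \<le> \<rho> c x) \<and>
                mfd_topology M closure_of {x \<in> points M. \<rho> c x \<noteq> 0} \<subseteq> fst c) \<and>
        (\<forall>x\<in>K. (\<Sum>c\<in>C. \<rho> c x) = 1) \<and>
        I = (\<Sum>(U, \<phi>)\<in>C. set_lebesgue_integral (Pi\<^sub>M (indices M) (\<lambda>_. lborel)) (\<phi> ` (K \<inter> U))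
               (\<lambda>v. let x = inv_into U \<phi> v in
                  \<rho> (U, \<phi>) x * form_coeff M (U, \<phi>) x (snd (\<omega> x)))))"

definition form_integral ::
  "('a, 'i) mfd \<Rightarrow> 'a set \<Rightarrow> ('a \<Rightarrow> 'a \<times> ('a, 'i) form) \<Rightarrow> real" where
  "form_integral M K \<omega> = (THE I. has_form_integral M K \<omega> I)"


section \<open>Fibre bundles and sections\<close>

text \<open>
  The total space is presented by charts adapted to the projection: the coordinates \<open>Inl i\<close> are
  base coordinates and the coordinates \<open>Inr j\<close> are fibre coordinates. Every fibre bundle has such
  an atlas, over any given atlas of the base.
\<close>

record ('x, 'i, 'y, 'j) fibred =
  base :: "('x, 'i) mfd"
  total :: "('y, 'i + 'j) mfd"
  proj :: "'y \<Rightarrow> 'x"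

definition fibre :: "('x, 'i, 'y, 'j) fibred \<Rightarrow> 'x \<Rightarrow> 'y set" where
  "fibre P x = {y \<in> points (total P). proj P y = x}"

definition fibre_indices :: "('x, 'i, 'y, 'j) fibred \<Rightarrow> 'j set" where
  "fibre_indices P = {j. Inr j \<in> indices (total P)}"

definition adapted_charts ::
  "('x, 'i, 'y, 'j) fibred \<Rightarrow> (('x, 'i) chart \<times> ('y, 'i + 'j) chart) set" where
  "adapted_charts P = {((U, \<phi>), (V, \<psi>)).
     (U, \<phi>) \<in> atlas (base P) \<and> (V, \<psi>) \<in> atlas (total P) \<and>
     proj P ` V \<subseteq> U \<and> (\<forall>y\<in>V. \<forall>i\<in>indices (base P). \<psi> y (Inl i) = \<phi> (proj P y) i)}"

definition fibre_bundle :: "('x, 'i, 'y, 'j) fibred \<Rightarrow> ('f, 'm) mfd \<Rightarrow> bool" where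
  "fibre_bundle P F \<longleftrightarrow>
     smooth_manifold (base P) \<and> smooth_manifold (total P) \<and> smooth_manifold F \<and>
     indices (total P) = indices (base P) <+> fibre_indices P \<and>
     (\<forall>c\<in>atlas (total P). \<exists>b. (b, c) \<in> adapted_charts P) \<and>
     smooth_map (total P) (base P) (proj P) \<and>
     proj P ` points (total P) = points (base P) \<and>
     (\<forall>x\<in>points (base P). \<exists>W \<tau>. openin (mfd_topology (base P)) W \<and> x \<in> W \<and>
        diffeo_on (total P) (prod_mfd (base P) F)
          {y \<in> points (total P). proj P y \<in> W} (W \<times> points F) (\<lambda>y. (proj P y, \<tau> y)))"

definition section_on :: "('x, 'i, 'y, 'j) fibred \<Rightarrow> 'x set \<Rightarrow> ('x \<Rightarrow> 'y) \<Rightarrow> bool" where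
  "section_on P W s \<longleftrightarrow> smooth_map_on (base P) (total P) W s \<and> (\<forall>x\<in>W. proj P (s x) = x)"

definition sections :: "('x, 'i, 'y, 'j) fibred \<Rightarrow> ('x \<Rightarrow> 'y) set" where
  "sections P = {s. section_on P (points (base P)) s}"

definition local_sections :: "('x, 'i, 'y, 'j) fibred \<Rightarrow> 'x \<Rightarrow> ('x \<Rightarrow> 'y) set" where
  "local_sections P x = {s. \<exists>W. x \<in> W \<and> section_on P W s}"

definition vertical_automorphism :: "('x, 'i, 'y, 'j) fibred \<Rightarrow> ('y \<Rightarrow> 'y) \<Rightarrow> bool" where
  "vertical_automorphism P f \<longleftrightarrow>
     diffeo_on (total P) (total P) (points (total P)) (points (total P)) f \<and>
     (\<forall>y\<in>points (total P). proj P (f y) = proj P y)"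

definition fibre_product ::
  "('x, 'i, 'y, 'j) fibred \<Rightarrow> ('x, 'i, 'z, 'k) fibred \<Rightarrow> ('x, 'i, 'y \<times> 'z, 'j + 'k) fibred" where
  "fibre_product P Q = \<lparr>
     base = base P,
     total = \<lparr>
       points = {(p, q). p \<in> points (total P) \<and> q \<in> points (total Q) \<and> proj P p = proj Q q},
       indices = indices (base P) <+> (fibre_indices P <+> fibre_indices Q),
       atlas = {({(p, q). p \<in> U \<and> q \<in> V \<and> proj P p = proj Q q},
                 \<lambda>(p, q). case_sum (\<lambda>i. \<phi> p (Inl i))
                            (case_sum (\<lambda>j. \<phi> p (Inr j)) (\<lambda>k. \<psi> q (Inr k)))) | U \<phi> V \<psi>.
                  (U, \<phi>) \<in> atlas (total P) \<and> (V, \<psi>) \<in> atlas (total Q)}\<rparr>,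
     proj = (\<lambda>(p, q). proj P p)\<rparr>"


section \<open>Jets\<close>

definition jet_eq ::
  "('x, 'i::linorder, 'y, 'j) fibred \<Rightarrow> nat \<Rightarrow> 'x \<Rightarrow> ('x \<Rightarrow> 'y) \<Rightarrow> ('x \<Rightarrow> 'y) \<Rightarrow> bool" where
  "jet_eq P r x s s' \<longleftrightarrow> s x = s' x \<and>
     (\<forall>((U, \<phi>), (V, \<psi>)) \<in> adapted_charts P. s x \<in> V \<longrightarrow>
        (\<forall>j\<in>fibre_indices P. \<forall>\<alpha>\<in>multi_indices (indices (base P)) r.
           partials \<alpha> (\<lambda>v. \<psi> (s (inv_into U \<phi> v)) (Inr j)) (\<phi> x) =
           partials \<alpha> (\<lambda>v. \<psi> (s' (inv_into U \<phi> v)) (Inr j)) (\<phi> x)))"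

type_synonym ('x, 'y) jet = "'x \<times> ('x \<Rightarrow> 'y) set"

definition jet ::
  "('x, 'i::linorder, 'y, 'j) fibred \<Rightarrow> nat \<Rightarrow> ('x \<Rightarrow> 'y) \<Rightarrow> 'x \<Rightarrow> ('x, 'y) jet" where
  "jet P r s x = (x, {s' \<in> local_sections P x. jet_eq P r x s s'})"

definition jets :: "('x, 'i::linorder, 'y, 'j) fibred \<Rightarrow> nat \<Rightarrow> ('x, 'y) jet set" where
  "jets P r = {jet P r s x | s x. x \<in> points (base P) \<and> s \<in> local_sections P x}"

definition jet_rep :: "('x, 'y) jet \<Rightarrow> 'x \<Rightarrow> 'y" where
  "jet_rep \<gamma> = (SOME s. s \<in> snd \<gamma>)"

definition jet_bundle ::
  "('x, 'i::linorder, 'y, 'j) fibred \<Rightarrow> nat \<Rightarrow> ('x, 'i, ('x, 'y) jet, 'j \<times> 'i multiset) fibred" where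
  "jet_bundle P r = \<lparr>
     base = base P,
     total = (let I = indices (base P) <+> (fibre_indices P \<times> multi_indices (indices (base P)) r)
       in \<lparr>
       points = jets P r,
       indices = I,
       atlas = {({\<gamma> \<in> jets P r. jet_rep \<gamma> (fst \<gamma>) \<in> V},
                 \<lambda>\<gamma>. restrict (case_sum (\<phi> (fst \<gamma>))
                    (\<lambda>(j, \<alpha>). partials \<alpha> (\<lambda>v. \<psi> (jet_rep \<gamma> (inv_into U \<phi> v)) (Inr j)) (\<phi> (fst \<gamma>))))
                  I) | U \<phi> V \<psi>.
                  ((U, \<phi>), (V, \<psi>)) \<in> adapted_charts P}\<rparr>),
     proj = fst\<rparr>"

text \<open>The map \<open>j\<^sup>r f\<close> on \<open>r\<close>-jets of sections induced by a vertical bundle map \<open>f\<close>.\<close>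

definition jet_prolongation ::
  "('x, 'i::linorder, 'y, 'j) fibred \<Rightarrow> nat \<Rightarrow> ('y \<Rightarrow> 'y) \<Rightarrow> ('x, 'y) jet \<Rightarrow> ('x, 'y) jet" where
  "jet_prolongation P r f \<gamma> = jet P r (f \<circ> jet_rep \<gamma>) (fst \<gamma>)"

definition lagrangian_density ::
  "('x, 'i::linorder, 'y, 'j) fibred \<Rightarrow> nat \<Rightarrow> (('x, 'y) jet \<Rightarrow> 'x \<times> ('x, 'i) form) \<Rightarrow> bool" where
  "lagrangian_density P r L \<longleftrightarrow>
     smooth_map (total (jet_bundle P r)) (top_forms (base P)) L \<and>
     (\<forall>\<gamma>\<in>jets P r. fst (L \<gamma>) = fst \<gamma>)"


section \<open>Variations and Euler--Lagrange equations\<close>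

definition compact_variation ::
  "('x, 'i, 'y, 'j) fibred \<Rightarrow> ('x \<Rightarrow> 'y) \<Rightarrow> 'x set \<Rightarrow> real \<Rightarrow> (real \<Rightarrow> 'x \<Rightarrow> 'y) \<Rightarrow> bool" where
  "compact_variation P s K \<delta> F \<longleftrightarrow>
     compactin (mfd_topology (base P)) K \<and> 0 < \<delta> \<and>
     smooth_map_on (prod_mfd real_line (base P)) (total P)
       ({-\<delta><..<\<delta>} \<times> points (base P)) (\<lambda>(\<epsilon>, x). F \<epsilon> x) \<and>
     (\<forall>\<epsilon>\<in>{-\<delta><..<\<delta>}. \<forall>x\<in>points (base P). proj P (F \<epsilon> x) = x) \<and>
     (\<forall>x\<in>points (base P). F 0 x = s x) \<and>
     (\<forall>\<epsilon>\<in>{-\<delta><..<\<delta>}. \<forall>x\<in>points (base P) - K. F \<epsilon> x = s x)"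

text \<open>\<open>\<Phi>\<close> assigns to each section of \<open>P\<close> the top form on the base that is to be integrated, e.g.
  \<open>\<phi> \<mapsto> \<L>(j\<^sup>r\<phi>)\<close>.\<close>

definition stationary ::
  "('x, 'i, 'y, 'j) fibred \<Rightarrow> (('x \<Rightarrow> 'y) \<Rightarrow> 'x \<Rightarrow> 'x \<times> ('x, 'i) form) \<Rightarrow> ('x \<Rightarrow> 'y) \<Rightarrow> bool" where
  "stationary P \<Phi> s \<longleftrightarrow>
     (\<forall>K \<delta> F. compact_variation P s K \<delta> F \<longrightarrow>
        ((\<lambda>\<epsilon>. form_integral (base P) K (\<Phi> (F \<epsilon>))) has_real_derivative 0) (at 0))"

definition euler_lagrange ::
  "('x, 'i::linorder, 'y, 'j) fibred \<Rightarrow> nat \<Rightarrow> (('x, 'y) jet \<Rightarrow> 'x \<times> ('x, 'i) form) \<Rightarrow>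
   ('x \<Rightarrow> 'y) \<Rightarrow> bool" where
  "euler_lagrange P r L \<phi> \<longleftrightarrow> stationary P (\<lambda>\<psi> x. L (jet P r \<psi> x)) \<phi>"

text \<open>The Euler--Lagrange equations of a density on a fibre product with respect to the second and
  to the first field, the other one being fixed.\<close>

definition euler_lagrange_snd ::
  "('x, 'i::linorder, 'e, 'l) fibred \<Rightarrow> ('x, 'i, 'y, 'j) fibred \<Rightarrow> nat \<Rightarrow>
   (('x, 'e \<times> 'y) jet \<Rightarrow> 'x \<times> ('x, 'i) form) \<Rightarrow> ('x \<Rightarrow> 'e) \<Rightarrow> ('x \<Rightarrow> 'y) \<Rightarrow> bool" where
  "euler_lagrange_snd E Y s L \<eta> \<phi> \<longleftrightarrow>
     stationary Y (\<lambda>\<psi> x. L (jet (fibre_product E Y) s (\<lambda>z. (\<eta> z, \<psi> z)) x)) \<phi>"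

definition euler_lagrange_fst ::
  "('x, 'i::linorder, 'e, 'l) fibred \<Rightarrow> ('x, 'i, 'y, 'j) fibred \<Rightarrow> nat \<Rightarrow>
   (('x, 'e \<times> 'y) jet \<Rightarrow> 'x \<times> ('x, 'i) form) \<Rightarrow> ('x \<Rightarrow> 'e) \<Rightarrow> ('x \<Rightarrow> 'y) \<Rightarrow> bool" where
  "euler_lagrange_fst E Y s L \<eta> \<phi> \<longleftrightarrow>
     stationary E (\<lambda>\<zeta> x. L (jet (fibre_product E Y) s (\<lambda>z. (\<zeta> z, \<phi> z)) x)) \<eta>"


section \<open>Gauge groups and covariance fields\<close>

definition group_bundle :: "('x, 'i, 'e, 'l) fibred \<Rightarrow> ('x \<Rightarrow> 'e monoid) \<Rightarrow> bool" where
  "group_bundle E G \<longleftrightarrow>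
     (\<forall>x\<in>points (base E). group (G x) \<and> carrier (G x) = fibre E x) \<and>
     smooth_map (total (fibre_product E E)) (total E) (\<lambda>(e, e'). e \<otimes>\<^bsub>G (proj E e)\<^esub> e') \<and>
     smooth_map (total E) (total E) (\<lambda>e. inv\<^bsub>G (proj E e)\<^esub> e) \<and>
     (\<lambda>x. \<one>\<^bsub>G x\<^esub>) \<in> sections E"

text \<open>
  The transformation \<open>\<eta>\<^sub>Y\<close> of \<open>Y\<close> given by a section \<open>\<eta>\<close> of \<open>E\<close>, where \<open>a\<close> is the law through which
  \<open>k\<close>-jets of sections of \<open>E\<close> at \<open>x\<close> act on the fibre \<open>Y\<^sub>x\<close>. For a section \<open>\<eta>\<close> over an open set, this
  transforms the part of \<open>Y\<close> over that set.
\<close>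

definition gauge_map ::
  "('x, 'i::linorder, 'e, 'l) fibred \<Rightarrow> ('x, 'i, 'y, 'j) fibred \<Rightarrow> nat \<Rightarrow>
   (('x, 'e) jet \<Rightarrow> 'y \<Rightarrow> 'y) \<Rightarrow> ('x \<Rightarrow> 'e) \<Rightarrow> 'y \<Rightarrow> 'y" where
  "gauge_map E Y k a \<eta> y = a (jet E k \<eta> (proj Y y)) y"

text \<open>
  The group acting on \<open>Y\<close> is the group of sections of \<open>E\<close> with pointwise operations. The law \<open>a\<close> is
  required to be multiplicative on all jets, including those of local sections that do not extend
  globally: otherwise the formula defining the density on \<open>J\<^sup>k\<^sup>+\<^sup>r(E \<times>\<^sub>X Y)\<close> would leave it undetermined
  at such jets.
\<close>

definition gauge_action ::
  "('x, 'i::linorder, 'e, 'l) fibred \<Rightarrow> ('x \<Rightarrow> 'e monoid) \<Rightarrow> ('x, 'i, 'y, 'j) fibred \<Rightarrow> nat \<Rightarrow>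
   (('x, 'e) jet \<Rightarrow> 'y \<Rightarrow> 'y) \<Rightarrow> bool" where
  "gauge_action E G Y k a \<longleftrightarrow>
     smooth_map (total (fibre_product (jet_bundle E k) Y)) (total Y) (\<lambda>(\<gamma>, y). a \<gamma> y) \<and>
     (\<forall>(\<gamma>, y)\<in>points (total (fibre_product (jet_bundle E k) Y)). proj Y (a \<gamma> y) = proj Y y) \<and>
     (\<forall>x\<in>points (base E). \<forall>\<eta>\<in>local_sections E x. \<forall>\<sigma>\<in>local_sections E x. \<forall>y\<in>fibre Y x.
        gauge_map E Y k a (\<lambda>z. \<eta> z \<otimes>\<^bsub>G z\<^esub> \<sigma> z) y =
        gauge_map E Y k a \<eta> (gauge_map E Y k a \<sigma> y)) \<and>
     (\<forall>\<eta>\<in>sections E. vertical_automorphism Y (gauge_map E Y k a \<eta>)) \<and>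
     (\<forall>\<eta>\<in>sections E. \<forall>\<sigma>\<in>sections E.
        (\<forall>y\<in>points (total Y). gauge_map E Y k a \<eta> y = gauge_map E Y k a \<sigma> y) \<longrightarrow>
        (\<forall>x\<in>points (base E). \<eta> x = \<sigma> x))"

text \<open>\<open>\<L>\<close> evaluated on \<open>j\<^sup>r(\<eta>\<^sub>Y \<circ> \<phi>)(x)\<close>, where \<open>(\<eta>, \<phi>)\<close> is a local section representing the given
  jet.\<close>

definition covariant_density ::
  "('x, 'i::linorder, 'e, 'l) fibred \<Rightarrow> ('x, 'i, 'y, 'j) fibred \<Rightarrow> nat \<Rightarrow>
   (('x, 'e) jet \<Rightarrow> 'y \<Rightarrow> 'y) \<Rightarrow> nat \<Rightarrow> (('x, 'y) jet \<Rightarrow> 'x \<times> ('x, 'i) form) \<Rightarrow>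
   ('x, 'e \<times> 'y) jet \<Rightarrow> 'x \<times> ('x, 'i) form" where
  "covariant_density E Y k a r L \<gamma> =
     (let \<eta> = fst \<circ> jet_rep \<gamma>; \<phi> = snd \<circ> jet_rep \<gamma>
      in L (jet Y r (gauge_map E Y k a \<eta> \<circ> \<phi>) (fst \<gamma>)))"

definition covariant_gauge_map ::
  "('x, 'i::linorder, 'e, 'l) fibred \<Rightarrow> ('x \<Rightarrow> 'e monoid) \<Rightarrow> ('x, 'i, 'y, 'j) fibred \<Rightarrow> nat \<Rightarrow>
   (('x, 'e) jet \<Rightarrow> 'y \<Rightarrow> 'y) \<Rightarrow> ('x \<Rightarrow> 'e) \<Rightarrow> 'e \<times> 'y \<Rightarrow> 'e \<times> 'y" where
  "covariant_gauge_map E G Y k a \<sigma> = (\<lambda>(e, y).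
     (e \<otimes>\<^bsub>G (proj E e)\<^esub> inv\<^bsub>G (proj E e)\<^esub> \<sigma> (proj E e), gauge_map E Y k a \<sigma> y))"

end

theory Submission
  imports Defs
begin

text \<open>
  The analytic core is that the \<open>r\<close>-jet of \<open>\<eta>\<^sub>Y \<circ> \<phi>\<close> at \<open>x\<close> is determined by the \<open>(k + r)\<close>-jet of
  \<open>(\<eta>, \<phi>)\<close> at \<open>x\<close>: \<open>\<eta>\<^sub>Y \<circ> \<phi>\<close> is the composition of the smooth law \<open>a\<close> with \<open>x \<mapsto> (j\<^sup>k\<eta>(x), \<phi>(x))\<close>,
  and compositions preserve agreement to order \<open>r\<close>. Hence the new density takes the value
  \<open>\<L>(j\<^sup>r(\<eta>\<^sub>Y \<circ> \<phi>)(x))\<close> on \<^emph>\<open>every\<close> representative of a jet. Invariance follows from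
  \<open>(\<eta> \<sigma>\<inverse>)\<^sub>Y \<circ> \<sigma>\<^sub>Y = \<eta>\<^sub>Y\<close>. Composition with the diffeomorphism \<open>\<eta>\<^sub>Y\<close> is a bijection from the variations
  of \<open>\<phi>\<close> onto those of \<open>\<eta> \<cdot> \<phi>\<close> that preserves the action, which gives (i). A variation \<open>\<eta>\<^sub>\<epsilon>\<close> of \<open>\<eta>\<close>
  gives the variation \<open>\<eta>\<^sub>\<epsilon> \<cdot> \<phi>\<close> of \<open>\<eta> \<cdot> \<phi>\<close>, which gives (ii).
\<close>


section \<open>Smooth functions of finitely many real variables\<close>


text \<open>A jet is a set of local sections, the density is evaluated on a representative picked by
  \<open>SOME\<close>, and \<open>jet_eq\<close> quantifies over every adapted chart. Everything
  therefore rests on comparing derivatives under changes of chart and of representative. This is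
  done once, for functions on open subsets of R^I (\<open>same_jet\<close>): the chain rule writes a
  partial derivative of a composite as a sum of products, to which induction on the order applies.
  Jet bundles enter as the middle space of compositions, where injectivity of their charts is the
  property that counts (\<open>injective_atlas\<close>). Part (a) concerns arbitrary jets, whose
  representatives may be merely local; the quotient of \<eta> by \<sigma> is formed as a local
  section, smooth because the fibrewise group operations are. In (b) the integrands agree on K for
  every small parameter, so the two actions are the same function of the parameter near 0. The
  delicate point of (ii) is that the transformation uses k derivatives of \<eta>: outside K the
  varied field must agree with \<eta> near each point, which holds because K is closed, X being
  Hausdorff.\<close>

abbreviation ropen :: "'i set \<Rightarrow> ('i \<Rightarrow> real) set \<Rightarrow> bool" where
  "ropen I \<equiv> openin (powertop_real I)"

abbreviation euc :: "'i set \<Rightarrow> ('i \<Rightarrow> real) set" where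
  "euc I \<equiv> I \<rightarrow>\<^sub>E UNIV"

text \<open>Open cubes, the balls of the sup norm: for finite \<open>I\<close> they form a
  neighbourhood basis of the product topology, which turns openness and continuity into
  epsilon-delta statements for any index type. Membership in \<open>euc I\<close> keeps the points
  extensional.\<close>

definition box_at :: "'i set \<Rightarrow> ('i \<Rightarrow> real) \<Rightarrow> real \<Rightarrow> ('i \<Rightarrow> real) set" where
  "box_at I v e = {w \<in> euc I. \<forall>i\<in>I. \<bar>w i - v i\<bar> < e}"

lemma fun_upd_extensional:
  assumes "v \<in> euc I" "i \<in> I"
  shows "v(i := t) \<in> euc I"
  using assms by (auto simp: PiE_def extensional_def)

lemma openin_box_at:
  assumes "finite I"
  shows "ropen I (box_at I v e)"
proof -
  have "box_at I v e = (\<Pi>\<^sub>E i\<in>I. ball (v i) e)"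
    unfolding set_eq_iff
    by (simp add: box_at_def PiE_iff dist_real_def abs_minus_commute) blast
  then show ?thesis using assms by (simp add: openin_PiE)
qed

lemma openin_powertop_iff_box:
  assumes I: "finite I"
  shows "ropen I S \<longleftrightarrow>
    S \<subseteq> (euc I) \<and> (\<forall>v\<in>S. \<exists>e>0. box_at I v e \<subseteq> S)"
proof (intro iffI conjI ballI)
  assume S: "ropen I S"
  then show "S \<subseteq> (euc I)" using openin_subset by fastforce
  fix v assume v: "v \<in> S"
  then obtain U where U: "\<And>i. i \<in> I \<Longrightarrow> open (U i)" "v \<in> PiE I U" "PiE I U \<subseteq> S"
    using S unfolding openin_product_topology_alt by (metis open_openin)
  have "\<exists>d>0. \<forall>t. \<bar>t - v i\<bar> < d \<longrightarrow> t \<in> U i" if "i \<in> I" for i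
    using U(1)[OF that] PiE_mem[OF U(2) that] unfolding open_dist dist_real_def by blast
  then obtain d where d: "\<And>i. i \<in> I \<Longrightarrow> d i > 0" "\<And>i t. i \<in> I \<Longrightarrow> \<bar>t - v i\<bar> < d i \<Longrightarrow> t \<in> U i"
    by metis
  \<comment> \<open>The 1 keeps the minimum meaningful and positive when \<open>I\<close> is
    empty.\<close>
  define e where "e = Min (insert 1 (d ` I))"
  have e: "e > 0" "\<And>i. i \<in> I \<Longrightarrow> e \<le> d i" using I d(1) by (auto simp: e_def)
  have "box_at I v e \<subseteq> PiE I U"
  proof
    fix w assume w: "w \<in> box_at I v e"
    then have "w i \<in> U i" if "i \<in> I" for i
      using d(2)[OF that, of "w i"] e(2)[OF that] that by (force simp: box_at_def)
    then show "w \<in> PiE I U" using w by (auto simp: box_at_def PiE_iff)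
  qed
  then show "\<exists>e>0. box_at I v e \<subseteq> S" using e(1) U(3) by blast
next
  assume R: "S \<subseteq> (euc I) \<and> (\<forall>v\<in>S. \<exists>e>0. box_at I v e \<subseteq> S)"
  show "ropen I S"
  proof (subst openin_subopen, intro ballI)
    fix v assume v: "v \<in> S"
    then obtain e where "e > 0" "box_at I v e \<subseteq> S" using R by blast
    moreover have "v \<in> box_at I v e" using R v \<open>e > 0\<close> by (auto simp: box_at_def)
    ultimately show "\<exists>T. ropen I T \<and> v \<in> T \<and> T \<subseteq> S"
      using openin_box_at[OF I] by blast
  qed
qed

lemma openin_powertop_UNIV: "ropen I (euc I)"
  using openin_topspace[of "powertop_real I"] by simp


lemma openin_powertop_extensional:
  "ropen I S \<Longrightarrow> v \<in> S \<Longrightarrow> v \<in> euc I"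
  using openin_subset by fastforce

lemma openin_powertop_curve:
  assumes "finite I" "ropen I S" "v \<in> S" "i \<in> I"
  shows "eventually (\<lambda>t. v(i := t) \<in> S) (nhds (v i))"
proof -
  have v: "v \<in> euc I" using openin_powertop_extensional[OF assms(2,3)] .
  obtain e where e: "e > 0" "box_at I v e \<subseteq> S"
    using assms by (auto simp: openin_powertop_iff_box)
  have "v(i := t) \<in> S" if "dist t (v i) < e" for t
    using e that fun_upd_extensional[OF v assms(4)]
    by (intro subsetD[OF e(2)]) (auto simp: box_at_def dist_real_def)
  then show ?thesis using e(1) unfolding eventually_nhds_metric by blast
qed

lemma continuous_powertop_iff:
  assumes I: "finite I" and U: "ropen I U"
  shows "continuous_map (subtopology (powertop_real I) U) euclideanreal f \<longleftrightarrow>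
    (\<forall>v\<in>U. \<forall>e>0. \<exists>d>0. box_at I v d \<subseteq> U \<and> (\<forall>w\<in>box_at I v d. \<bar>f w - f v\<bar> < e))"
    (is "?L \<longleftrightarrow> ?R")
proof
  assume L: ?L
  show ?R
  proof (intro ballI allI impI)
    fix v and e :: real assume v: "v \<in> U" and e: "e > 0"
    have "openin (subtopology (powertop_real I) U)
        {w \<in> topspace (subtopology (powertop_real I) U). f w \<in> ball (f v) e}"
      using L by (rule openin_continuous_map_preimage) simp
    then have "ropen I
        {w \<in> topspace (subtopology (powertop_real I) U). f w \<in> ball (f v) e}"
      using U openin_trans_full by blast
    moreover have "v \<in> {w \<in> topspace (subtopology (powertop_real I) U). f w \<in> ball (f v) e}"
      using v e openin_powertop_extensional[OF U v] by simp
    ultimately obtain d where "d > 0"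
      "box_at I v d \<subseteq> {w \<in> topspace (subtopology (powertop_real I) U). f w \<in> ball (f v) e}"
      unfolding openin_powertop_iff_box[OF I] by blast
    then show "\<exists>d>0. box_at I v d \<subseteq> U \<and> (\<forall>w\<in>box_at I v d. \<bar>f w - f v\<bar> < e)"
      by (intro exI[of _ d]) (auto simp: dist_real_def abs_minus_commute)
  qed
next
  assume R: ?R
  have "ropen I {w \<in> U. f w \<in> T}" if T: "open T" for T
  proof -
    have "\<exists>d>0. box_at I v d \<subseteq> {w \<in> U. f w \<in> T}" if v: "v \<in> U" "f v \<in> T" for v
    proof -
      obtain e where e: "e > 0" "ball (f v) e \<subseteq> T" using T v(2) openE by blast
      obtain d where "d > 0" "box_at I v d \<subseteq> U" "\<forall>w\<in>box_at I v d. \<bar>f w - f v\<bar> < e"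
        using R v(1) e(1) by blast
      then show ?thesis using e(2)
        by (intro exI[of _ d]) (auto simp: dist_real_def abs_minus_commute subset_iff)
    qed
    then show ?thesis
      using openin_powertop_extensional[OF U] unfolding openin_powertop_iff_box[OF I] by blast
  qed
  moreover have "topspace (subtopology (powertop_real I) U) = U"
    using openin_subset[OF U] by auto
  ultimately show ?L
    by (auto simp: continuous_map_def openin_open_subtopology[OF U])
qed

section \<open>Continuous real functions on open subsets of R^I\<close>

definition cont_on :: "'i set \<Rightarrow> ('i \<Rightarrow> real) set \<Rightarrow> (('i \<Rightarrow> real) \<Rightarrow> real) \<Rightarrow> bool" where
  "cont_on I U f \<longleftrightarrow> continuous_map (subtopology (powertop_real I) U) euclideanreal f"

lemma cont_onD:
  assumes "finite I" "ropen I U" "cont_on I U f" "v \<in> U" "e > 0"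
  shows "\<exists>d>0. box_at I v d \<subseteq> U \<and> (\<forall>w\<in>box_at I v d. \<bar>f w - f v\<bar> < e)"
  using assms unfolding cont_on_def by (simp add: continuous_powertop_iff)


lemma box_at_mono: "d \<le> e \<Longrightarrow> box_at I v d \<subseteq> box_at I v e"
  by (force simp: box_at_def)

lemma topspace_subtopology_powertop:
  "ropen I U \<Longrightarrow> topspace (subtopology (powertop_real I) U) = U"
  using openin_subset by fastforce

lemma cont_on_cong:
  assumes "\<And>v. v \<in> U \<Longrightarrow> f v = g v"
  shows "cont_on I U f \<longleftrightarrow> cont_on I U g"
  unfolding cont_on_def
  by (auto intro: continuous_map_eq simp: assms)

lemma cont_on_subset: "cont_on I U f \<Longrightarrow> V \<subseteq> U \<Longrightarrow> cont_on I V f"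
  unfolding cont_on_def by (rule continuous_map_from_subtopology_mono)

lemma cont_on_const: "cont_on I U (\<lambda>v. c)"
  unfolding cont_on_def by simp

lemma cont_on_coord: "i \<in> I \<Longrightarrow> cont_on I U (\<lambda>v. v i)"
  unfolding cont_on_def
  by (intro continuous_map_from_subtopology continuous_map_product_projection)

lemma cont_on_add: "cont_on I U f \<Longrightarrow> cont_on I U g \<Longrightarrow> cont_on I U (\<lambda>v. f v + g v)"
  unfolding cont_on_def by (rule continuous_map_add)

lemma cont_on_mult: "cont_on I U f \<Longrightarrow> cont_on I U g \<Longrightarrow> cont_on I U (\<lambda>v. f v * g v)"
  unfolding cont_on_def by (rule continuous_map_real_mult)

lemma cont_on_map:
  assumes "ropen I U" "\<And>j. j \<in> J \<Longrightarrow> cont_on I U (\<lambda>v. F v j)"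
    and "\<And>v. v \<in> U \<Longrightarrow> F v \<in> euc J"
  shows "continuous_map (subtopology (powertop_real I) U) (powertop_real J) F"
  using assms topspace_subtopology_powertop[OF assms(1)]
  by (auto simp: continuous_map_componentwise cont_on_def PiE_def)

lemma cont_on_compose:
  assumes U: "ropen I U" and V: "ropen J V"
    and F: "\<And>j. j \<in> J \<Longrightarrow> cont_on I U (\<lambda>v. F v j)" "\<And>v. v \<in> U \<Longrightarrow> F v \<in> V"
    and g: "cont_on J V g"
  shows "cont_on I U (\<lambda>v. g (F v))"
proof -
  have "continuous_map (subtopology (powertop_real I) U) (powertop_real J) F"
    by (rule cont_on_map[OF U]) (use F openin_powertop_extensional[OF V] in auto)
  then have "continuous_map (subtopology (powertop_real I) U) (subtopology (powertop_real J) V) F"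
    using F(2) topspace_subtopology_powertop[OF U]
    by (intro continuous_map_into_subtopology) auto
  then show ?thesis
    using continuous_map_compose[of _ _ F _ g] g unfolding cont_on_def o_def by blast
qed

lemma openin_preimage:
  assumes U: "ropen I U" and S: "ropen J S"
    and F: "\<And>j. j \<in> J \<Longrightarrow> cont_on I U (\<lambda>v. F v j)" "\<And>v. v \<in> U \<Longrightarrow> F v \<in> euc J"
  shows "ropen I {v \<in> U. F v \<in> S}"
  using openin_continuous_map_preimage[OF cont_on_map[OF U F] S] openin_trans_full[OF _ U]
  unfolding topspace_subtopology_powertop[OF U] by blast

lemma cont_on_local:
  assumes "\<And>v. v \<in> U \<Longrightarrow> \<exists>S. ropen I S \<and> v \<in> S \<and> cont_on I S f"
    and U: "ropen I U"
  shows "cont_on I U f"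
proof -
  have "ropen I {v \<in> U. f v \<in> T}" if T: "open T" for T
  proof (subst openin_subopen, intro ballI)
    fix v assume v: "v \<in> {v \<in> U. f v \<in> T}"
    then obtain S where S: "ropen I S" "v \<in> S" "cont_on I S f"
      using assms(1) by blast
    have "ropen I {w \<in> S. f w \<in> T}"
      using openin_continuous_map_preimage[OF S(3)[unfolded cont_on_def], of T] T
        openin_trans_full[OF _ S(1)]
      unfolding topspace_subtopology_powertop[OF S(1)] by simp
    then have "ropen I (U \<inter> {w \<in> S. f w \<in> T})" using U by blast
    then show "\<exists>S. ropen I S \<and> v \<in> S \<and> S \<subseteq> {v \<in> U. f v \<in> T}"
      using v S(2) by blast
  qed
  then show ?thesis
    using topspace_subtopology_powertop[OF U]
    by (auto simp: cont_on_def continuous_map_def openin_open_subtopology[OF U])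
qed

lemma box_at_uniform:
  assumes "finite A" "\<And>i. i \<in> A \<Longrightarrow> \<exists>d>0. \<forall>w\<in>box_at I v d. P i w"
  shows "\<exists>d>0. \<forall>i\<in>A. \<forall>w\<in>box_at I v d. P i w"
  using assms
proof (induction A)
  case empty
  then show ?case by (intro exI[of _ 1]) simp
next
  case (insert a A)
  obtain d where d: "d > 0" "\<forall>i\<in>A. \<forall>w\<in>box_at I v d. P i w" using insert by blast
  obtain d' where d': "d' > 0" "\<forall>w\<in>box_at I v d'. P a w" using insert.prems[of a] by blast
  have "\<forall>i\<in>insert a A. \<forall>w\<in>box_at I v (min d d'). P i w"
    using d(2) d'(2) box_at_mono[of "min d d'" d I v] box_at_mono[of "min d d'" d' I v] by auto
  then show ?case using d(1) d'(1) by (intro exI[of _ "min d d'"]) auto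
qed

section \<open>C^k functions, the total differential and the chain rule\<close>

lemma Ck_on_cont_on: "Ck_on k I U f \<Longrightarrow> cont_on I U f"
  by (cases k) (auto simp: cont_on_def)

lemma Ck_on_Suc_iff: "Ck_on (Suc k) I U f \<longleftrightarrow> cont_on I U f \<and>
     (\<forall>i\<in>I. (\<forall>v\<in>U. (\<lambda>t. f (v(i := t))) field_differentiable (at (v i))) \<and>
             Ck_on k I U (partial i f))"
  by (simp add: cont_on_def)

lemma Ck_on_0_iff: "Ck_on 0 I U f \<longleftrightarrow> cont_on I U f"
  by (simp add: cont_on_def)

text \<open>Formulated at an arbitrary point of the coordinate line through \<open>w\<close>,
  because the mean value arguments below differentiate along whole segments of such lines.\<close>

lemma partial_has_derivative:
  assumes "Ck_on (Suc k) I U f" "i \<in> I" "w(i := s) \<in> U"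
  shows "((\<lambda>t. f (w(i := t))) has_real_derivative partial i f (w(i := s))) (at s)"
proof -
  have "(\<lambda>t. f ((w(i := s))(i := t))) field_differentiable (at ((w(i := s)) i))"
    using assms by fastforce
  then show ?thesis
    unfolding partial_def by (simp add: DERIV_deriv_iff_field_differentiable)
qed

lemma partial_eqI:
  "((\<lambda>t. f (v(i := t))) has_real_derivative D) (at (v i)) \<Longrightarrow> partial i f v = D"
  unfolding partial_def by (rule DERIV_imp_deriv)

lemma partial_has_derivative_at:
  assumes "Ck_on (Suc k) I U f" "i \<in> I" "v \<in> U"
  shows "((\<lambda>t. f (v(i := t))) has_real_derivative partial i f v) (at (v i))"
  using partial_has_derivative[of k I U f i v "v i"] assms unfolding fun_upd_triv by blast

declare Ck_on.simps [simp del]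

text \<open>Continuous partial derivatives give total differentiability: pass from \<open>v\<close>
  to \<open>w\<close> changing one coordinate at a time, and bound each change by the mean value
  inequality, since the partial derivatives vary by less than \<open>e\<close> on a small
  cube.\<close>

lemma total_differential_approx:
  assumes I: "finite I" and U: "ropen I U" and f: "Ck_on (Suc 0) I U f"
    and v: "v \<in> U" and e: "e > 0"
  shows "\<exists>d>0. \<forall>w\<in>box_at I v d.
    \<bar>f w - f v - (\<Sum>i\<in>I. partial i f v * (w i - v i))\<bar> \<le> e * (\<Sum>i\<in>I. \<bar>w i - v i\<bar>)"
proof -
  have "\<exists>d>0. \<forall>w\<in>box_at I v d. w \<in> U \<and> \<bar>partial i f w - partial i f v\<bar> < e" if "i \<in> I" for i
  proof -
    have "cont_on I U (partial i f)" using f that by (simp add: Ck_on_Suc_iff Ck_on_0_iff)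
    from cont_onD[OF I U this v e] show ?thesis by blast
  qed
  from box_at_uniform[where P = "\<lambda>i w. w \<in> U \<and> \<bar>partial i f w - partial i f v\<bar> < e", OF I this]
  obtain d where d: "d > 0"
    "\<And>i w. i \<in> I \<Longrightarrow> w \<in> box_at I v d \<Longrightarrow> w \<in> U \<and> \<bar>partial i f w - partial i f v\<bar> < e" by blast
  \<comment> \<open>Induction on the set \<open>A\<close> of coordinates in which \<open>w\<close>
    may differ from \<open>v\<close>; the case \<open>A = I\<close> is the claim.\<close>
  have "\<forall>w\<in>box_at I v d. (\<forall>i\<in>I - A. w i = v i) \<longrightarrow>
    \<bar>f w - f v - (\<Sum>i\<in>A. partial i f v * (w i - v i))\<bar> \<le> e * (\<Sum>i\<in>A. \<bar>w i - v i\<bar>)"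
    if "A \<subseteq> I" for A
    using finite_subset[OF that I] that
  proof (induction A)
    case empty
    have "w = v" if "w \<in> box_at I v d" "\<forall>i\<in>I. w i = v i" for w
      using that openin_powertop_extensional[OF U v]
      by (intro PiE_ext[of w I "\<lambda>_. UNIV" v]) (auto simp: box_at_def)
    then show ?case by auto
  next
    case (insert a A)
    have a: "a \<in> I" using insert.prems by simp
    show ?case
    proof (intro ballI impI)
      fix w assume w: "w \<in> box_at I v d" and wA: "\<forall>i\<in>I - insert a A. w i = v i"
      have upd: "w(a := t) \<in> box_at I v d" if "t \<in> ball (v a) d" for t
        using w that a by (auto simp: box_at_def dist_real_def abs_minus_commute PiE_iff extensional_def)
      \<comment> \<open>The mean value inequality is applied to \<open>f\<close> minus its linear
        part in direction \<open>a\<close>, whose derivative is the deviation of the partial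
        derivative from its value at \<open>v\<close>.\<close>
      have "norm ((f (w(a := w a)) - partial a f v * w a) - (f (w(a := v a)) - partial a f v * v a))
          \<le> e * norm (w a - v a)"
      proof (rule field_differentiable_bound[of "ball (v a) d" "\<lambda>t. f (w(a := t)) - partial a f v * t"
            "\<lambda>t. partial a f (w(a := t)) - partial a f v" e "w a" "v a"])
        show "((\<lambda>t. f (w(a := t)) - partial a f v * t) has_field_derivative
            partial a f (w(a := t)) - partial a f v) (at t within ball (v a) d)"
          if "t \<in> ball (v a) d" for t
          using partial_has_derivative[OF f a, of w t] d(2)[OF a upd[OF that]]
          by (auto intro!: derivative_eq_intros intro: has_field_derivative_at_within)
        show "norm (partial a f (w(a := t)) - partial a f v) \<le> e" if "t \<in> ball (v a) d" for t
          using d(2)[OF a upd[OF that]] by simp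
      qed (use w a d(1) in \<open>auto simp: box_at_def dist_real_def abs_minus_commute\<close>)
      then have 1: "\<bar>f w - f (w(a := v a)) - partial a f v * (w a - v a)\<bar> \<le> e * \<bar>w a - v a\<bar>"
        by (simp add: algebra_simps)
      have "\<bar>f (w(a := v a)) - f v - (\<Sum>i\<in>A. partial i f v * ((w(a := v a)) i - v i))\<bar>
          \<le> e * (\<Sum>i\<in>A. \<bar>(w(a := v a)) i - v i\<bar>)"
        using insert upd[of "v a"] d(1) wA by auto
      then have 2: "\<bar>f (w(a := v a)) - f v - (\<Sum>i\<in>A. partial i f v * (w i - v i))\<bar>
          \<le> e * (\<Sum>i\<in>A. \<bar>w i - v i\<bar>)"
      proof -
        have "(w(a := v a)) i = w i" if "i \<in> A" for i using that insert.hyps(2) by auto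
        then show ?thesis using \<open>\<bar>f (w(a := v a)) - f v - _\<bar> \<le> _\<close> by (simp cong: sum.cong)
      qed
      show "\<bar>f w - f v - (\<Sum>i\<in>insert a A. partial i f v * (w i - v i))\<bar>
          \<le> e * (\<Sum>i\<in>insert a A. \<bar>w i - v i\<bar>)"
        using 1 2 insert.hyps by (simp add: distrib_left)
    qed
  qed
  from this[of I] show ?thesis using d(1) by auto
qed

text \<open>The remainder of the linear approximation, divided by \<open>t - t0\<close>, is at most
  a small constant times the sum of the difference quotients of the components, and these stay
  bounded because they converge.\<close>

lemma chain_rule_curve:
  assumes I: "finite I" and U: "ropen I U" and f: "Ck_on (Suc 0) I U f"
    and F0: "F t0 \<in> U" and F: "eventually (\<lambda>t. F t \<in> euc I) (at t0)"
    and D: "\<And>i. i \<in> I \<Longrightarrow> ((\<lambda>t. F t i) has_real_derivative D i) (at t0)"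
  shows "((\<lambda>t. f (F t)) has_real_derivative (\<Sum>i\<in>I. partial i f (F t0) * D i)) (at t0)"
proof -
  define q where "q i t = (F t i - F t0 i) / (t - t0)" for i t
  have q: "(q i \<longlongrightarrow> D i) (at t0)" if "i \<in> I" for i
    using D[OF that] unfolding has_field_derivative_iff q_def .
  define p where "p i = partial i f (F t0)" for i
  have "((\<lambda>t. (f (F t) - f (F t0)) / (t - t0) - (\<Sum>i\<in>I. p i * q i t)) \<longlongrightarrow> 0) (at t0)"
  proof (rule tendstoI)
    fix e :: real assume e: "e > 0"
    \<comment> \<open>The summand 1 makes \<open>B\<close> positive and strictly larger than the
      limit of the summed difference quotients; tolerance \<open>e / (2 * B)\<close> then leaves an
      error of at most \<open>e / 2\<close>.\<close>
    define B where "B = (\<Sum>i\<in>I. \<bar>D i\<bar>) + 1"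
    have B: "B > 0" unfolding B_def by (intro add_nonneg_pos sum_nonneg) auto
    obtain d where d: "d > 0" "\<And>w. w \<in> box_at I (F t0) d \<Longrightarrow>
      \<bar>f w - f (F t0) - (\<Sum>i\<in>I. p i * (w i - F t0 i))\<bar> \<le> e / (2 * B) * (\<Sum>i\<in>I. \<bar>w i - F t0 i\<bar>)"
      using total_differential_approx[OF I U f F0, of "e / (2 * B)"] e B
      unfolding p_def by auto
    have "((\<lambda>t. \<Sum>i\<in>I. \<bar>q i t\<bar>) \<longlongrightarrow> (\<Sum>i\<in>I. \<bar>D i\<bar>)) (at t0)"
      by (intro tendsto_intros q)
    then have ev1: "eventually (\<lambda>t. (\<Sum>i\<in>I. \<bar>q i t\<bar>) < B) (at t0)"
      by (rule order_tendstoD) (simp add: B_def)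
    have "eventually (\<lambda>t. \<bar>F t i - F t0 i\<bar> < d) (at t0)" if "i \<in> I" for i
    proof -
      have "((\<lambda>t. F t i) \<longlongrightarrow> F t0 i) (at t0)"
        using DERIV_isCont[OF D[OF that]] by (simp add: isCont_def)
      from tendstoD[OF this d(1)] show ?thesis by (simp add: dist_real_def)
    qed
    then have "eventually (\<lambda>t. \<forall>i\<in>I. \<bar>F t i - F t0 i\<bar> < d) (at t0)"
      using I by (simp add: eventually_ball_finite)
    with F have ev2: "eventually (\<lambda>t. F t \<in> box_at I (F t0) d) (at t0)"
      by eventually_elim (simp add: box_at_def)
    have ev3: "eventually (\<lambda>t. t \<noteq> t0) (at t0)" by (rule eventually_neq_at_within)
    show "eventually (\<lambda>t. dist ((f (F t) - f (F t0)) / (t - t0) - (\<Sum>i\<in>I. p i * q i t)) 0 < e) (at t0)"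
      using ev1 ev2 ev3
    proof eventually_elim
      fix t assume t: "(\<Sum>i\<in>I. \<bar>q i t\<bar>) < B" "F t \<in> box_at I (F t0) d" "t \<noteq> t0"
      have 1: "(f (F t) - f (F t0)) / (t - t0) - (\<Sum>i\<in>I. p i * q i t)
          = (f (F t) - f (F t0) - (\<Sum>i\<in>I. p i * (F t i - F t0 i))) / (t - t0)"
        by (simp add: q_def diff_divide_distrib[of "f (F t) - f (F t0)"] sum_divide_distrib)
      have 2: "(\<Sum>i\<in>I. \<bar>F t i - F t0 i\<bar>) = (\<Sum>i\<in>I. \<bar>q i t\<bar>) * \<bar>t - t0\<bar>"
        using t(3) by (simp add: q_def sum_distrib_right)
      have "\<bar>f (F t) - f (F t0) - (\<Sum>i\<in>I. p i * (F t i - F t0 i))\<bar>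
          \<le> (e / (2 * B) * (\<Sum>i\<in>I. \<bar>q i t\<bar>)) * \<bar>t - t0\<bar>"
        using d(2)[OF t(2)] unfolding 2 by (simp add: mult.assoc)
      then have "\<bar>(f (F t) - f (F t0)) / (t - t0) - (\<Sum>i\<in>I. p i * q i t)\<bar>
          \<le> e / (2 * B) * (\<Sum>i\<in>I. \<bar>q i t\<bar>)"
        unfolding 1 abs_divide using t(3) by (simp add: pos_divide_le_eq)
      also have "\<dots> \<le> e / (2 * B) * B"
        using t(1) e B by (intro mult_left_mono) auto
      also have "\<dots> < e" using e B by simp
      finally show "dist ((f (F t) - f (F t0)) / (t - t0) - (\<Sum>i\<in>I. p i * q i t)) 0 < e" by simp
    qed
  qed
  moreover have "((\<lambda>t. \<Sum>i\<in>I. p i * q i t) \<longlongrightarrow> (\<Sum>i\<in>I. p i * D i)) (at t0)"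
    by (intro tendsto_intros q)
  ultimately have "((\<lambda>t. (f (F t) - f (F t0)) / (t - t0)) \<longlongrightarrow> (\<Sum>i\<in>I. p i * D i)) (at t0)"
    by (rule Lim_transform[rotated])
  then show ?thesis unfolding has_field_derivative_iff p_def .
qed

lemma partial_cong:
  assumes "finite I" "ropen I U" "\<And>v. v \<in> U \<Longrightarrow> f v = g v" "i \<in> I" "v \<in> U"
  shows "partial i f v = partial i g v"
  unfolding partial_def
  by (rule deriv_cong_ev[OF _ refl])
    (use openin_powertop_curve[OF assms(1,2,5,4)] assms(3) in \<open>auto elim: eventually_mono\<close>)

lemma Ck_on_SucI:
  assumes "finite I" "ropen I U" "cont_on I U f"
    and "\<And>i v. i \<in> I \<Longrightarrow> v \<in> U \<Longrightarrow> ((\<lambda>t. f (v(i := t))) has_real_derivative h i v) (at (v i))"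
    and "\<And>i. i \<in> I \<Longrightarrow> Ck_on k I U (partial i f)"
  shows "Ck_on (Suc k) I U f"
  using assms unfolding Ck_on_Suc_iff field_differentiable_def by blast

text \<open>Functions are total while only their values on \<open>U\<close> carry meaning. As
  \<open>U\<close> is open, coordinate lines stay in \<open>U\<close> near each of its points, so
  the partial derivatives on \<open>U\<close> also see those values alone and the induction on
  \<open>k\<close> proceeds.\<close>

lemma Ck_on_cong:
  assumes I: "finite I" and U: "ropen I U"
  shows "(\<And>v. v \<in> U \<Longrightarrow> f v = g v) \<Longrightarrow> Ck_on k I U f \<Longrightarrow> Ck_on k I U g"
proof (induction k arbitrary: f g)
  case 0
  then show ?case using cont_on_cong[of U f g I] by (simp add: Ck_on_0_iff)
next
  case (Suc k)
  show ?case
  proof (rule Ck_on_SucI[OF I U, where h = "\<lambda>i. partial i f"])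
    show "cont_on I U g" using Suc.prems cont_on_cong[of U f g I] by (simp add: Ck_on_Suc_iff)
    show "Ck_on k I U (partial i g)" if "i \<in> I" for i
      using Suc.IH[of "partial i f" "partial i g"] Suc.prems partial_cong[OF I U Suc.prems(1)] that
      by (simp add: Ck_on_Suc_iff)
    fix i v assume iv: "i \<in> I" "v \<in> U"
    have "((\<lambda>t. f (v(i := t))) has_real_derivative partial i f v) (at (v i))"
      using partial_has_derivative_at[OF Suc.prems(2) iv] .
    moreover have "eventually (\<lambda>t. f (v(i := t)) = g (v(i := t))) (nhds (v i))"
      using openin_powertop_curve[OF I U iv(2,1)] by eventually_elim (rule Suc.prems(1))
    ultimately show "((\<lambda>t. g (v(i := t))) has_real_derivative partial i f v) (at (v i))"
      by (subst (asm) DERIV_cong_ev[OF refl _ refl])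
  qed
qed

lemma Ck_on_Suc_imp: "Ck_on (Suc k) I U f \<Longrightarrow> Ck_on k I U f"
proof (induction k arbitrary: f)
  case 0
  then show ?case by (simp add: Ck_on_Suc_iff Ck_on_0_iff)
next
  case (Suc k)
  then show ?case unfolding Ck_on_Suc_iff[of "Suc k"] Ck_on_Suc_iff[of k] by blast
qed

lemma Ck_on_mono_order: "k \<le> l \<Longrightarrow> Ck_on l I U f \<Longrightarrow> Ck_on k I U f"
  by (induction rule: inc_induct) (auto intro: Ck_on_Suc_imp)

lemma Ck_on_subset: "Ck_on k I U f \<Longrightarrow> V \<subseteq> U \<Longrightarrow> Ck_on k I V f"
proof (induction k arbitrary: f)
  case 0
  then show ?case by (simp add: Ck_on_0_iff cont_on_subset)
next
  case (Suc k)
  then show ?case unfolding Ck_on_Suc_iff by (blast intro: cont_on_subset)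
qed

lemma Ck_on_local:
  assumes U: "ropen I U"
  shows "(\<And>v. v \<in> U \<Longrightarrow> \<exists>S. ropen I S \<and> v \<in> S \<and> Ck_on k I S f) \<Longrightarrow> Ck_on k I U f"
proof (induction k arbitrary: f)
  case 0
  then show ?case using cont_on_local[OF _ U] by (simp add: Ck_on_0_iff)
next
  case (Suc k)
  have "cont_on I U f" by (rule cont_on_local[OF _ U]) (use Suc.prems in \<open>fastforce simp: Ck_on_Suc_iff\<close>)
  then show ?case using Suc unfolding Ck_on_Suc_iff by metis
qed

lemma partial_const: "partial i (\<lambda>v. c) = (\<lambda>v. 0)"
  unfolding partial_def by simp

lemma Ck_on_const: "finite I \<Longrightarrow> ropen I U \<Longrightarrow> Ck_on k I U (\<lambda>v. c)"
  by (induction k arbitrary: c)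
    (auto simp: Ck_on_0_iff Ck_on_Suc_iff cont_on_const partial_const)

lemma coord_has_derivative:
  "((\<lambda>t. (v(i := t)) j) has_real_derivative (if i = j then 1 else 0)) (at s)"
  by auto

lemma Ck_on_coord:
  assumes "finite I" "ropen I U" "j \<in> I"
  shows "Ck_on k I U (\<lambda>v. v j)"
proof (cases k)
  case 0
  then show ?thesis using assms by (simp add: Ck_on_0_iff cont_on_coord)
next
  case (Suc k')
  have "partial i (\<lambda>v. v j) = (\<lambda>v. if i = j then 1 else 0)" for i :: 'a
    by (rule ext, rule partial_eqI[OF coord_has_derivative])
  then show ?thesis unfolding Suc using assms coord_has_derivative
    by (intro Ck_on_SucI[where h = "\<lambda>i v. if i = j then 1 else 0"])
      (auto intro: Ck_on_const cont_on_coord)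
qed

lemma Ck_on_add:
  assumes I: "finite I" and U: "ropen I U"
  shows "Ck_on k I U f \<Longrightarrow> Ck_on k I U g \<Longrightarrow> Ck_on k I U (\<lambda>v. f v + g v)"
proof (induction k arbitrary: f g)
  case 0
  then show ?case by (simp add: Ck_on_0_iff cont_on_add)
next
  case (Suc k)
  have D: "((\<lambda>t. f (v(i := t)) + g (v(i := t))) has_real_derivative partial i f v + partial i g v) (at (v i))"
    if "i \<in> I" "v \<in> U" for i v
    using partial_has_derivative_at[OF Suc.prems(1) that] partial_has_derivative_at[OF Suc.prems(2) that]
    by (rule DERIV_add)
  show ?case
  proof (rule Ck_on_SucI[OF I U _ D])
    show "cont_on I U (\<lambda>v. f v + g v)" using Suc.prems by (simp add: Ck_on_Suc_iff cont_on_add)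
    fix i assume i: "i \<in> I"
    have "Ck_on k I U (\<lambda>v. partial i f v + partial i g v)"
      using Suc i by (simp add: Ck_on_Suc_iff)
    then show "Ck_on k I U (partial i (\<lambda>v. f v + g v))"
      by (rule Ck_on_cong[OF I U, rotated]) (rule partial_eqI[OF D[OF i], symmetric])
  qed auto
qed

lemma partial_mult:
  assumes "Ck_on (Suc k) I U f" "Ck_on (Suc k) I U g" "i \<in> I" "v \<in> U"
  shows "((\<lambda>t. f (v(i := t)) * g (v(i := t))) has_real_derivative
    partial i f v * g v + f v * partial i g v) (at (v i))"
  using DERIV_mult[OF partial_has_derivative_at[OF assms(1,3,4)] partial_has_derivative_at[OF assms(2,3,4)]]
  by (simp only: fun_upd_triv add.commute mult.commute)

lemma Ck_on_mult:
  assumes I: "finite I" and U: "ropen I U"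
  shows "Ck_on k I U f \<Longrightarrow> Ck_on k I U g \<Longrightarrow> Ck_on k I U (\<lambda>v. f v * g v)"
proof (induction k arbitrary: f g)
  case 0
  then show ?case by (simp add: Ck_on_0_iff cont_on_mult)
next
  case (Suc k)
  note D = partial_mult[OF Suc.prems]
  show ?case
  proof (rule Ck_on_SucI[OF I U _ D])
    show "cont_on I U (\<lambda>v. f v * g v)" using Suc.prems by (simp add: Ck_on_Suc_iff cont_on_mult)
    fix i assume i: "i \<in> I"
    have "Ck_on k I U (\<lambda>v. partial i f v * g v + f v * partial i g v)"
      using Suc i Ck_on_Suc_imp[OF Suc.prems(1)] Ck_on_Suc_imp[OF Suc.prems(2)]
      by (intro Ck_on_add[OF I U] Suc.IH) (auto simp: Ck_on_Suc_iff)
    then show "Ck_on k I U (partial i (\<lambda>v. f v * g v))"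
      by (rule Ck_on_cong[OF I U, rotated]) (rule partial_eqI[OF D[OF i], symmetric])
  qed auto
qed

lemma Ck_on_sum:
  assumes I: "finite I" and U: "ropen I U" and "\<And>a. a \<in> A \<Longrightarrow> Ck_on k I U (f a)"
  shows "Ck_on k I U (\<lambda>v. \<Sum>a\<in>A. f a v)"
proof (cases "finite A")
  case True
  then show ?thesis using assms(3)
    by (induction A) (auto intro: Ck_on_const[OF I U] Ck_on_add[OF I U])
qed (simp add: Ck_on_const[OF I U])

lemma partial_compose:
  assumes I: "finite I" and U: "ropen I U"
    and J: "finite J" and V: "ropen J V"
    and F: "\<And>j. j \<in> J \<Longrightarrow> Ck_on (Suc 0) I U (\<lambda>v. F v j)" "\<And>v. v \<in> U \<Longrightarrow> F v \<in> V"
    and g: "Ck_on (Suc 0) J V g" and i: "i \<in> I" and v: "v \<in> U"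
  shows "((\<lambda>t. g (F (v(i := t)))) has_real_derivative
    (\<Sum>j\<in>J. partial j g (F v) * partial i (\<lambda>v. F v j) v)) (at (v i))"
proof -
  have "((\<lambda>t. g (F (v(i := t)))) has_real_derivative
    (\<Sum>j\<in>J. partial j g (F (v(i := v i))) * partial i (\<lambda>v. F v j) v)) (at (v i))"
  proof (rule chain_rule_curve[OF J V g])
    show "F (v(i := v i)) \<in> V" using F(2) v by simp
    have "eventually (\<lambda>t. v(i := t) \<in> U) (at (v i))"
      using openin_powertop_curve[OF I U v i] by (simp add: eventually_nhds_conv_at)
    then show "eventually (\<lambda>t. F (v(i := t)) \<in> euc J) (at (v i))"
      by eventually_elim (rule openin_powertop_extensional[OF V F(2)])
    show "((\<lambda>t. F (v(i := t)) j) has_real_derivative partial i (\<lambda>v. F v j) v) (at (v i))"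
      if "j \<in> J" for j
      using partial_has_derivative_at[OF F(1)[OF that] i v] .
  qed
  then show ?thesis by simp
qed

text \<open>By the chain rule each partial derivative of the composite is a sum of products of
  \<open>partial j g\<close> along \<open>F\<close> with partial derivatives of the components of
  \<open>F\<close>; the first factors are C^k by the induction hypothesis.\<close>

lemma Ck_on_compose:
  assumes I: "finite I" and U: "ropen I U"
    and J: "finite J" and V: "ropen J V"
    and F: "\<And>j. j \<in> J \<Longrightarrow> Ck_on k I U (\<lambda>v. F v j)" "\<And>v. v \<in> U \<Longrightarrow> F v \<in> V"
    and g: "Ck_on k J V g"
  shows "Ck_on k I U (\<lambda>v. g (F v))"
  using F(1) g
proof (induction k arbitrary: g)
  case 0
  then show ?case using F(2) by (auto simp: Ck_on_0_iff intro: cont_on_compose[OF U V])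
next
  case (Suc k)
  have F1: "Ck_on (Suc 0) I U (\<lambda>v. F v j)" if "j \<in> J" for j
    using Ck_on_mono_order[OF _ Suc.prems(1)[OF that]] by simp
  have g1: "Ck_on (Suc 0) J V g" using Ck_on_mono_order[OF _ Suc.prems(2)] by simp
  note D = partial_compose[OF I U J V F1 F(2) g1]
  show ?case
  proof (rule Ck_on_SucI[OF I U _ D])
    show "cont_on I U (\<lambda>v. g (F v))"
      using Suc.prems F(2) by (auto simp: Ck_on_Suc_iff intro: cont_on_compose[OF U V])
    fix i assume i: "i \<in> I"
    have "Ck_on k I U (\<lambda>v. \<Sum>j\<in>J. partial j g (F v) * partial i (\<lambda>v. F v j) v)"
    proof (intro Ck_on_sum[OF I U] Ck_on_mult[OF I U])
      fix j assume j: "j \<in> J"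
      show "Ck_on k I U (\<lambda>v. partial j g (F v))"
        by (rule Suc.IH[OF Ck_on_Suc_imp[OF Suc.prems(1)]])
          (use Suc.prems(2) j in \<open>auto simp: Ck_on_Suc_iff\<close>)
      show "Ck_on k I U (partial i (\<lambda>v. F v j))"
        using Suc.prems(1)[OF j] i by (simp add: Ck_on_Suc_iff)
    qed
    then show "Ck_on k I U (partial i (\<lambda>v. g (F v)))"
      by (rule Ck_on_cong[OF I U, rotated]) (rule partial_eqI[OF D[OF _ _ i], symmetric])
  qed auto
qed


section \<open>Symmetry of second partial derivatives\<close>

lemma mixed_difference:
  assumes f: "Ck_on 2 I U f" and box: "box_at I v d \<subseteq> U" and h: "0 < h" "h < d"
    and ij: "i \<in> I" "j \<in> I" "i \<noteq> j" and v: "v \<in> euc I"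
  shows "\<exists>w\<in>box_at I v d. f (v(i := v i + h, j := v j + h)) - f (v(i := v i + h))
    - f (v(j := v j + h)) + f v = h * h * partial j (partial i f) w"
proof -
  have f1: "Ck_on (Suc 0) I U f" and f2: "Ck_on (Suc 0) I U (partial i f)"
    using Ck_on_mono_order[of "Suc 0" 2 I U f] f ij(1) by (auto simp: numeral_2_eq_2 Ck_on_Suc_iff[of "Suc 0"])
  have box2: "v(i := s, j := t) \<in> box_at I v d" if "v i \<le> s" "s \<le> v i + h" "v j \<le> t" "t \<le> v j + h" for s t
    using that h v ij by (auto simp: box_at_def PiE_iff extensional_def)
  \<comment> \<open>The second difference of \<open>f\<close> over the square of side
    \<open>h\<close> is the increment of this first difference, so two mean value theorems, in
    direction \<open>i\<close> and then \<open>j\<close>, bring out the mixed derivative.\<close>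
  define \<phi> where "\<phi> s = f (v(i := s, j := v j + h)) - f (v(i := s, j := v j))" for s
  have "(\<phi> has_real_derivative (partial i f (v(i := s, j := v j + h)) - partial i f (v(i := s, j := v j)))) (at s)"
    if s: "v i \<le> s" "s \<le> v i + h" for s
  proof -
    have "v(i := s, j := t) \<in> U" if "t = v j \<or> t = v j + h" for t
      using subsetD[OF box box2[OF s]] that h by auto
    then show ?thesis
      unfolding \<phi>_def fun_upd_twist[OF ij(3)]
      by (intro DERIV_diff partial_has_derivative[OF f1 ij(1)]) blast+
  qed
  then obtain \<xi> where \<xi>: "v i < \<xi>" "\<xi> < v i + h" "\<phi> (v i + h) - \<phi> (v i) =
      h * (partial i f (v(i := \<xi>, j := v j + h)) - partial i f (v(i := \<xi>, j := v j)))"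
    using MVT2[of "v i" "v i + h" \<phi> "\<lambda>s. partial i f (v(i := s, j := v j + h)) - partial i f (v(i := s, j := v j))"] h
    by auto
  have "((\<lambda>t. partial i f (v(i := \<xi>, j := t))) has_real_derivative partial j (partial i f) (v(i := \<xi>, j := t))) (at t)"
    if t: "v j \<le> t" "t \<le> v j + h" for t
    using subsetD[OF box box2] t \<xi> by (intro partial_has_derivative[OF f2 ij(2)]) simp
  then obtain \<zeta> where \<zeta>: "v j < \<zeta>" "\<zeta> < v j + h"
      "partial i f (v(i := \<xi>, j := v j + h)) - partial i f (v(i := \<xi>, j := v j)) =
      h * partial j (partial i f) (v(i := \<xi>, j := \<zeta>))"
    using MVT2[of "v j" "v j + h" "\<lambda>t. partial i f (v(i := \<xi>, j := t))"
        "\<lambda>t. partial j (partial i f) (v(i := \<xi>, j := t))"] h by auto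
  have "v(i := v i, j := t) = v(j := t)" "v(i := s, j := v j) = v(i := s)" for s t
    using ij(3) by auto
  then have "f (v(i := v i + h, j := v j + h)) - f (v(i := v i + h)) - f (v(j := v j + h)) + f v
      = h * h * partial j (partial i f) (v(i := \<xi>, j := \<zeta>))"
    using \<xi>(3) \<zeta>(3) by (simp add: \<phi>_def algebra_simps)
  then show ?thesis using box2 \<xi> \<zeta> by (intro bexI[of _ "v(i := \<xi>, j := \<zeta>)"]) auto
qed

text \<open>The second difference is symmetric in \<open>i\<close> and \<open>j\<close>. Hence the
  two mixed derivatives share a value at some pair of points in every small cube around
  \<open>v\<close>, and continuity forces them to agree at \<open>v\<close>.\<close>

lemma partial_commute:
  assumes I: "finite I" and U: "ropen I U" and f: "Ck_on 2 I U f"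
    and ij: "i \<in> I" "j \<in> I" and v: "v \<in> U"
  shows "partial i (partial j f) v = partial j (partial i f) v"
proof (rule ccontr)
  assume ne: "partial i (partial j f) v \<noteq> partial j (partial i f) v"
  then have "i \<noteq> j" by blast
  \<comment> \<open>Half the supposed gap: each mixed derivative deviates by less than
    \<open>e\<close> from its value at \<open>v\<close>, too little for the two to meet.\<close>
  define e where "e = \<bar>partial i (partial j f) v - partial j (partial i f) v\<bar> / 2"
  have e: "e > 0" using ne by (simp add: e_def)
  have "cont_on I U (partial i (partial j f))" "cont_on I U (partial j (partial i f))"
    using f ij by (simp_all add: numeral_2_eq_2 Ck_on_Suc_iff Ck_on_0_iff)
  from cont_onD[OF I U this(1) v e] cont_onD[OF I U this(2) v e]
  obtain d1 d2 where d: "d1 > 0" "box_at I v d1 \<subseteq> U"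
      "\<forall>w\<in>box_at I v d1. \<bar>partial i (partial j f) w - partial i (partial j f) v\<bar> < e"
      "d2 > 0" "\<forall>w\<in>box_at I v d2. \<bar>partial j (partial i f) w - partial j (partial i f) v\<bar> < e"
    by blast
  define d where "d = min d1 d2"
  define h where "h = d / 2"
  have h: "0 < h" "h < d" using d(1,4) by (auto simp: h_def d_def)
  have sub: "box_at I v d \<subseteq> box_at I v d1" "box_at I v d \<subseteq> box_at I v d2"
    by (auto simp: d_def intro!: box_at_mono)
  have vE: "v \<in> euc I" using openin_powertop_extensional[OF U v] .
  have boxU: "box_at I v d \<subseteq> U" using sub d(2) by blast
  obtain w where w: "w \<in> box_at I v d" "f (v(i := v i + h, j := v j + h)) - f (v(i := v i + h))
    - f (v(j := v j + h)) + f v = h * h * partial j (partial i f) w"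
    using mixed_difference[OF f boxU h ij \<open>i \<noteq> j\<close> vE] by blast
  obtain w' where w': "w' \<in> box_at I v d" "f (v(j := v j + h, i := v i + h)) - f (v(j := v j + h))
    - f (v(i := v i + h)) + f v = h * h * partial i (partial j f) w'"
    using mixed_difference[OF f boxU h ij(2,1) \<open>i \<noteq> j\<close>[symmetric] vE] by blast
  have "h * h * partial j (partial i f) w = h * h * partial i (partial j f) w'"
    using w(2) w'(2) unfolding fun_upd_twist[OF \<open>i \<noteq> j\<close>] by linarith
  then have "partial j (partial i f) w = partial i (partial j f) w'" using h by simp
  moreover have "\<bar>partial i (partial j f) w' - partial i (partial j f) v\<bar> < e"
      "\<bar>partial j (partial i f) w - partial j (partial i f) v\<bar> < e"
    using w(1) w'(1) sub d(3,5) by blast+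
  ultimately show False by (simp add: e_def abs_if split: if_splits)
qed

section \<open>Smooth functions, iterated derivatives and agreement to order r\<close>

lemma Cinf_on_cont_on: "Cinf_on I U f \<Longrightarrow> cont_on I U f"
  unfolding Cinf_on_def using Ck_on_cont_on by blast

lemma Cinf_on_eq:
  assumes "finite I" "ropen I U" "Cinf_on I U f" "\<And>v. v \<in> U \<Longrightarrow> f v = g v"
  shows "Cinf_on I U g"
  using assms(3) Ck_on_cong[OF assms(1,2), of f g] assms(4) unfolding Cinf_on_def by simp

lemma Cinf_on_subset: "Cinf_on I U f \<Longrightarrow> V \<subseteq> U \<Longrightarrow> Cinf_on I V f"
  unfolding Cinf_on_def using Ck_on_subset by blast

lemma Cinf_on_local:
  assumes "ropen I U"
    "\<And>v. v \<in> U \<Longrightarrow> \<exists>S. ropen I S \<and> v \<in> S \<and> Cinf_on I S f"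
  shows "Cinf_on I U f"
  using assms(2) Ck_on_local[OF assms(1)] unfolding Cinf_on_def by metis

lemma Cinf_on_const: "finite I \<Longrightarrow> ropen I U \<Longrightarrow> Cinf_on I U (\<lambda>v. c)"
  unfolding Cinf_on_def by (simp add: Ck_on_const)

lemma Cinf_on_coord: "finite I \<Longrightarrow> ropen I U \<Longrightarrow> i \<in> I \<Longrightarrow> Cinf_on I U (\<lambda>v. v i)"
  unfolding Cinf_on_def by (simp add: Ck_on_coord)

lemma Cinf_on_compose:
  assumes "finite I" "ropen I U" "finite J" "ropen J V"
    and "\<And>j. j \<in> J \<Longrightarrow> Cinf_on I U (\<lambda>v. F v j)" "\<And>v. v \<in> U \<Longrightarrow> F v \<in> V" "Cinf_on J V g"
  shows "Cinf_on I U (\<lambda>v. g (F v))"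
  using assms Ck_on_compose[OF assms(1-4)] unfolding Cinf_on_def by simp

lemma Cinf_on_partial: "Cinf_on I U f \<Longrightarrow> i \<in> I \<Longrightarrow> Cinf_on I U (partial i f)"
  unfolding Cinf_on_def by (metis Ck_on_Suc_iff)

lemma Cinf_on_foldr_partial:
  "Cinf_on I U f \<Longrightarrow> set l \<subseteq> I \<Longrightarrow> Cinf_on I U (foldr partial l f)"
  by (induction l) (auto intro: Cinf_on_partial)

lemma foldr_partial_cong:
  assumes "finite I" "ropen I U" "\<And>v. v \<in> U \<Longrightarrow> f v = g v"
  shows "set l \<subseteq> I \<Longrightarrow> v \<in> U \<Longrightarrow> foldr partial l f v = foldr partial l g v"
  using assms(3) by (induction l arbitrary: v) (auto intro!: partial_cong[OF assms(1,2)])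

text \<open>\<open>insort\<close> carries \<open>i\<close> past the smaller entries of the list, and
  each passage is one exchange of two derivatives.\<close>

lemma foldr_partial_insort:
  assumes I: "finite I" and U: "ropen I U" and f: "Cinf_on I U f"
  shows "set l \<subseteq> I \<Longrightarrow> i \<in> I \<Longrightarrow> v \<in> U \<Longrightarrow>
    foldr partial (insort i l) f v = partial i (foldr partial l f) v"
proof (induction l arbitrary: v)
  case (Cons a l)
  show ?case
  proof (cases "i \<le> a")
    case False
    have "foldr partial (insort i (a # l)) f v = partial a (foldr partial (insort i l) f) v"
      using False by simp
    also have "\<dots> = partial a (partial i (foldr partial l f)) v"
      using Cons by (intro partial_cong[OF I U]) auto
    also have "\<dots> = partial i (partial a (foldr partial l f)) v"
      using Cons.prems Cinf_on_foldr_partial[OF f, of l]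
      by (intro partial_commute[OF I U]) (auto simp: Cinf_on_def)
    finally show ?thesis by simp
  qed simp
qed simp

lemma foldr_partial_sort:
  assumes I: "finite I" and U: "ropen I U" and f: "Cinf_on I U f"
  shows "set l \<subseteq> I \<Longrightarrow> v \<in> U \<Longrightarrow> foldr partial (sort l) f v = foldr partial l f v"
proof (induction l arbitrary: v)
  case (Cons i l)
  have "foldr partial (sort (i # l)) f v = partial i (foldr partial (sort l) f) v"
    using Cons.prems foldr_partial_insort[OF I U f, of "sort l" i v] by simp
  also have "\<dots> = partial i (foldr partial l f) v"
    using Cons by (intro partial_cong[OF I U]) auto
  finally show ?case by simp
qed simp

text \<open>Derivatives are indexed by lists in any order, not by sorted multi-indices as in
  \<open>jet_eq\<close>, so that the relation is recursive in the order: a derivative can be split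
  off without restoring sortedness.\<close>

definition same_jet :: "'i set \<Rightarrow> nat \<Rightarrow> ('i \<Rightarrow> real) \<Rightarrow>
    (('i \<Rightarrow> real) \<Rightarrow> real) \<Rightarrow> (('i \<Rightarrow> real) \<Rightarrow> real) \<Rightarrow> bool" where
  "same_jet I r v f g \<longleftrightarrow>
     (\<forall>l. set l \<subseteq> I \<and> length l \<le> r \<longrightarrow> foldr partial l f v = foldr partial l g v)"

lemma same_jet_refl: "same_jet I r v f f"
  by (simp add: same_jet_def)

lemma same_jet_value: "same_jet I r v f g \<Longrightarrow> f v = g v"
  unfolding same_jet_def by (drule spec[of _ "[]"]) simp

lemma same_jet_foldr:
  assumes "same_jet I (length l + r) v f g" "set l \<subseteq> I"
  shows "same_jet I r v (foldr partial l f) (foldr partial l g)"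
  unfolding same_jet_def
proof (intro allI impI)
  fix l' assume "set l' \<subseteq> I \<and> length l' \<le> r"
  then show "foldr partial l' (foldr partial l f) v = foldr partial l' (foldr partial l g) v"
    using assms(1)[unfolded same_jet_def, rule_format, of "l' @ l"] assms(2) by simp
qed

lemma same_jet_mono: "same_jet I r v f g \<Longrightarrow> s \<le> r \<Longrightarrow> same_jet I s v f g"
  unfolding same_jet_def by auto

lemma same_jet_Suc_iff:
  "same_jet I (Suc r) v f g \<longleftrightarrow> f v = g v \<and> (\<forall>i\<in>I. same_jet I r v (partial i f) (partial i g))"
proof (intro iffI conjI ballI)
  assume "same_jet I (Suc r) v f g"
  then show "f v = g v" by (rule same_jet_value)
  show "same_jet I r v (partial i f) (partial i g)" if "i \<in> I" for i
    using same_jet_foldr[of I "[i]" r v f g] that \<open>same_jet I (Suc r) v f g\<close> by simp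
next
  assume R: "f v = g v \<and> (\<forall>i\<in>I. same_jet I r v (partial i f) (partial i g))"
  show "same_jet I (Suc r) v f g"
    unfolding same_jet_def
  proof (intro allI impI)
    fix l assume l: "set l \<subseteq> I \<and> length l \<le> Suc r"
    show "foldr partial l f v = foldr partial l g v"
    \<comment> \<open>\<open>foldr\<close> applies the last entry of the list first, so the
      derivative that acts directly on the function is split off at the end.\<close>
    proof (cases l rule: rev_cases)
      case Nil
      then show ?thesis using R by simp
    next
      case (snoc l' i)
      then show ?thesis using R l unfolding same_jet_def by simp
    qed
  qed
qed

lemma same_jet_cong:
  assumes "finite I" "ropen I U" "v \<in> U"
    and "\<And>v. v \<in> U \<Longrightarrow> f v = f' v" "\<And>v. v \<in> U \<Longrightarrow> g v = g' v"
  shows "same_jet I r v f g \<longleftrightarrow> same_jet I r v f' g'"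
  unfolding same_jet_def
  using foldr_partial_cong[OF assms(1,2,4) _ assms(3)] foldr_partial_cong[OF assms(1,2,5) _ assms(3)]
  by auto

lemma same_jet_transfer:
  assumes "finite I" "ropen I U" "v \<in> U" "same_jet I r v f g"
    and "\<And>v. v \<in> U \<Longrightarrow> f v = f' v" "\<And>v. v \<in> U \<Longrightarrow> g v = g' v"
  shows "same_jet I r v f' g'"
  using same_jet_cong[OF assms(1-3), of f f' g g' r] assms(4-6) by simp

lemma same_jet_eqI:
  assumes "finite I" "ropen I U" "v \<in> U" "\<And>v. v \<in> U \<Longrightarrow> f v = g v"
  shows "same_jet I r v f g"
  using same_jet_transfer[OF assms(1-3) same_jet_refl, of f f g r] assms(4) by simp

lemma same_jet_add:
  assumes I: "finite I" and U: "ropen I U" and v: "v \<in> U"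
  shows "Cinf_on I U f \<Longrightarrow> Cinf_on I U f' \<Longrightarrow> Cinf_on I U g \<Longrightarrow> Cinf_on I U g' \<Longrightarrow>
    same_jet I r v f f' \<Longrightarrow> same_jet I r v g g' \<Longrightarrow>
    same_jet I r v (\<lambda>v. f v + g v) (\<lambda>v. f' v + g' v)"
proof (induction r arbitrary: f f' g g')
  case 0
  then show ?case by (simp add: same_jet_def)
next
  case (Suc r)
  have D: "partial i (\<lambda>v. p v + q v) w = partial i p w + partial i q w"
    if "Cinf_on I U p" "Cinf_on I U q" "i \<in> I" "w \<in> U" for p q i w
    using that by (intro partial_eqI DERIV_add partial_has_derivative_at[of 0 I U]) (auto simp: Cinf_on_def)
  show ?case unfolding same_jet_Suc_iff
  proof (intro conjI ballI)
    show "f v + g v = f' v + g' v" using Suc.prems same_jet_value by metis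
    fix i assume i: "i \<in> I"
    have "same_jet I r v (\<lambda>v. partial i f v + partial i g v) (\<lambda>v. partial i f' v + partial i g' v)"
      using Suc.prems i by (intro Suc.IH Cinf_on_partial) (auto simp: same_jet_Suc_iff)
    then show "same_jet I r v (partial i (\<lambda>v. f v + g v)) (partial i (\<lambda>v. f' v + g' v))"
      by (subst same_jet_cong[OF I U v]) (use D Suc.prems i in auto)
  qed
qed

lemma same_jet_sum:
  assumes I: "finite I" and U: "ropen I U" and v: "v \<in> U" and "finite A"
    and "\<And>a. a \<in> A \<Longrightarrow> Cinf_on I U (f a)" "\<And>a. a \<in> A \<Longrightarrow> Cinf_on I U (g a)"
    and "\<And>a. a \<in> A \<Longrightarrow> same_jet I r v (f a) (g a)"
  shows "same_jet I r v (\<lambda>v. \<Sum>a\<in>A. f a v) (\<lambda>v. \<Sum>a\<in>A. g a v)"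
  using assms(4-)
proof (induction A)
  case (insert a A)
  have "Cinf_on I U (\<lambda>v. \<Sum>a\<in>A. f a v)" "Cinf_on I U (\<lambda>v. \<Sum>a\<in>A. g a v)"
    using insert.prems by (simp_all add: Cinf_on_def Ck_on_sum[OF I U])
  then show ?case using insert by (auto intro: same_jet_add[OF I U v])
qed (simp add: same_jet_refl)

lemma Cinf_on_mult:
  "finite I \<Longrightarrow> ropen I U \<Longrightarrow> Cinf_on I U f \<Longrightarrow> Cinf_on I U g \<Longrightarrow>
    Cinf_on I U (\<lambda>v. f v * g v)"
  unfolding Cinf_on_def by (simp add: Ck_on_mult)

lemma same_jet_mult:
  assumes I: "finite I" and U: "ropen I U" and v: "v \<in> U"
  shows "Cinf_on I U f \<Longrightarrow> Cinf_on I U f' \<Longrightarrow> Cinf_on I U g \<Longrightarrow> Cinf_on I U g' \<Longrightarrow>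
    same_jet I r v f f' \<Longrightarrow> same_jet I r v g g' \<Longrightarrow>
    same_jet I r v (\<lambda>v. f v * g v) (\<lambda>v. f' v * g' v)"
proof (induction r arbitrary: f f' g g')
  case 0
  then show ?case by (simp add: same_jet_def)
next
  case (Suc r)
  have D: "partial i (\<lambda>v. p v * q v) w = partial i p w * q w + p w * partial i q w"
    if "Cinf_on I U p" "Cinf_on I U q" "i \<in> I" "w \<in> U" for p q i w
    using that by (intro partial_eqI partial_mult[of 0 I U]) (auto simp: Cinf_on_def)
  show ?case unfolding same_jet_Suc_iff
  proof (intro conjI ballI)
    show "f v * g v = f' v * g' v" using Suc.prems same_jet_value by metis
    fix i assume i: "i \<in> I"
    have "same_jet I r v (\<lambda>v. partial i f v * g v + f v * partial i g v)
        (\<lambda>v. partial i f' v * g' v + f' v * partial i g' v)"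
      using Suc.prems i same_jet_mono[of I "Suc r" v _ _ r]
      by (intro same_jet_add[OF I U v] Suc.IH Cinf_on_mult[OF I U] Cinf_on_partial)
        (auto simp: same_jet_Suc_iff)
    then show "same_jet I r v (partial i (\<lambda>v. f v * g v)) (partial i (\<lambda>v. f' v * g' v))"
      by (subst same_jet_cong[OF I U v]) (use D Suc.prems i in auto)
  qed
qed

text \<open>Induction on the order through the chain rule replaces any explicit formula for higher
  derivatives of composites. Inner and outer functions may both change: composing with a fixed map
  uses a change of the inner one, a change of base coordinates a change of the outer one.\<close>

lemma same_jet_compose:
  assumes I: "finite I" and U: "ropen I U" and v: "v \<in> U"
    and J: "finite J" and V: "ropen J V"
    and F: "\<And>j. j \<in> J \<Longrightarrow> Cinf_on I U (\<lambda>v. F v j)" "\<And>v. v \<in> U \<Longrightarrow> F v \<in> V"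
    and F': "\<And>j. j \<in> J \<Longrightarrow> Cinf_on I U (\<lambda>v. F' v j)" "\<And>v. v \<in> U \<Longrightarrow> F' v \<in> V"
    and FF': "F v = F' v"
  shows "(\<And>j. j \<in> J \<Longrightarrow> same_jet I r v (\<lambda>v. F v j) (\<lambda>v. F' v j)) \<Longrightarrow>
    Cinf_on J V g \<Longrightarrow> Cinf_on J V g' \<Longrightarrow> same_jet J r (F v) g g' \<Longrightarrow>
    same_jet I r v (\<lambda>v. g (F v)) (\<lambda>v. g' (F' v))"
proof (induction r arbitrary: g g')
  case 0
  then show ?case using FF' by (simp add: same_jet_def)
next
  case (Suc r)
  have D: "partial i (\<lambda>v. p (H v)) w = (\<Sum>j\<in>J. partial j p (H w) * partial i (\<lambda>v. H v j) w)"
    if "Cinf_on J V p" "i \<in> I" "w \<in> U" "\<And>j. j \<in> J \<Longrightarrow> Cinf_on I U (\<lambda>v. H v j)"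
      "\<And>v. v \<in> U \<Longrightarrow> H v \<in> V" for p i w H
    using that by (intro partial_eqI partial_compose[OF I U J V]) (auto simp: Cinf_on_def)
  have C: "Cinf_on I U (\<lambda>v. partial j p (H v) * partial i (\<lambda>v. H v j) v)"
    if "Cinf_on J V p" "i \<in> I" "j \<in> J" "\<And>j. j \<in> J \<Longrightarrow> Cinf_on I U (\<lambda>v. H v j)"
      "\<And>v. v \<in> U \<Longrightarrow> H v \<in> V" for p i j H
    by (intro Cinf_on_mult[OF I U] Cinf_on_compose[OF I U J V, where F = H and g = "partial j p"])
      (use that in \<open>auto intro: Cinf_on_partial\<close>)
  show ?case unfolding same_jet_Suc_iff
  proof (intro conjI ballI)
    show "g (F v) = g' (F' v)" using Suc.prems(4) same_jet_value FF' by metis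
    fix i assume i: "i \<in> I"
    have "same_jet I r v (\<lambda>v. \<Sum>j\<in>J. partial j g (F v) * partial i (\<lambda>v. F v j) v)
        (\<lambda>v. \<Sum>j\<in>J. partial j g' (F' v) * partial i (\<lambda>v. F' v j) v)"
    proof (intro same_jet_sum[OF I U v J] C same_jet_mult[OF I U v])
      fix j assume j: "j \<in> J"
      show "Cinf_on I U (\<lambda>v. partial j g (F v))" "Cinf_on I U (\<lambda>v. partial j g' (F' v))"
        using Cinf_on_compose[OF I U J V F, of "partial j g"]
          Cinf_on_compose[OF I U J V F', of "partial j g'"]
          Cinf_on_partial[OF Suc.prems(2) j] Cinf_on_partial[OF Suc.prems(3) j] by blast+
      show "Cinf_on I U (partial i (\<lambda>v. F v j))" "Cinf_on I U (partial i (\<lambda>v. F' v j))"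
        using F F' i j by (auto intro: Cinf_on_partial)
      show "same_jet I r v (partial i (\<lambda>v. F v j)) (partial i (\<lambda>v. F' v j))"
        using Suc.prems(1)[OF j] i by (simp add: same_jet_Suc_iff)
      show "same_jet I r v (\<lambda>v. partial j g (F v)) (\<lambda>v. partial j g' (F' v))"
        \<comment> \<open>The outer functions lose one order by differentiation; the inner ones
          agree to order \<open>Suc r\<close> and are merely weakened to \<open>r\<close>.\<close>
        by (rule Suc.IH[OF same_jet_mono[OF Suc.prems(1)]])
          (use Suc.prems j in \<open>auto simp: same_jet_Suc_iff[of J] intro: Cinf_on_partial\<close>)
    qed (use Suc.prems i F F' in auto)
    then show "same_jet I r v (partial i (\<lambda>v. g (F v))) (partial i (\<lambda>v. g' (F' v)))"
      by (subst same_jet_cong[OF I U v]) (use D F F' Suc.prems i in auto)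
  qed
qed

lemma same_jet_partials:
  assumes "same_jet I r v f g" "\<alpha> \<in> multi_indices I r"
  shows "partials \<alpha> f v = partials \<alpha> g v"
proof -
  have "length (sorted_list_of_multiset \<alpha>) = size \<alpha>"
    by (metis mset_sorted_list_of_multiset size_mset)
  then show ?thesis using assms by (simp add: same_jet_def multi_indices_def partials_def)
qed

text \<open>Bridge between lists and the multi-indices of \<open>jet_eq\<close>: for smooth
  functions a list of derivatives may be sorted, by the symmetry of second derivatives.\<close>

lemma same_jet_iff_partials:
  assumes I: "finite I" and U: "ropen I U" and v: "v \<in> U"
    and f: "Cinf_on I U f" "Cinf_on I U g"
  shows "same_jet I r v f g \<longleftrightarrow> (\<forall>\<alpha>\<in>multi_indices I r. partials \<alpha> f v = partials \<alpha> g v)"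
proof
  assume L: "same_jet I r v f g"
  then show "\<forall>\<alpha>\<in>multi_indices I r. partials \<alpha> f v = partials \<alpha> g v"
    by (blast intro: same_jet_partials)
next
  assume R: "\<forall>\<alpha>\<in>multi_indices I r. partials \<alpha> f v = partials \<alpha> g v"
  show "same_jet I r v f g"
    unfolding same_jet_def
  proof (intro allI impI)
    fix l :: "'a list" assume l: "set l \<subseteq> I \<and> length l \<le> r"
    then have "partials (mset l) f v = partials (mset l) g v"
      using R by (auto simp: multi_indices_def)
    then show "foldr partial l f v = foldr partial l g v"
      using l foldr_partial_sort[OF I U f(1) _ v] foldr_partial_sort[OF I U f(2) _ v]
      by (simp add: partials_def)
  qed
qed


section \<open>Manifolds and smooth maps\<close>


text \<open>The conditions of \<open>smooth_manifold\<close> on charts and transition maps,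
  separated from those on the topology so that they pass to products such as R x X, the source of
  every variation.\<close>

definition smooth_atlas :: "('a, 'i) mfd \<Rightarrow> bool" where
  "smooth_atlas M \<longleftrightarrow>
     finite (indices M) \<and> \<Union> (fst ` atlas M) = points M \<and>
     (\<forall>(U, \<phi>)\<in>atlas M. inj_on \<phi> U \<and> ropen (indices M) (\<phi> ` U)) \<and>
     (\<forall>(U, \<phi>)\<in>atlas M. \<forall>(V, \<psi>)\<in>atlas M.
        ropen (indices M) (\<phi> ` (U \<inter> V)) \<and>
        (\<forall>j\<in>indices M. Cinf_on (indices M) (\<phi> ` (U \<inter> V)) (\<lambda>v. \<psi> (inv_into U \<phi> v) j)))"

text \<open>What a composition asks of its middle space: a chart there is inverted on its domain,
  and \<open>smooth_map_on\<close> already quantifies over all pairs of charts. It is the form in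
  which jet bundles and fibre products are used.\<close>

definition injective_atlas :: "('a, 'i) mfd \<Rightarrow> bool" where
  "injective_atlas M \<longleftrightarrow>
     finite (indices M) \<and> \<Union> (fst ` atlas M) = points M \<and>
     (\<forall>(U, \<phi>)\<in>atlas M. inj_on \<phi> U \<and> \<phi> ` U \<subseteq> euc (indices M))"

lemma smooth_manifold_atlas: "smooth_manifold M \<Longrightarrow> smooth_atlas M"
  unfolding smooth_manifold_def smooth_atlas_def by blast

lemma smooth_atlas_finite: "smooth_atlas M \<Longrightarrow> finite (indices M)"
  by (simp add: smooth_atlas_def)

lemma smooth_atlas_points: "smooth_atlas M \<Longrightarrow> p \<in> points M \<longleftrightarrow> (\<exists>(U, \<phi>)\<in>atlas M. p \<in> U)"
  unfolding smooth_atlas_def by (metis (mono_tags, lifting) UN_iff case_prod_unfold)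

lemma smooth_atlas_chart:
  assumes "smooth_atlas M" "(U, \<phi>) \<in> atlas M"
  shows "inj_on \<phi> U" "ropen (indices M) (\<phi> ` U)" "U \<subseteq> points M"
  using assms unfolding smooth_atlas_def by fastforce+

lemma smooth_atlas_transition:
  assumes "smooth_atlas M" "(U, \<phi>) \<in> atlas M" "(V, \<psi>) \<in> atlas M"
  shows "ropen (indices M) (\<phi> ` (U \<inter> V))"
    "j \<in> indices M \<Longrightarrow> Cinf_on (indices M) (\<phi> ` (U \<inter> V)) (\<lambda>v. \<psi> (inv_into U \<phi> v) j)"
  using assms unfolding smooth_atlas_def by fastforce+

lemma smooth_atlas_extensional:
  assumes "smooth_atlas M" "(U, \<phi>) \<in> atlas M" "p \<in> U"
  shows "\<phi> p \<in> euc (indices M)"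
  using openin_powertop_extensional[OF smooth_atlas_chart(2)[OF assms(1,2)]] assms(3) by blast

lemma smooth_atlas_injective:
  assumes M: "smooth_atlas M"
  shows "injective_atlas M"
  unfolding injective_atlas_def
proof (intro conjI ballI; clarify?)
  show "finite (indices M)" using M by (rule smooth_atlas_finite)
  show "\<Union> (fst ` atlas M) = points M" using M by (simp add: smooth_atlas_def)
  show "inj_on \<phi> U \<and> \<phi> ` U \<subseteq> euc (indices M)" if "(U, \<phi>) \<in> atlas M" for U \<phi>
    using smooth_atlas_chart(1)[OF M that] smooth_atlas_extensional[OF M that] by blast
qed

lemma injective_atlas_points: "injective_atlas M \<Longrightarrow> p \<in> points M \<longleftrightarrow> (\<exists>(U, \<phi>)\<in>atlas M. p \<in> U)"
  unfolding injective_atlas_def by (metis (mono_tags, lifting) UN_iff case_prod_unfold)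

lemma injective_atlas_chart:
  assumes "injective_atlas M" "(U, \<phi>) \<in> atlas M"
  shows "inj_on \<phi> U" "p \<in> U \<Longrightarrow> \<phi> p \<in> euc (indices M)"
  using assms unfolding injective_atlas_def by fastforce+

lemma inv_chart:
  assumes "inj_on \<phi> U" "v \<in> \<phi> ` (U \<inter> A)"
  shows "inv_into U \<phi> v \<in> U" "inv_into U \<phi> v \<in> A" "\<phi> (inv_into U \<phi> v) = v"
  using assms by (auto simp: inv_into_f_f)

text \<open>Induction over the topology generated by the charts: a generator is a preimage under
  some chart, and seen from another chart it becomes a preimage under the continuous transition map.
  Injectivity of the chart handles intersections.\<close>

lemma chart_image_openin:
  assumes M: "smooth_atlas M" and W: "openin (mfd_topology M) W" and c: "(U, \<phi>) \<in> atlas M"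
  shows "ropen (indices M) (\<phi> ` (U \<inter> W))"
proof -
  note inj = smooth_atlas_chart(1)[OF M c]
  have "generate_topology_on {{p \<in> V. \<psi> p \<in> S} | V \<psi> S. (V, \<psi>) \<in> atlas M \<and>
      ropen (indices M) S} W"
    using W unfolding mfd_topology_def openin_topology_generated_by_iff .
  then show ?thesis
  proof (induction rule: generate_topology_on.induct)
    case (Int A B)
    have "\<phi> ` (U \<inter> (A \<inter> B)) = \<phi> ` (U \<inter> A) \<inter> \<phi> ` (U \<inter> B)"
      using inj by (auto simp: inj_on_def)
    then show ?case using Int.IH by auto
  next
    case (UN K)
    have "\<phi> ` (U \<inter> \<Union> K) = (\<Union>A\<in>K. \<phi> ` (U \<inter> A))" by blast
    then show ?case using UN.IH by auto
  next
    case (Basis A)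
    then obtain V \<psi> S where A: "A = {p \<in> V. \<psi> p \<in> S}" "(V, \<psi>) \<in> atlas M"
      "ropen (indices M) S" by blast
    have "\<phi> ` (U \<inter> A) = {v \<in> \<phi> ` (U \<inter> V). \<psi> (inv_into U \<phi> v) \<in> S}"
      using inj by (auto simp: A(1) inv_into_f_f)
    moreover have "ropen (indices M) {v \<in> \<phi> ` (U \<inter> V). \<psi> (inv_into U \<phi> v) \<in> S}"
    proof (rule openin_preimage[OF smooth_atlas_transition(1)[OF M c A(2)] A(3)])
      show "cont_on (indices M) (\<phi> ` (U \<inter> V)) (\<lambda>v. \<psi> (inv_into U \<phi> v) j)" if "j \<in> indices M" for j
        using smooth_atlas_transition(2)[OF M c A(2) that] by (rule Cinf_on_cont_on)
      show "\<psi> (inv_into U \<phi> v) \<in> euc (indices M)" if "v \<in> \<phi> ` (U \<inter> V)" for v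
        using smooth_atlas_extensional[OF M A(2)] inv_chart[OF inj that] by blast
    qed
    ultimately show ?case by simp
  qed simp
qed

lemma topspace_mfd_topology:
  assumes "smooth_atlas M"
  shows "topspace (mfd_topology M) = points M"
proof -
  have "topspace (mfd_topology M) =
      \<Union> {{p \<in> U. \<phi> p \<in> S} | U \<phi> S. (U, \<phi>) \<in> atlas M \<and> ropen (indices M) S}"
    unfolding mfd_topology_def by (rule topology_generated_by_topspace)
  also have "\<dots> = points M"
  proof (intro equalityI subsetI)
    fix p assume "p \<in> points M"
    then obtain U \<phi> where c: "(U, \<phi>) \<in> atlas M" "p \<in> U"
      using smooth_atlas_points[OF assms] by blast
    have "p \<in> {p \<in> U. \<phi> p \<in> \<phi> ` U}" using c(2) by blast
    then show "p \<in> \<Union> {{p \<in> U. \<phi> p \<in> S} | U \<phi> S. (U, \<phi>) \<in> atlas M \<and> ropen (indices M) S}"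
      using smooth_atlas_chart(2)[OF assms c(1)] c(1) by blast
  next
    fix p assume "p \<in> \<Union> {{p \<in> U. \<phi> p \<in> S} | U \<phi> S. (U, \<phi>) \<in> atlas M \<and> ropen (indices M) S}"
    then show "p \<in> points M" using smooth_atlas_chart(3)[OF assms] by blast
  qed
  finally show ?thesis .
qed

lemma openin_mfd_points: "smooth_atlas M \<Longrightarrow> openin (mfd_topology M) (points M)"
  by (metis openin_topspace topspace_mfd_topology)

lemma smooth_map_onD:
  assumes "smooth_map_on M N W f" "(U, \<phi>) \<in> atlas M" "(V, \<psi>) \<in> atlas N"
  shows "ropen (indices M) (\<phi> ` (U \<inter> W \<inter> f -` V))"
    "j \<in> indices N \<Longrightarrow> Cinf_on (indices M) (\<phi> ` (U \<inter> W \<inter> f -` V)) (\<lambda>v. \<psi> (f (inv_into U \<phi> v)) j)"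
  using assms unfolding smooth_map_on_def by fastforce+

lemma smooth_map_on_openin: "smooth_map_on M N W f \<Longrightarrow> openin (mfd_topology M) W"
  by (simp add: smooth_map_on_def)

lemma smooth_map_on_image: "smooth_map_on M N W f \<Longrightarrow> x \<in> W \<Longrightarrow> f x \<in> points N"
  by (auto simp: smooth_map_on_def)

abbreviation smooth_in_chart ::
  "('a, 'i) mfd \<Rightarrow> ('b, 'j) mfd \<Rightarrow> 'a set \<Rightarrow> ('a \<Rightarrow> 'b) \<Rightarrow> 'a \<Rightarrow> 'b set \<Rightarrow> ('b \<Rightarrow> 'j \<Rightarrow> real) \<Rightarrow> bool"
where
  "smooth_in_chart M N W f p V \<psi> \<equiv>
     \<exists>U \<phi> S. (U, \<phi>) \<in> atlas M \<and> p \<in> U \<and> ropen (indices M) S \<and> \<phi> p \<in> S \<and> S \<subseteq> \<phi> ` (U \<inter> W \<inter> f -` V) \<and>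
       (\<forall>j\<in>indices N. Cinf_on (indices M) S (\<lambda>v. \<psi> (f (inv_into U \<phi> v)) j))"

text \<open>Smoothness need only be tested in one source chart around each point, since the transition maps
  of the source are smooth; nothing is required of the transition maps of the target.\<close>

lemma smooth_map_onI:
  assumes M: "smooth_atlas M" and W: "openin (mfd_topology M) W"
    and f: "\<And>x. x \<in> W \<Longrightarrow> f x \<in> points N"
    and loc: "\<And>p V \<psi>. p \<in> W \<Longrightarrow> (V, \<psi>) \<in> atlas N \<Longrightarrow> f p \<in> V \<Longrightarrow>
      smooth_in_chart M N W f p V \<psi>"
  shows "smooth_map_on M N W f"
proof -
  note I = smooth_atlas_finite[OF M]
  have "ropen (indices M) (\<phi>0 ` (U0 \<inter> W \<inter> f -` V)) \<and>
      (\<forall>j\<in>indices N. Cinf_on (indices M) (\<phi>0 ` (U0 \<inter> W \<inter> f -` V)) (\<lambda>v. \<psi> (f (inv_into U0 \<phi>0 v)) j))"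
    if c0: "(U0, \<phi>0) \<in> atlas M" and d: "(V, \<psi>) \<in> atlas N" for U0 \<phi>0 V \<psi>
  proof -
    let ?D = "\<phi>0 ` (U0 \<inter> W \<inter> f -` V)"
    note inj0 = smooth_atlas_chart(1)[OF M c0]
    have *: "\<exists>S. ropen (indices M) S \<and> v \<in> S \<and> S \<subseteq> ?D \<and>
      (\<forall>j\<in>indices N. Cinf_on (indices M) S (\<lambda>v. \<psi> (f (inv_into U0 \<phi>0 v)) j))"
      if v: "v \<in> ?D" for v
    proof -
      obtain p where p: "p \<in> U0" "p \<in> W" "f p \<in> V" "v = \<phi>0 p" using v by blast
      from loc[OF p(2) d p(3)] obtain U \<phi> S where c: "(U, \<phi>) \<in> atlas M" "p \<in> U"
        and S: "ropen (indices M) S" "\<phi> p \<in> S" "S \<subseteq> \<phi> ` (U \<inter> W \<inter> f -` V)"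
        and C: "\<And>j. j \<in> indices N \<Longrightarrow> Cinf_on (indices M) S (\<lambda>v. \<psi> (f (inv_into U \<phi> v)) j)"
        by blast
      note inj = smooth_atlas_chart(1)[OF M c(1)]
      \<comment> \<open>The good neighbourhood \<open>S\<close> of the chart
        \<open>(U, \<phi>)\<close>, carried over to the arbitrary chart \<open>(U0, \<phi>0)\<close>
        by the transition map.\<close>
      let ?T = "{w \<in> \<phi>0 ` (U0 \<inter> U). \<phi> (inv_into U0 \<phi>0 w) \<in> S}"
      note tr = smooth_atlas_transition[OF M c0 c(1)]
      have T: "ropen (indices M) ?T"
      proof (rule openin_preimage[OF tr(1) S(1)])
        show "cont_on (indices M) (\<phi>0 ` (U0 \<inter> U)) (\<lambda>v. \<phi> (inv_into U0 \<phi>0 v) j)" if "j \<in> indices M" for j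
          using tr(2)[OF that] by (rule Cinf_on_cont_on)
        show "\<phi> (inv_into U0 \<phi>0 v) \<in> euc (indices M)" if "v \<in> \<phi>0 ` (U0 \<inter> U)" for v
          using smooth_atlas_extensional[OF M c(1)] inv_chart[OF inj0 that] by blast
      qed
      have inv: "inv_into U \<phi> (\<phi> (inv_into U0 \<phi>0 w)) = inv_into U0 \<phi>0 w" if "w \<in> ?T" for w
        using that inv_chart[OF inj0, of w U] inj by (intro inv_into_f_f) auto
      have "?T \<subseteq> ?D"
      proof
        fix w assume w: "w \<in> ?T"
        then have "inv_into U0 \<phi>0 w \<in> W \<inter> f -` V"
        proof -
          have "\<phi> (inv_into U0 \<phi>0 w) \<in> \<phi> ` (U \<inter> (W \<inter> f -` V))"
            using w S(3) by (simp add: Int_assoc subset_iff)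
          from inv_chart(2)[OF inj this] show ?thesis unfolding inv[OF w] .
        qed
        then show "w \<in> ?D" using w inv_chart[OF inj0, of w U] by (metis (no_types, lifting) IntI IntD1 IntD2 imageI mem_Collect_eq)
      qed
      moreover have "v \<in> ?T" using p c(2) S(2) inj0 by (simp add: inv_into_f_f)
      moreover have "Cinf_on (indices M) ?T (\<lambda>w. \<psi> (f (inv_into U0 \<phi>0 w)) j)" if j: "j \<in> indices N" for j
      proof (rule Cinf_on_eq[OF I T])
        show "Cinf_on (indices M) ?T (\<lambda>w. \<psi> (f (inv_into U \<phi> (\<phi> (inv_into U0 \<phi>0 w)))) j)"
        proof (rule Cinf_on_compose[OF I T I S(1) _ _ C[OF j]])
          show "Cinf_on (indices M) ?T (\<lambda>v. \<phi> (inv_into U0 \<phi>0 v) j)" if "j \<in> indices M" for j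
            by (rule Cinf_on_subset[OF tr(2)[OF that]]) (rule Collect_restrict)
        qed blast
      qed (simp add: inv)
      ultimately show ?thesis using T by blast
    qed
    have D: "ropen (indices M) ?D"
      by (subst openin_subopen) (use * in blast)
    then show ?thesis using Cinf_on_local[OF D] * by meson
  qed
  then show ?thesis unfolding smooth_map_on_def using W f by auto
qed

text \<open>In coordinates the composite is the local expression of \<open>g\<close> after that of
  \<open>f\<close>, glued through a single chart of \<open>N\<close> around
  \<open>f p\<close>.\<close>

lemma smooth_map_on_compose:
  assumes M: "smooth_atlas M" and N: "injective_atlas N"
    and f: "smooth_map_on M N W f" and g: "smooth_map_on N P W' g" and sub: "f ` W \<subseteq> W'"
  shows "smooth_map_on M P W (\<lambda>x. g (f x))"
proof (rule smooth_map_onI[OF M smooth_map_on_openin[OF f]])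
  show "g (f x) \<in> points P" if "x \<in> W" for x
    using that sub smooth_map_on_image[OF g] by blast
  fix p T \<theta> assume p: "p \<in> W" and d: "(T, \<theta>) \<in> atlas P" "g (f p) \<in> T"
  obtain U \<phi> where c: "(U, \<phi>) \<in> atlas M" "p \<in> U"
    using smooth_atlas_points[OF M] topspace_mfd_topology[OF M] openin_subset[OF smooth_map_on_openin[OF f]] p
    by (metis (no_types, lifting) case_prodE subsetD)
  obtain V \<psi> where e: "(V, \<psi>) \<in> atlas N" "f p \<in> V"
    using injective_atlas_points[OF N] smooth_map_on_image[OF f p] by blast
  note inj = smooth_atlas_chart(1)[OF M c(1)] and injV = injective_atlas_chart(1)[OF N e(1)]
  let ?D = "\<phi> ` (U \<inter> W \<inter> f -` V)" and ?O = "\<psi> ` (V \<inter> W' \<inter> g -` T)"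
  note f' = smooth_map_onD[OF f c(1) e(1)] and g' = smooth_map_onD[OF g e(1) d(1)]
  \<comment> \<open>Being in \<open>?O\<close> is a condition on coordinates, which makes
    \<open>?S\<close> open; injectivity of \<open>\<psi>\<close> turns it back into a condition on
    the point \<open>f x\<close> itself.\<close>
  let ?S = "{v \<in> ?D. \<psi> (f (inv_into U \<phi> v)) \<in> ?O}"
  have Dinv: "inv_into U \<phi> v \<in> U" "inv_into U \<phi> v \<in> W" "f (inv_into U \<phi> v) \<in> V"
      "\<phi> (inv_into U \<phi> v) = v" if "v \<in> ?D" for v
    using inv_chart[OF inj, of v "W \<inter> f -` V"] that by (auto simp: Int_assoc)
  have S: "ropen (indices M) ?S"
  proof (rule openin_preimage[OF f'(1) g'(1)])
    show "cont_on (indices M) ?D (\<lambda>v. \<psi> (f (inv_into U \<phi> v)) j)" if "j \<in> indices N" for j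
      using f'(2)[OF that] by (rule Cinf_on_cont_on)
    show "\<psi> (f (inv_into U \<phi> v)) \<in> euc (indices N)" if "v \<in> ?D" for v
      using injective_atlas_chart(2)[OF N e(1)] Dinv[OF that] by blast
  qed
  have gT: "g (f (inv_into U \<phi> v)) \<in> T" if v: "v \<in> ?S" for v
  proof -
    obtain y where y: "y \<in> V" "g y \<in> T" "\<psi> (f (inv_into U \<phi> v)) = \<psi> y" using v by blast
    have "f (inv_into U \<phi> v) = y" using inj_onD[OF injV y(3)] y(1) Dinv(3) v by blast
    then show ?thesis using y(2) by simp
  qed
  have "?S \<subseteq> \<phi> ` (U \<inter> W \<inter> (\<lambda>x. g (f x)) -` T)"
  proof
    fix v assume v: "v \<in> ?S"
    then show "v \<in> \<phi> ` (U \<inter> W \<inter> (\<lambda>x. g (f x)) -` T)"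
      using Dinv[of v] gT[OF v] by (intro image_eqI[of _ _ "inv_into U \<phi> v"]) auto
  qed
  moreover have "\<phi> p \<in> ?S"
    using p c(2) d(2) e(2) inj sub by (auto simp: inv_into_f_f)
  moreover have "Cinf_on (indices M) ?S (\<lambda>v. \<theta> (g (f (inv_into U \<phi> v))) j)" if j: "j \<in> indices P" for j
  proof (rule Cinf_on_eq[OF smooth_atlas_finite[OF M] S])
    have "finite (indices N)" using N by (simp add: injective_atlas_def)
    then show "Cinf_on (indices M) ?S (\<lambda>v. \<theta> (g (inv_into V \<psi> (\<psi> (f (inv_into U \<phi> v))))) j)"
    proof (rule Cinf_on_compose[OF smooth_atlas_finite[OF M] S _ g'(1) _ _ g'(2)[OF j]])
      show "Cinf_on (indices M) ?S (\<lambda>v. \<psi> (f (inv_into U \<phi> v)) j)" if "j \<in> indices N" for j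
        by (rule Cinf_on_subset[OF f'(2)[OF that]]) (rule Collect_restrict)
    qed blast
  qed (use Dinv injV in \<open>simp add: inv_into_f_f\<close>)
  ultimately show "smooth_in_chart M P W (\<lambda>x. g (f x)) p T \<theta>"
    using c S by blast
qed

lemma smooth_map_id:
  assumes M: "smooth_atlas M"
  shows "smooth_map_on M M (points M) (\<lambda>x. x)"
proof (rule smooth_map_onI[OF M openin_mfd_points[OF M]])
  fix p V \<psi> assume p: "p \<in> points M" and c: "(V, \<psi>) \<in> atlas M" "p \<in> V"
  note inj = smooth_atlas_chart[OF M c(1)]
  have "Cinf_on (indices M) (\<psi> ` V) (\<lambda>v. \<psi> (inv_into V \<psi> v) j)" if "j \<in> indices M" for j
    using smooth_atlas_transition(2)[OF M c(1) c(1) that] by simp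
  then show "smooth_in_chart M M (points M) (\<lambda>x. x) p V \<psi>"
    using c inj by (intro exI[of _ V] exI[of _ \<psi>] exI[of _ "\<psi> ` V"]) auto
qed


section \<open>Product manifolds and families with a real parameter\<close>

lemma openin_powertop_Plus:
  assumes A: "ropen I A" and B: "ropen J B"
  shows "ropen (I <+> J) {w \<in> euc (I <+> J). w \<circ> Inl \<in> A \<and> w \<circ> Inr \<in> B}"
proof -
  note U = openin_powertop_UNIV[of "I <+> J"]
  have "ropen (I <+> J) {w \<in> euc (I <+> J). w \<circ> Inl \<in> A}"
    by (rule openin_preimage[OF U A]) (auto intro: cont_on_coord simp: PiE_iff extensional_def)
  moreover have "ropen (I <+> J) {w \<in> euc (I <+> J). w \<circ> Inr \<in> B}"
    by (rule openin_preimage[OF U B]) (auto intro: cont_on_coord simp: PiE_iff extensional_def)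
  ultimately have "ropen (I <+> J)
      ({w \<in> euc (I <+> J). w \<circ> Inl \<in> A} \<inter> {w \<in> euc (I <+> J). w \<circ> Inr \<in> B})"
    by (rule openin_Int)
  then show ?thesis by (rule back_subst[of "openin _"]) blast
qed

lemma case_sum_comp_Inl_Inr: "case_sum (w \<circ> Inl) (w \<circ> Inr) = w"
  by (rule ext) (simp split: sum.split)

lemma case_sum_extensional:
  "a \<in> euc I \<Longrightarrow> b \<in> euc J \<Longrightarrow> case_sum a b \<in> euc (I <+> J)"
  by (auto simp: PiE_iff extensional_def split: sum.split)

abbreviation prod_chart where
  "prod_chart \<phi> \<psi> \<equiv> (\<lambda>(p, q). case_sum (\<phi> p) (\<psi> q))"

lemma prod_chart_image:
  assumes "\<phi> ` A \<subseteq> euc I" "\<psi> ` B \<subseteq> euc J"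
  shows "(prod_chart \<phi> \<psi>) ` (A \<times> B)
    = {w \<in> euc (I <+> J). w \<circ> Inl \<in> \<phi> ` A \<and> w \<circ> Inr \<in> \<psi> ` B}"
proof (intro equalityI subsetI)
  fix w assume "w \<in> (prod_chart \<phi> \<psi>) ` (A \<times> B)"
  then obtain p q where "p \<in> A" "q \<in> B" "w = case_sum (\<phi> p) (\<psi> q)" by auto
  then show "w \<in> {w \<in> euc (I <+> J). w \<circ> Inl \<in> \<phi> ` A \<and> w \<circ> Inr \<in> \<psi> ` B}"
    using case_sum_extensional[of "\<phi> p" I "\<psi> q" J] subsetD[OF assms(1), of "\<phi> p"]
      subsetD[OF assms(2), of "\<psi> q"] by (simp add: case_sum_o_inj)
next
  fix w assume "w \<in> {w \<in> euc (I <+> J). w \<circ> Inl \<in> \<phi> ` A \<and> w \<circ> Inr \<in> \<psi> ` B}"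
  then obtain p q where "p \<in> A" "q \<in> B" "w \<circ> Inl = \<phi> p" "w \<circ> Inr = \<psi> q" by auto
  then show "w \<in> (prod_chart \<phi> \<psi>) ` (A \<times> B)"
    using case_sum_comp_Inl_Inr[of w] by (intro image_eqI[of _ _ "(p, q)"]) auto
qed

lemma prod_chart_inj:
  assumes "inj_on \<phi> A" "inj_on \<psi> B"
  shows "inj_on (prod_chart \<phi> \<psi>) (A \<times> B)"
proof (rule inj_onI)
  fix x y assume xy: "x \<in> A \<times> B" "y \<in> A \<times> B"
    and "(prod_chart \<phi> \<psi>) x = (prod_chart \<phi> \<psi>) y"
  then have "case_sum (\<phi> (fst x)) (\<psi> (snd x)) = case_sum (\<phi> (fst y)) (\<psi> (snd y))"
    by (simp add: case_prod_unfold)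
  then have "\<phi> (fst x) = \<phi> (fst y)" "\<psi> (snd x) = \<psi> (snd y)"
    by (metis case_sum_o_inj(1), metis case_sum_o_inj(2))
  then show "x = y"
    using xy inj_onD[OF assms(1)] inj_onD[OF assms(2)] by (simp add: mem_Times_iff prod_eq_iff)
qed

lemma Cinf_on_Inl:
  assumes "finite I" "finite J" "ropen (I <+> J) W"
    and "ropen I A" "\<And>w. w \<in> W \<Longrightarrow> w \<circ> Inl \<in> A" "Cinf_on I A f"
  shows "Cinf_on (I <+> J) W (\<lambda>w. f (w \<circ> Inl))"
proof (rule Cinf_on_compose[OF _ assms(3,1,4) _ assms(5,6)])
  show "Cinf_on (I <+> J) W (\<lambda>w. (w \<circ> Inl) j)" if "j \<in> I" for j
    unfolding o_def by (rule Cinf_on_coord) (use assms that in auto)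
qed (use assms in auto)

lemma Cinf_on_Inr:
  assumes "finite I" "finite J" "ropen (I <+> J) W"
    and "ropen J A" "\<And>w. w \<in> W \<Longrightarrow> w \<circ> Inr \<in> A" "Cinf_on J A f"
  shows "Cinf_on (I <+> J) W (\<lambda>w. f (w \<circ> Inr))"
proof (rule Cinf_on_compose[OF _ assms(3,2,4) _ assms(5,6)])
  show "Cinf_on (I <+> J) W (\<lambda>w. (w \<circ> Inr) j)" if "j \<in> J" for j
    unfolding o_def by (rule Cinf_on_coord) (use assms that in auto)
qed (use assms in auto)

lemma prod_mfd_simps:
  "points (prod_mfd M N) = points M \<times> points N"
  "indices (prod_mfd M N) = indices M <+> indices N"
  "c \<in> atlas (prod_mfd M N) \<longleftrightarrow> (\<exists>U \<phi> V \<psi>. (U, \<phi>) \<in> atlas M \<and> (V, \<psi>) \<in> atlas N \<and>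
     c = (U \<times> V, prod_chart \<phi> \<psi>))"
  by (auto simp: prod_mfd_def)

lemma inv_into_prod_chart:
  assumes "inj_on \<phi> U" "inj_on \<psi> V" "w \<circ> Inl \<in> \<phi> ` U" "w \<circ> Inr \<in> \<psi> ` V"
  shows "inv_into (U \<times> V) (prod_chart \<phi> \<psi>) w =
    (inv_into U \<phi> (w \<circ> Inl), inv_into V \<psi> (w \<circ> Inr))"
proof (rule inv_into_f_eq[OF prod_chart_inj[OF assms(1,2)]])
  show "(inv_into U \<phi> (w \<circ> Inl), inv_into V \<psi> (w \<circ> Inr)) \<in> U \<times> V"
    using assms(3,4) by (simp add: inv_into_into)
  show "(prod_chart \<phi> \<psi>) (inv_into U \<phi> (w \<circ> Inl), inv_into V \<psi> (w \<circ> Inr)) = w"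
    using assms(3,4) by (simp add: f_inv_into_f case_sum_comp_Inl_Inr)
qed

lemma smooth_atlas_prod_mfd:
  assumes M: "smooth_atlas M" and N: "smooth_atlas N"
  shows "smooth_atlas (prod_mfd M N)"
proof -
  note fin = smooth_atlas_finite[OF M] smooth_atlas_finite[OF N]
  have img: "(prod_chart \<phi> \<psi>) ` (A \<times> B) =
      {w \<in> euc (indices M <+> indices N). w \<circ> Inl \<in> \<phi> ` A \<and> w \<circ> Inr \<in> \<psi> ` B}"
    if "(U, \<phi>) \<in> atlas M" "(V, \<psi>) \<in> atlas N" "A \<subseteq> U" "B \<subseteq> V" for U \<phi> V \<psi> A B
  proof (rule prod_chart_image)
    show "\<phi> ` A \<subseteq> euc (indices M)"
      using smooth_atlas_extensional[OF M that(1)] that(3) by blast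
    show "\<psi> ` B \<subseteq> euc (indices N)"
      using smooth_atlas_extensional[OF N that(2)] that(4) by blast
  qed
  have tr: "ropen (indices M <+> indices N)
        ((prod_chart \<phi> \<psi>) ` ((U \<times> V) \<inter> (U' \<times> V')))" (is "openin _ ?W")
      "j \<in> indices M <+> indices N \<Longrightarrow> Cinf_on (indices M <+> indices N)
        ((prod_chart \<phi> \<psi>) ` ((U \<times> V) \<inter> (U' \<times> V')))
        (\<lambda>v. (prod_chart \<phi>' \<psi>') (inv_into (U \<times> V) (prod_chart \<phi> \<psi>) v) j)"
    if c: "(U, \<phi>) \<in> atlas M" "(V, \<psi>) \<in> atlas N" "(U', \<phi>') \<in> atlas M" "(V', \<psi>') \<in> atlas N"
    for U \<phi> V \<psi> U' \<phi>' V' \<psi>' j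
  proof -
    note trM = smooth_atlas_transition[OF M c(1,3)] and trN = smooth_atlas_transition[OF N c(2,4)]
    have W: "?W = {w \<in> euc (indices M <+> indices N).
        w \<circ> Inl \<in> \<phi> ` (U \<inter> U') \<and> w \<circ> Inr \<in> \<psi> ` (V \<inter> V')}"
      unfolding Times_Int_Times by (rule img[OF c(1,2)]) auto
    show op: "ropen (indices M <+> indices N) ?W"
      unfolding W by (rule openin_powertop_Plus[OF trM(1) trN(1)])
    have inv: "inv_into (U \<times> V) (prod_chart \<phi> \<psi>) w =
        (inv_into U \<phi> (w \<circ> Inl), inv_into V \<psi> (w \<circ> Inr))" if "w \<in> ?W" for w
      using that unfolding W
      by (intro inv_into_prod_chart smooth_atlas_chart(1)[OF M c(1)] smooth_atlas_chart(1)[OF N c(2)]) auto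
    assume j: "j \<in> indices M <+> indices N"
    show "Cinf_on (indices M <+> indices N) ?W
        (\<lambda>v. (prod_chart \<phi>' \<psi>') (inv_into (U \<times> V) (prod_chart \<phi> \<psi>) v) j)"
    proof (cases j)
      case (Inl i)
      then have "Cinf_on (indices M <+> indices N) ?W (\<lambda>w. \<phi>' (inv_into U \<phi> (w \<circ> Inl)) i)"
        using j by (intro Cinf_on_Inl[OF fin op trM(1) _ trM(2)]) (auto simp: W)
      from Cinf_on_eq[OF _ op this] show ?thesis using fin by (simp add: inv Inl)
    next
      case (Inr i)
      then have "Cinf_on (indices M <+> indices N) ?W (\<lambda>w. \<psi>' (inv_into V \<psi> (w \<circ> Inr)) i)"
        using j by (intro Cinf_on_Inr[OF fin op trN(1) _ trN(2)]) (auto simp: W)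
      from Cinf_on_eq[OF _ op this] show ?thesis using fin by (simp add: inv Inr)
    qed
  qed
  have chart: "inj_on \<theta> S \<and> ropen (indices M <+> indices N) (\<theta> ` S)"
    if "(S, \<theta>) \<in> atlas (prod_mfd M N)" for S \<theta>
  proof -
    from that obtain U \<phi> V \<psi> where c: "(U, \<phi>) \<in> atlas M" "(V, \<psi>) \<in> atlas N"
      "S = U \<times> V" "\<theta> = (prod_chart \<phi> \<psi>)"
      unfolding prod_mfd_simps by blast
    show ?thesis
      using tr(1)[OF c(1,2,1,2)] smooth_atlas_chart(1)[OF M c(1)] smooth_atlas_chart(1)[OF N c(2)]
      unfolding c(3,4) by (simp add: prod_chart_inj)
  qed
  have cover: "\<Union> (fst ` atlas (prod_mfd M N)) = points (prod_mfd M N)"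
  proof (intro equalityI subsetI)
    fix x assume "x \<in> \<Union> (fst ` atlas (prod_mfd M N))"
    then show "x \<in> points (prod_mfd M N)"
      using smooth_atlas_chart(3)[OF M] smooth_atlas_chart(3)[OF N] unfolding prod_mfd_simps(1)
      by (auto simp: prod_mfd_simps(3)) blast+
  next
    fix x assume "x \<in> points (prod_mfd M N)"
    then obtain U \<phi> V \<psi> where "(U, \<phi>) \<in> atlas M" "(V, \<psi>) \<in> atlas N" "fst x \<in> U" "snd x \<in> V"
      using smooth_atlas_points[OF M] smooth_atlas_points[OF N] unfolding prod_mfd_simps by force
    then have "(U \<times> V, \<lambda>(p, q). case_sum (\<phi> p) (\<psi> q)) \<in> atlas (prod_mfd M N)" "x \<in> U \<times> V"
      unfolding prod_mfd_simps by (blast, auto simp: mem_Times_iff)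
    then show "x \<in> \<Union> (fst ` atlas (prod_mfd M N))" by force
  qed
  have trans: "ropen (indices M <+> indices N) (\<theta> ` (S \<inter> S')) \<and>
      (\<forall>j\<in>indices M <+> indices N. Cinf_on (indices M <+> indices N) (\<theta> ` (S \<inter> S')) (\<lambda>v. \<theta>' (inv_into S \<theta> v) j))"
    if S: "(S, \<theta>) \<in> atlas (prod_mfd M N)" "(S', \<theta>') \<in> atlas (prod_mfd M N)" for S \<theta> S' \<theta>'
  proof -
    from S obtain U \<phi> V \<psi> U' \<phi>' V' \<psi>' where c: "(U, \<phi>) \<in> atlas M" "(V, \<psi>) \<in> atlas N"
      "S = U \<times> V" "\<theta> = (prod_chart \<phi> \<psi>)"
      "(U', \<phi>') \<in> atlas M" "(V', \<psi>') \<in> atlas N"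
      "S' = U' \<times> V'" "\<theta>' = (prod_chart \<phi>' \<psi>')"
      unfolding prod_mfd_simps by blast
    show ?thesis using tr[OF c(1,2,5,6)] unfolding c(3,4,7,8) by blast
  qed
  show ?thesis
    unfolding smooth_atlas_def prod_mfd_simps(2)
  proof (intro conjI)
    show "\<forall>(U, \<phi>)\<in>atlas (prod_mfd M N). \<forall>(V, \<psi>)\<in>atlas (prod_mfd M N).
        ropen (indices M <+> indices N) (\<phi> ` (U \<inter> V)) \<and>
        (\<forall>j\<in>indices M <+> indices N.
          Cinf_on (indices M <+> indices N) (\<phi> ` (U \<inter> V)) (\<lambda>v. \<psi> (inv_into U \<phi> v) j))"
      using trans by blast
  qed (use fin chart cover in \<open>simp, simp, blast\<close>)
qed

lemma smooth_atlas_real_line: "smooth_atlas real_line"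
proof -
  have img: "(\<lambda>(t::real) (u::unit). t) ` UNIV = ({()} \<rightarrow>\<^sub>E UNIV)"
    by (auto simp: PiE_iff extensional_def intro!: image_eqI[of _ _ "_ ()"])
  have op: "ropen {()} ((\<lambda>(t::real) (u::unit). t) ` UNIV)"
    unfolding img by (rule openin_powertop_UNIV)
  have inj: "inj (\<lambda>(t::real) (u::unit). t)" by (auto simp: inj_on_def dest: fun_cong)
  have "inv_into UNIV (\<lambda>(t::real) (u::unit). t) = (\<lambda>v. v ())"
    by (rule ext, rule inv_into_f_eq[OF inj]) auto
  then show ?thesis
    using op inj Cinf_on_coord[OF _ op, of "()"] unfolding smooth_atlas_def real_line_def by simp
qed

lemma real_line_simps:
  "points real_line = UNIV" "indices real_line = {()}" "atlas real_line = {(UNIV, \<lambda>t u. t)}"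
  by (auto simp: real_line_def)

lemma prod_real_line_chart:
  "c \<in> atlas (prod_mfd real_line X) \<longleftrightarrow> (\<exists>V \<psi>. (V, \<psi>) \<in> atlas X \<and>
     c = (UNIV \<times> V, \<lambda>(t, q). case_sum (\<lambda>u. t) (\<psi> q)))"
  by (simp add: prod_mfd_simps real_line_simps)

lemma smooth_map_on_slice_inclusion:
  assumes X: "smooth_atlas X" and W: "openin (mfd_topology X) W"
  shows "smooth_map_on X (prod_mfd real_line X) W (Pair \<epsilon>)"
proof (rule smooth_map_onI[OF X W])
  note WX = openin_subset[OF W, unfolded topspace_mfd_topology[OF X]]
  show "(\<epsilon>, x) \<in> points (prod_mfd real_line X)" if "x \<in> W" for x
    using that WX by (auto simp: prod_mfd_simps real_line_simps)
  fix p T \<theta> assume p: "p \<in> W" and T: "(T, \<theta>) \<in> atlas (prod_mfd real_line X)" "(\<epsilon>, p) \<in> T"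
  then obtain V \<psi> where V: "(V, \<psi>) \<in> atlas X" "T = UNIV \<times> V" "\<theta> = (\<lambda>(t, q). case_sum (\<lambda>u. t) (\<psi> q))"
    unfolding prod_real_line_chart by blast
  have S: "ropen (indices X) (\<psi> ` (V \<inter> W))" by (rule chart_image_openin[OF X W V(1)])
  note inj = smooth_atlas_chart(1)[OF X V(1)] and fin = smooth_atlas_finite[OF X]
  have "Cinf_on (indices X) (\<psi> ` (V \<inter> W)) (\<lambda>v. \<theta> (\<epsilon>, inv_into V \<psi> v) j)"
    if "j \<in> indices (prod_mfd real_line X)" for j
  proof (cases j)
    case (Inl i)
    then show ?thesis unfolding V(3) using Cinf_on_const[OF fin S] by simp
  next
    case (Inr i)
    then have "i \<in> indices X" using that by (auto simp: prod_mfd_simps)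
    from Cinf_on_coord[OF fin S this]
    show ?thesis by (rule Cinf_on_eq[OF fin S]) (auto simp: V(3) Inr inv_chart[OF inj])
  qed
  then show "smooth_in_chart X (prod_mfd real_line X) W (Pair \<epsilon>) p T \<theta>"
    using S V(1,2) p T(2) by (intro exI[of _ V] exI[of _ \<psi>] exI[of _ "\<psi> ` (V \<inter> W)"]) auto
qed

text \<open>Fixing the parameter is composition with the smooth inclusion of X into R x X at height
  \<open>\<epsilon>\<close>.\<close>

lemma smooth_map_on_slice:
  assumes X: "smooth_atlas X" and W: "openin (mfd_topology X) W" and \<epsilon>: "\<epsilon> \<in> J"
    and F: "smooth_map_on (prod_mfd real_line X) N (J \<times> W) (\<lambda>(\<epsilon>, x). F \<epsilon> x)"
  shows "smooth_map_on X N W (F \<epsilon>)"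
  using smooth_map_on_compose[OF X smooth_atlas_injective[OF
      smooth_atlas_prod_mfd[OF smooth_atlas_real_line X]] smooth_map_on_slice_inclusion[OF X W] F] \<epsilon>
  by auto

text \<open>Each summand evaluates the form only at points of \<open>K\<close>. So for every
  partition of unity the two defining predicates hold of the same numbers, and the two definite
  descriptions coincide.\<close>

lemma form_integral_cong:
  assumes "\<And>x. x \<in> K \<Longrightarrow> \<omega> x = \<omega>' x" "smooth_atlas M"
  shows "form_integral M K \<omega> = form_integral M K \<omega>'"
proof -
  have "set_lebesgue_integral (Pi\<^sub>M (indices M) (\<lambda>_. lborel)) (\<phi> ` (K \<inter> U))
          (\<lambda>v. let x = inv_into U \<phi> v in h x * form_coeff M (U, \<phi>) x (snd (\<omega> x))) =
        set_lebesgue_integral (Pi\<^sub>M (indices M) (\<lambda>_. lborel)) (\<phi> ` (K \<inter> U))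
          (\<lambda>v. let x = inv_into U \<phi> v in h x * form_coeff M (U, \<phi>) x (snd (\<omega>' x)))"
    if "(U, \<phi>) \<in> atlas M" for U \<phi> h
  proof -
    have "inv_into U \<phi> v \<in> K" if "v \<in> \<phi> ` (K \<inter> U)" for v
      using inv_chart(2)[OF smooth_atlas_chart(1)[OF assms(2) \<open>(U, \<phi>) \<in> atlas M\<close>]] that
      by (simp add: Int_commute)
    then show ?thesis unfolding set_lebesgue_integral_def Let_def
      by (intro Bochner_Integration.integral_cong refl) (auto simp: indicator_def assms(1))
  qed
  then have eq: "(\<Sum>(U, \<phi>)\<in>C. set_lebesgue_integral (Pi\<^sub>M (indices M) (\<lambda>_. lborel)) (\<phi> ` (K \<inter> U))
          (\<lambda>v. let x = inv_into U \<phi> v in \<rho> (U, \<phi>) x * form_coeff M (U, \<phi>) x (snd (\<omega> x)))) =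
     (\<Sum>(U, \<phi>)\<in>C. set_lebesgue_integral (Pi\<^sub>M (indices M) (\<lambda>_. lborel)) (\<phi> ` (K \<inter> U))
          (\<lambda>v. let x = inv_into U \<phi> v in \<rho> (U, \<phi>) x * form_coeff M (U, \<phi>) x (snd (\<omega>' x))))"
    if "C \<subseteq> atlas M" for C \<rho>
    using that by (intro sum.cong refl) auto
  have "has_form_integral M K \<omega> I = has_form_integral M K \<omega>' I" for I
    unfolding has_form_integral_def by (intro ex_cong1 conj_cong refl) (simp add: eq)
  then show ?thesis unfolding form_integral_def by presburger
qed


section \<open>Jets and fibre products\<close>


lemma smooth_atlas_point_chart:
  assumes "smooth_atlas M" "p \<in> points M"
  obtains U \<phi> where "(U, \<phi>) \<in> atlas M" "p \<in> U"
  using smooth_atlas_points[OF assms(1)] assms(2) by blast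

lemma fibre_bundleD:
  assumes "fibre_bundle P F"
  shows "smooth_atlas (base P)" "smooth_atlas (total P)"
    "indices (total P) = indices (base P) <+> fibre_indices P"
    "c \<in> atlas (total P) \<Longrightarrow> \<exists>b. (b, c) \<in> adapted_charts P"
  using assms unfolding fibre_bundle_def
  by (auto intro: smooth_manifold_atlas)

lemma adapted_chartsD:
  assumes "((U, \<phi>), (V, \<psi>)) \<in> adapted_charts P"
  shows "(U, \<phi>) \<in> atlas (base P)" "(V, \<psi>) \<in> atlas (total P)" "y \<in> V \<Longrightarrow> proj P y \<in> U"
    "y \<in> V \<Longrightarrow> i \<in> indices (base P) \<Longrightarrow> \<psi> y (Inl i) = \<phi> (proj P y) i"
  using assms by (auto simp: adapted_charts_def)

lemma fibre_indices_iff: "j \<in> fibre_indices P \<longleftrightarrow> Inr j \<in> indices (total P)"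
  by (simp add: fibre_indices_def)

lemma fibre_bundle_adapted_chart:
  assumes P: "fibre_bundle P F" and y: "y \<in> points (total P)"
  obtains U \<phi> V \<psi> where "((U, \<phi>), (V, \<psi>)) \<in> adapted_charts P" "y \<in> V"
proof -
  obtain V \<psi> where V: "(V, \<psi>) \<in> atlas (total P)" "y \<in> V"
    using smooth_atlas_point_chart[OF fibre_bundleD(2)[OF P] y] .
  obtain b where "(b, (V, \<psi>)) \<in> adapted_charts P" using fibre_bundleD(4)[OF P V(1)] by blast
  then show ?thesis using that V(2) by (cases b) blast
qed

section \<open>Equality of jets and its independence of the chart\<close>

lemma jet_eq_refl: "jet_eq P r x s s"
  by (auto simp: jet_eq_def)

lemma jet_eq_sym: "jet_eq P r x s s' \<Longrightarrow> jet_eq P r x s' s"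
  unfolding jet_eq_def by fastforce

lemma jet_eq_trans: "jet_eq P r x s s' \<Longrightarrow> jet_eq P r x s' s'' \<Longrightarrow> jet_eq P r x s s''"
  unfolding jet_eq_def by fastforce

lemma jet_eq_chartD:
  assumes "jet_eq P r x s s'" "((U, \<phi>), (V, \<psi>)) \<in> adapted_charts P" "s x \<in> V"
    "j \<in> fibre_indices P" "\<alpha> \<in> multi_indices (indices (base P)) r"
  shows "partials \<alpha> (\<lambda>v. \<psi> (s (inv_into U \<phi> v)) (Inr j)) (\<phi> x) =
    partials \<alpha> (\<lambda>v. \<psi> (s' (inv_into U \<phi> v)) (Inr j)) (\<phi> x)"
  using assms unfolding jet_eq_def by fastforce

lemma jet_eqI:
  assumes "s x = s' x"
    and "\<And>U \<phi> V \<psi> j \<alpha>. ((U, \<phi>), (V, \<psi>)) \<in> adapted_charts P \<Longrightarrow> s x \<in> V \<Longrightarrow>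
      j \<in> fibre_indices P \<Longrightarrow> \<alpha> \<in> multi_indices (indices (base P)) r \<Longrightarrow>
      partials \<alpha> (\<lambda>v. \<psi> (s (inv_into U \<phi> v)) (Inr j)) (\<phi> x) =
      partials \<alpha> (\<lambda>v. \<psi> (s' (inv_into U \<phi> v)) (Inr j)) (\<phi> x)"
  shows "jet_eq P r x s s'"
  using assms unfolding jet_eq_def by fastforce

lemma jet_eq_imp_jet_eq: "jet_eq P r x s s' \<Longrightarrow> jet P r s x = jet P r s' x"
  unfolding jet_def using jet_eq_sym[of P r x] jet_eq_trans[of P r x] by blast

text \<open>Derivatives at \<open>x\<close> see only values near \<open>x\<close>. The condition on
  \<open>proj P (s x)\<close> puts \<open>x\<close> into the base domain of every chart around
  \<open>s x\<close>, where the derivatives are formed. Used throughout for maps that coincide only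
  where they are sections.\<close>

lemma jet_eq_germ:
  assumes X: "smooth_atlas (base P)" and W: "openin (mfd_topology (base P)) W" "x \<in> W"
    and eq: "\<And>z. z \<in> W \<Longrightarrow> s z = s' z" and s: "proj P (s x) = x"
  shows "jet_eq P r x s s'"
proof (rule jet_eqI)
  show "s x = s' x" using eq W(2) .
  fix U \<phi> V \<psi> j \<alpha> assume c: "((U, \<phi>), (V, \<psi>)) \<in> adapted_charts P" "s x \<in> V"
    and \<alpha>: "\<alpha> \<in> multi_indices (indices (base P)) r"
  note b = adapted_chartsD(1)[OF c(1)]
  note inj = smooth_atlas_chart(1)[OF X b]
  have "x \<in> U" using adapted_chartsD(3)[OF c] s by simp
  then have x: "\<phi> x \<in> \<phi> ` (U \<inter> W)" using W(2) by blast
  have "same_jet (indices (base P)) r (\<phi> x) (\<lambda>v. \<psi> (s (inv_into U \<phi> v)) (Inr j))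
      (\<lambda>v. \<psi> (s' (inv_into U \<phi> v)) (Inr j))"
    by (rule same_jet_eqI[OF smooth_atlas_finite[OF X] chart_image_openin[OF X W(1) b] x])
      (simp add: eq inv_chart(2)[OF inj])
  then show "partials \<alpha> (\<lambda>v. \<psi> (s (inv_into U \<phi> v)) (Inr j)) (\<phi> x) =
      partials \<alpha> (\<lambda>v. \<psi> (s' (inv_into U \<phi> v)) (Inr j)) (\<phi> x)"
    using \<alpha> by (rule same_jet_partials)
qed

lemma local_sections_value:
  assumes "s \<in> local_sections P x"
  shows "s x \<in> points (total P)" "proj P (s x) = x"
  using assms unfolding local_sections_def section_on_def by (auto dest: smooth_map_on_image)

lemma jet_rep_jet:
  assumes "s \<in> local_sections P x"
  shows "jet_rep (jet P r s x) \<in> local_sections P x" "jet_eq P r x s (jet_rep (jet P r s x))"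
proof -
  have "jet_rep (jet P r s x) \<in> snd (jet P r s x)"
    unfolding jet_rep_def by (rule someI[of _ s]) (simp add: jet_def assms jet_eq_refl)
  then show "jet_rep (jet P r s x) \<in> local_sections P x" "jet_eq P r x s (jet_rep (jet P r s x))"
    by (simp_all add: jet_def)
qed

lemma fst_jet: "fst (jet P r s x) = x"
  by (simp add: jet_def)

lemma jet_rep_jet_value: "s \<in> local_sections P x \<Longrightarrow> jet_rep (jet P r s x) x = s x"
  using jet_rep_jet(2)[of s P x r] by (simp add: jet_eq_def)

lemma jetsD:
  assumes "\<gamma> \<in> jets P r"
  shows "jet_rep \<gamma> \<in> local_sections P (fst \<gamma>)" "fst \<gamma> \<in> points (base P)"
    "jet P r (jet_rep \<gamma>) (fst \<gamma>) = \<gamma>"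
proof -
  obtain s x where \<gamma>: "\<gamma> = jet P r s x" "x \<in> points (base P)" "s \<in> local_sections P x"
    using assms unfolding jets_def by blast
  show "jet_rep \<gamma> \<in> local_sections P (fst \<gamma>)" "fst \<gamma> \<in> points (base P)"
    using jet_rep_jet(1)[OF \<gamma>(3)] \<gamma> by (auto simp: fst_jet)
  show "jet P r (jet_rep \<gamma>) (fst \<gamma>) = \<gamma>"
    using jet_eq_imp_jet_eq[OF jet_rep_jet(2)[OF \<gamma>(3)]] \<gamma> by (simp add: fst_jet)
qed

lemma jet_in_jets: "x \<in> points (base P) \<Longrightarrow> s \<in> local_sections P x \<Longrightarrow> jet P r s x \<in> jets P r"
  unfolding jets_def by blast

text \<open>Here \<open>s\<close> and \<open>s'\<close> are maps from the base to a manifold \<open>N\<close> which agree to order \<open>r\<close> at \<open>x\<close> in one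
  chart. With \<open>N = total P\<close> and \<open>g = id\<close> this says that \<^const>\<open>jet_eq\<close> can be checked in a single
  chart.\<close>

lemma jet_eq_push_forward:
  assumes P: "fibre_bundle P F"
    and N: "injective_atlas N" "(C, \<theta>) \<in> atlas N" and g: "smooth_map_on N (total P) W' g"
    and c: "(U', \<phi>') \<in> atlas (base P)" "x \<in> U'" "proj P (g (s x)) = x"
    and S: "ropen (indices (base P)) S" "\<phi>' x \<in> S" "S \<subseteq> \<phi>' ` U'"
    and s: "\<And>v. v \<in> S \<Longrightarrow> s (inv_into U' \<phi>' v) \<in> C \<inter> W'"
      "\<And>v. v \<in> S \<Longrightarrow> s' (inv_into U' \<phi>' v) \<in> C \<inter> W'" "s x = s' x"
    and C: "\<And>i. i \<in> indices N \<Longrightarrow> Cinf_on (indices (base P)) S (\<lambda>v. \<theta> (s (inv_into U' \<phi>' v)) i)"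
      "\<And>i. i \<in> indices N \<Longrightarrow> Cinf_on (indices (base P)) S (\<lambda>v. \<theta> (s' (inv_into U' \<phi>' v)) i)"
      "\<And>i. i \<in> indices N \<Longrightarrow> same_jet (indices (base P)) r (\<phi>' x)
        (\<lambda>v. \<theta> (s (inv_into U' \<phi>' v)) i) (\<lambda>v. \<theta> (s' (inv_into U' \<phi>' v)) i)"
  shows "jet_eq P r x (\<lambda>z. g (s z)) (\<lambda>z. g (s' z))"
proof (rule jet_eqI)
  show "g (s x) = g (s' x)" using s(3) by simp
  fix U \<phi> V \<psi> j \<alpha>
  assume d: "((U, \<phi>), (V, \<psi>)) \<in> adapted_charts P" "g (s x) \<in> V" and j: "j \<in> fibre_indices P"
    and \<alpha>: "\<alpha> \<in> multi_indices (indices (base P)) r"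
  define I where "I = indices (base P)"
  note X = fibre_bundleD(1)[OF P] and b = adapted_chartsD(1)[OF d(1)] and e = adapted_chartsD(2)[OF d(1)]
  have fin: "finite I" "finite (indices N)"
    using smooth_atlas_finite[OF X] N(1) by (auto simp: I_def injective_atlas_def)
  have x: "x \<in> U" using adapted_chartsD(3)[OF d] c(3) by simp
  note injC = injective_atlas_chart(1)[OF N]
  note inj = smooth_atlas_chart(1)[OF X b] and inj' = smooth_atlas_chart(1)[OF X c(1)]
  let ?O = "\<theta> ` (C \<inter> W' \<inter> g -` V)"
  let ?A = "\<lambda>w. \<psi> (g (inv_into C \<theta> w)) (Inr j)"
  note gO = smooth_map_onD(1)[OF g N(2) e]
  have gA: "Cinf_on (indices N) ?O ?A"
    using smooth_map_onD(2)[OF g N(2) e] j by (simp add: fibre_indices_iff)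
  define p where "p s v = \<theta> (s (inv_into U' \<phi>' v))" for s :: "_ \<Rightarrow> _" and v
  have pE: "p s v \<in> euc (indices N)" "p s' v \<in> euc (indices N)" if "v \<in> S" for v
    using injective_atlas_chart(2)[OF N] s(1,2)[OF that] by (auto simp: p_def)
  \<comment> \<open>The coordinate points at which the images of both maps lie in the domain of the
    local expression of \<open>g\<close>; both compositions are smooth there.\<close>
  define S1 where "S1 = {v \<in> S. p s v \<in> ?O} \<inter> {v \<in> S. p s' v \<in> ?O}"
  have S1: "ropen I S1"
    unfolding S1_def
    by (intro openin_Int openin_preimage[OF _ gO] Cinf_on_cont_on)
      (use S C pE in \<open>auto simp: p_def I_def\<close>)
  have S1S: "S1 \<subseteq> S" by (auto simp: S1_def)
  have invx: "inv_into U' \<phi>' (\<phi>' x) = x" using inj' c(2) by (rule inv_into_f_f)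
  have xS1: "\<phi>' x \<in> S1"
  proof -
    have "s x \<in> C \<inter> W' \<inter> g -` V" "s' x \<in> C \<inter> W' \<inter> g -` V"
      using s(1,2)[OF S(2)] d(2) s(3) unfolding invx by auto
    then have "p s (\<phi>' x) \<in> ?O" "p s' (\<phi>' x) \<in> ?O" unfolding p_def invx by blast+
    then show ?thesis unfolding S1_def using S(2) by blast
  qed
  have pC: "Cinf_on I S1 (\<lambda>v. p s v i)" "Cinf_on I S1 (\<lambda>v. p s' v i)"
    "same_jet I r (\<phi>' x) (\<lambda>v. p s v i) (\<lambda>v. p s' v i)" if "i \<in> indices N" for i
    using C[OF that] Cinf_on_subset[OF _ S1S] by (auto simp: p_def I_def)
  have pO: "p s v \<in> ?O" "p s' v \<in> ?O" if "v \<in> S1" for v using that by (auto simp: S1_def)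
  have H: "Cinf_on I S1 (\<lambda>v. ?A (p s v))" "Cinf_on I S1 (\<lambda>v. ?A (p s' v))"
    using Cinf_on_compose[OF fin(1) S1 fin(2) gO pC(1) pO(1) gA]
      Cinf_on_compose[OF fin(1) S1 fin(2) gO pC(2) pO(2) gA] by auto
  \<comment> \<open>First application of the composition lemma, in the given base chart: the inner
    maps agree to order \<open>r\<close> and the outer map is the local expression of
    \<open>g\<close>.\<close>
  have "p s (\<phi>' x) = p s' (\<phi>' x)" unfolding p_def invx s(3) ..
  then have J1: "same_jet I r (\<phi>' x) (\<lambda>v. ?A (p s v)) (\<lambda>v. ?A (p s' v))"
    by (intro same_jet_compose[OF fin(1) S1 xS1 fin(2) gO pC(1) pO(1) pC(2) pO(2) _ pC(3) gA gA same_jet_refl])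
  \<comment> \<open>Transition from the base chart \<open>\<phi>\<close> demanded by
    \<open>jet_eq\<close> to the chart \<open>\<phi>'\<close> of the hypotheses. In the second
    application it is the common inner map, and the outer maps agree to order
    \<open>r\<close>.\<close>
  define \<tau> where "\<tau> w = \<phi>' (inv_into U \<phi> w)" for w
  define T where "T = {w \<in> \<phi> ` (U \<inter> U'). \<tau> w \<in> S1}"
  note tr = smooth_atlas_transition[OF X b c(1)]
  have UU: "inv_into U \<phi> w \<in> U" "inv_into U \<phi> w \<in> U'" if "w \<in> T" for w
    using inv_chart[OF inj, of w U'] that by (auto simp: T_def)
  have T: "ropen I T"
    unfolding T_def
  proof (rule openin_preimage[OF tr(1)[folded I_def] S1])
    show "cont_on I (\<phi> ` (U \<inter> U')) (\<lambda>v. \<tau> v j)" if "j \<in> I" for j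
      using Cinf_on_cont_on[OF tr(2)] that by (simp add: \<tau>_def I_def)
    show "\<tau> v \<in> euc I" if "v \<in> \<phi> ` (U \<inter> U')" for v
      using smooth_atlas_extensional[OF X c(1)] inv_chart(2)[OF inj that] by (simp add: \<tau>_def I_def)
  qed
  have \<tau>x: "\<tau> (\<phi> x) = \<phi>' x" using inj x by (simp add: \<tau>_def inv_into_f_f)
  have xT: "\<phi> x \<in> T" using x c(2) xS1 \<tau>x by (simp add: T_def)
  have \<tau>C: "Cinf_on I T (\<lambda>w. \<tau> w i)" if "i \<in> I" for i
    using Cinf_on_subset[OF tr(2), of i T] that by (auto simp: \<tau>_def I_def T_def)
  have \<tau>S: "\<tau> w \<in> S1" if "w \<in> T" for w using that by (simp add: T_def)
  have J2: "same_jet I r (\<phi> x) (\<lambda>w. ?A (p s (\<tau> w))) (\<lambda>w. ?A (p s' (\<tau> w)))"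
    by (rule same_jet_compose[OF fin(1) T xT fin(1) S1 \<tau>C \<tau>S \<tau>C \<tau>S refl same_jet_refl H])
      (simp_all add: \<tau>x J1)
  have inv: "inv_into U' \<phi>' (\<tau> w) = inv_into U \<phi> w" if "w \<in> T" for w
    unfolding \<tau>_def using inj' UU(2)[OF that] by (rule inv_into_f_f)
  have eq: "?A (p s (\<tau> w)) = \<psi> (g (s (inv_into U \<phi> w))) (Inr j)"
       "?A (p s' (\<tau> w)) = \<psi> (g (s' (inv_into U \<phi> w))) (Inr j)" if "w \<in> T" for w
  proof -
    have "\<tau> w \<in> S" using \<tau>S[OF that] S1S by blast
    from s(1,2)[OF this] show "?A (p s (\<tau> w)) = \<psi> (g (s (inv_into U \<phi> w))) (Inr j)"
       "?A (p s' (\<tau> w)) = \<psi> (g (s' (inv_into U \<phi> w))) (Inr j)"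
      unfolding p_def inv[OF that] using injC by (simp_all add: inv_into_f_f)
  qed
  have "same_jet I r (\<phi> x) (\<lambda>w. \<psi> (g (s (inv_into U \<phi> w))) (Inr j)) (\<lambda>w. \<psi> (g (s' (inv_into U \<phi> w))) (Inr j))"
    by (rule same_jet_transfer[OF fin(1) T xT J2 eq])
  then show "partials \<alpha> (\<lambda>v. \<psi> (g (s (inv_into U \<phi> v))) (Inr j)) (\<phi> x) =
      partials \<alpha> (\<lambda>v. \<psi> (g (s' (inv_into U \<phi> v))) (Inr j)) (\<phi> x)"
    using \<alpha> unfolding I_def by (rule same_jet_partials)
qed

text \<open>In an adapted chart a section fixes the base coordinates: they are the coordinate
  functions themselves, so two sections can differ only in their fibre coordinates.\<close>

lemma section_coords:
  assumes P: "fibre_bundle P F" and s: "section_on P W s"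
    and c: "((U, \<phi>), (V, \<psi>)) \<in> adapted_charts P"
  defines "D \<equiv> \<phi> ` (U \<inter> W \<inter> s -` V)"
  shows "ropen (indices (base P)) D"
    and "j \<in> indices (total P) \<Longrightarrow> Cinf_on (indices (base P)) D (\<lambda>v. \<psi> (s (inv_into U \<phi> v)) j)"
    and "v \<in> D \<Longrightarrow> inv_into U \<phi> v \<in> U \<and> inv_into U \<phi> v \<in> W \<and> s (inv_into U \<phi> v) \<in> V \<and> \<phi> (inv_into U \<phi> v) = v"
    and "v \<in> D \<Longrightarrow> i \<in> indices (base P) \<Longrightarrow> \<psi> (s (inv_into U \<phi> v)) (Inl i) = v i"
proof -
  note b = adapted_chartsD(1)[OF c] and e = adapted_chartsD(2)[OF c]
  note sm = s[unfolded section_on_def, THEN conjunct1]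
  show "ropen (indices (base P)) D"
    "j \<in> indices (total P) \<Longrightarrow> Cinf_on (indices (base P)) D (\<lambda>v. \<psi> (s (inv_into U \<phi> v)) j)"
    unfolding D_def using smooth_map_onD[OF sm b e] by auto
  show *: "inv_into U \<phi> v \<in> U \<and> inv_into U \<phi> v \<in> W \<and> s (inv_into U \<phi> v) \<in> V \<and> \<phi> (inv_into U \<phi> v) = v"
    if "v \<in> D" for v
    using inv_chart[OF smooth_atlas_chart(1)[OF fibre_bundleD(1)[OF P] b], of v "W \<inter> s -` V"] that
    by (simp add: D_def Int_assoc)
  show "\<psi> (s (inv_into U \<phi> v)) (Inl i) = v i" if "v \<in> D" "i \<in> indices (base P)"
    using *[OF that(1)] adapted_chartsD(4)[OF c _ that(2)] s by (simp add: section_on_def)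
qed

text \<open>Push-forward along the identity of the total space. The base coordinates of both
  sections are identical, and for the fibre coordinates the hypothesis on multi-indices is upgraded
  to \<open>same_jet\<close>.\<close>

lemma jet_eq_single_chart:
  assumes P: "fibre_bundle P F" and s: "s \<in> local_sections P x" "s' \<in> local_sections P x" "s x = s' x"
    and c: "((U, \<phi>), (V, \<psi>)) \<in> adapted_charts P" "s x \<in> V"
    and eq: "\<And>j \<alpha>. j \<in> fibre_indices P \<Longrightarrow> \<alpha> \<in> multi_indices (indices (base P)) r \<Longrightarrow>
      partials \<alpha> (\<lambda>v. \<psi> (s (inv_into U \<phi> v)) (Inr j)) (\<phi> x) =
      partials \<alpha> (\<lambda>v. \<psi> (s' (inv_into U \<phi> v)) (Inr j)) (\<phi> x)"
  shows "jet_eq P r x s s'"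
proof -
  obtain W W' where W: "x \<in> W" "section_on P W s" "x \<in> W'" "section_on P W' s'"
    using s(1,2) unfolding local_sections_def by blast
  note D = section_coords[OF P W(2) c(1)] and D' = section_coords[OF P W(4) c(1)]
  let ?S = "\<phi> ` (U \<inter> W \<inter> s -` V) \<inter> \<phi> ` (U \<inter> W' \<inter> s' -` V)"
  note X = fibre_bundleD(1)[OF P] and Y = fibre_bundleD(2)[OF P]
  have S: "ropen (indices (base P)) ?S" using D(1) D'(1) by (rule openin_Int)
  have xU: "x \<in> U" using adapted_chartsD(3)[OF c] local_sections_value(2)[OF s(1)] by simp
  then have xS: "\<phi> x \<in> ?S" using W c(2) s(3) by auto
  have C: "Cinf_on (indices (base P)) ?S (\<lambda>v. \<psi> (s (inv_into U \<phi> v)) i)"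
     "Cinf_on (indices (base P)) ?S (\<lambda>v. \<psi> (s' (inv_into U \<phi> v)) i)" if "i \<in> indices (total P)" for i
    using D(2)[OF that] D'(2)[OF that] by (auto intro: Cinf_on_subset)
  have "jet_eq P r x (\<lambda>z. (\<lambda>x. x) (s z)) (\<lambda>z. (\<lambda>x. x) (s' z))"
  proof (rule jet_eq_push_forward[OF P smooth_atlas_injective[OF Y] adapted_chartsD(2)[OF c(1)]
        smooth_map_id[OF Y] adapted_chartsD(1)[OF c(1)] xU _ S xS _ _ _ s(3) C])
    show "same_jet (indices (base P)) r (\<phi> x) (\<lambda>v. \<psi> (s (inv_into U \<phi> v)) i) (\<lambda>v. \<psi> (s' (inv_into U \<phi> v)) i)"
      if i: "i \<in> indices (total P)" for i
    proof (cases i)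
      case (Inl i')
      then have "i' \<in> indices (base P)" using i fibre_bundleD(3)[OF P] by auto
      then have "\<psi> (s (inv_into U \<phi> v)) i = \<psi> (s' (inv_into U \<phi> v)) i" if "v \<in> ?S" for v
        using D(4) D'(4) that Inl by simp
      from same_jet_eqI[OF smooth_atlas_finite[OF X] S xS this] show ?thesis .
    next
      case (Inr j)
      then have "j \<in> fibre_indices P" using i by (simp add: fibre_indices_iff)
      then show ?thesis
        unfolding Inr using eq C[OF i] same_jet_iff_partials[OF smooth_atlas_finite[OF X] S xS] by (simp add: Inr)
    qed
    show "s (inv_into U \<phi> v) \<in> V \<inter> points (total P)" "s' (inv_into U \<phi> v) \<in> V \<inter> points (total P)" if "v \<in> ?S" for v
      using D(3)[of v] D'(3)[of v] that smooth_atlas_chart(3)[OF Y adapted_chartsD(2)[OF c(1)]] by blast+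
  qed (use local_sections_value(2)[OF s(1)] in auto)
  then show ?thesis by simp
qed

section \<open>Charts of the jet bundle\<close>

lemma finite_multi_indices:
  assumes "finite I"
  shows "finite (multi_indices I r)"
proof -
  have "multi_indices I r \<subseteq> mset ` {l. set l \<subseteq> I \<and> length l \<le> r}"
  proof
    fix \<alpha> assume \<alpha>: "\<alpha> \<in> multi_indices I r"
    obtain l where "mset l = \<alpha>" using ex_mset by blast
    then show "\<alpha> \<in> mset ` {l. set l \<subseteq> I \<and> length l \<le> r}"
      using \<alpha> by (auto simp: multi_indices_def)
  qed
  then show ?thesis using finite_lists_length_le[OF assms] finite_subset by blast
qed

definition jet_chart_coords where
  "jet_chart_coords P r U \<phi> \<psi> \<gamma> = restrict (case_sum (\<phi> (fst \<gamma>))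
     (\<lambda>(j, \<alpha>). partials \<alpha> (\<lambda>v. \<psi> (jet_rep \<gamma> (inv_into U \<phi> v)) (Inr j)) (\<phi> (fst \<gamma>))))
     (indices (base P) <+> (fibre_indices P \<times> multi_indices (indices (base P)) r))"

lemma jet_chart_coords_Inl:
  "i \<in> indices (base P) \<Longrightarrow> jet_chart_coords P r U \<phi> \<psi> \<gamma> (Inl i) = \<phi> (fst \<gamma>) i"
  by (auto simp: jet_chart_coords_def)

lemma jet_chart_coords_Inr:
  "j \<in> fibre_indices P \<Longrightarrow> \<alpha> \<in> multi_indices (indices (base P)) r \<Longrightarrow>
    jet_chart_coords P r U \<phi> \<psi> \<gamma> (Inr (j, \<alpha>)) =
    partials \<alpha> (\<lambda>v. \<psi> (jet_rep \<gamma> (inv_into U \<phi> v)) (Inr j)) (\<phi> (fst \<gamma>))"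
  by (auto simp: jet_chart_coords_def)

lemma jet_bundle_simps:
  "base (jet_bundle P r) = base P" "proj (jet_bundle P r) = fst"
  "points (total (jet_bundle P r)) = jets P r"
  "indices (total (jet_bundle P r)) =
    indices (base P) <+> (fibre_indices P \<times> multi_indices (indices (base P)) r)"
  "fibre_indices (jet_bundle P r) = fibre_indices P \<times> multi_indices (indices (base P)) r"
  "c \<in> atlas (total (jet_bundle P r)) \<longleftrightarrow> (\<exists>U \<phi> V \<psi>. ((U, \<phi>), (V, \<psi>)) \<in> adapted_charts P \<and>
     c = ({\<gamma> \<in> jets P r. jet_rep \<gamma> (fst \<gamma>) \<in> V}, jet_chart_coords P r U \<phi> \<psi>))"
  unfolding jet_bundle_def Let_def jet_chart_coords_def[abs_def]
  by (auto simp: fibre_indices_def)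

text \<open>The chart differentiates the representative chosen by \<open>jet_rep\<close>; as that
  choice has the same jet as \<open>s\<close>, the coordinates can be computed from \<open>s\<close>
  itself.\<close>

lemma jet_chart_coords_jet:
  assumes s: "s \<in> local_sections P x" and c: "((U, \<phi>), (V, \<psi>)) \<in> adapted_charts P" "s x \<in> V"
  shows "i \<in> indices (base P) \<Longrightarrow> jet_chart_coords P r U \<phi> \<psi> (jet P r s x) (Inl i) = \<phi> x i"
    "j \<in> fibre_indices P \<Longrightarrow> \<alpha> \<in> multi_indices (indices (base P)) r \<Longrightarrow>
      jet_chart_coords P r U \<phi> \<psi> (jet P r s x) (Inr (j, \<alpha>)) =
      partials \<alpha> (\<lambda>v. \<psi> (s (inv_into U \<phi> v)) (Inr j)) (\<phi> x)"
  using jet_eq_chartD[OF jet_rep_jet(2)[OF s] c]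
  by (simp_all add: jet_chart_coords_Inl jet_chart_coords_Inr fst_jet)

lemma partials_empty: "partials {#} f = f"
  by (simp add: partials_def)

text \<open>The base coordinates recover the base point, the base coordinates together with the
  order-zero ones recover the value of the section, and then equality of all derivatives in this one
  chart is equality of jets.\<close>

lemma jet_chart_inj:
  assumes P: "fibre_bundle P F" and c: "((U, \<phi>), (V, \<psi>)) \<in> adapted_charts P"
  shows "inj_on (jet_chart_coords P r U \<phi> \<psi>) {\<gamma> \<in> jets P r. jet_rep \<gamma> (fst \<gamma>) \<in> V}"
proof (rule inj_onI)
  fix \<gamma> \<gamma>' assume \<gamma>: "\<gamma> \<in> {\<gamma> \<in> jets P r. jet_rep \<gamma> (fst \<gamma>) \<in> V}" "\<gamma>' \<in> {\<gamma> \<in> jets P r. jet_rep \<gamma> (fst \<gamma>) \<in> V}"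
    and eq: "jet_chart_coords P r U \<phi> \<psi> \<gamma> = jet_chart_coords P r U \<phi> \<psi> \<gamma>'"
  note X = fibre_bundleD(1)[OF P] and Y = fibre_bundleD(2)[OF P]
  note b = adapted_chartsD(1)[OF c] and e = adapted_chartsD(2)[OF c]
  let ?s = "jet_rep \<gamma>" and ?s' = "jet_rep \<gamma>'"
  have s: "?s \<in> local_sections P (fst \<gamma>)" "?s' \<in> local_sections P (fst \<gamma>')" using \<gamma> jetsD(1)[of \<gamma> P r] jetsD(1)[of \<gamma>' P r] by auto
  have V: "?s (fst \<gamma>) \<in> V" "?s' (fst \<gamma>') \<in> V" using \<gamma> by auto
  have U: "fst \<gamma> \<in> U" "fst \<gamma>' \<in> U"
    using adapted_chartsD(3)[OF c V(1)] adapted_chartsD(3)[OF c V(2)] s local_sections_value(2) by metis+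
  have "\<phi> (fst \<gamma>) i = \<phi> (fst \<gamma>') i" if "i \<in> indices (base P)" for i
    using fun_cong[OF eq, of "Inl i"] that by (simp add: jet_chart_coords_Inl)
  then have "\<phi> (fst \<gamma>) = \<phi> (fst \<gamma>')"
    using smooth_atlas_extensional[OF X b U(1)] smooth_atlas_extensional[OF X b U(2)] by (intro PiE_ext)
  then have x: "fst \<gamma>' = fst \<gamma>" using inj_onD[OF smooth_atlas_chart(1)[OF X b]] U by auto
  have p: "partials \<alpha> (\<lambda>v. \<psi> (?s (inv_into U \<phi> v)) (Inr j)) (\<phi> (fst \<gamma>)) =
      partials \<alpha> (\<lambda>v. \<psi> (?s' (inv_into U \<phi> v)) (Inr j)) (\<phi> (fst \<gamma>))"
    if "j \<in> fibre_indices P" "\<alpha> \<in> multi_indices (indices (base P)) r" for j \<alpha>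
    using fun_cong[OF eq, of "Inr (j, \<alpha>)"] that by (simp add: jet_chart_coords_Inr x)
  have "\<psi> (?s (fst \<gamma>)) i = \<psi> (?s' (fst \<gamma>)) i" if i: "i \<in> indices (total P)" for i
  proof (cases i)
    case (Inl i')
    then have "i' \<in> indices (base P)" using i fibre_bundleD(3)[OF P] by auto
    then show ?thesis
      using adapted_chartsD(4)[OF c V(1)] adapted_chartsD(4)[OF c V(2)] s x local_sections_value(2) Inl by metis
  next
    case (Inr j)
    have "inv_into U \<phi> (\<phi> (fst \<gamma>)) = fst \<gamma>" using smooth_atlas_chart(1)[OF X b] U(1) by (rule inv_into_f_f)
    then show ?thesis
      \<comment> \<open>The empty multi-index stands for the fibre coordinate itself.\<close>
      using p[of j "{#}"] i Inr by (simp add: partials_empty multi_indices_def fibre_indices_iff)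
  qed
  then have "\<psi> (?s (fst \<gamma>)) = \<psi> (?s' (fst \<gamma>))"
    using PiE_ext[OF smooth_atlas_extensional[OF Y e V(1)] smooth_atlas_extensional[OF Y e V(2)]] x by simp
  then have "?s (fst \<gamma>) = ?s' (fst \<gamma>)"
    using inj_onD[OF smooth_atlas_chart(1)[OF Y e]] V x by auto
  then have "jet_eq P r (fst \<gamma>) ?s ?s'"
    using jet_eq_single_chart[OF P s(1) _ _ c V(1) p] s(2) x by simp
  from jet_eq_imp_jet_eq[OF this] show "\<gamma> = \<gamma>'"
    using jetsD(3)[of \<gamma> P r] jetsD(3)[of \<gamma>' P r] \<gamma> x by simp
qed

lemma injective_atlas_jet_bundle:
  assumes P: "fibre_bundle P F"
  shows "injective_atlas (total (jet_bundle P r))"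
  unfolding injective_atlas_def jet_bundle_simps(3,4)
proof (intro conjI)
  note X = fibre_bundleD(1)[OF P] and Y = fibre_bundleD(2)[OF P]
  have "finite (indices (base P))" "finite (indices (total P))"
    using X Y by (simp_all add: smooth_atlas_finite)
  then show "finite (indices (base P) <+> fibre_indices P \<times> multi_indices (indices (base P)) r)"
    unfolding fibre_bundleD(3)[OF P] by (simp add: finite_multi_indices)
  show "\<Union> (fst ` atlas (total (jet_bundle P r))) = jets P r"
  proof (intro equalityI subsetI)
    fix \<gamma> assume \<gamma>: "\<gamma> \<in> jets P r"
    obtain U \<phi> V \<psi> where "((U, \<phi>), (V, \<psi>)) \<in> adapted_charts P" "jet_rep \<gamma> (fst \<gamma>) \<in> V"
      using fibre_bundle_adapted_chart[OF P local_sections_value(1)[OF jetsD(1)[OF \<gamma>]]] .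
    then have "({\<gamma> \<in> jets P r. jet_rep \<gamma> (fst \<gamma>) \<in> V}, jet_chart_coords P r U \<phi> \<psi>) \<in> atlas (total (jet_bundle P r))"
        "\<gamma> \<in> {\<gamma> \<in> jets P r. jet_rep \<gamma> (fst \<gamma>) \<in> V}"
      unfolding jet_bundle_simps using \<gamma> by blast+
    then show "\<gamma> \<in> \<Union> (fst ` atlas (total (jet_bundle P r)))" by force
  qed (auto simp: jet_bundle_simps(6))
  show "\<forall>(U, \<phi>)\<in>atlas (total (jet_bundle P r)). inj_on \<phi> U \<and> \<phi> ` U \<subseteq>
      (indices (base P) <+> fibre_indices P \<times> multi_indices (indices (base P)) r) \<rightarrow>\<^sub>E UNIV"
  proof clarify
    fix S \<theta> assume "(S, \<theta>) \<in> atlas (total (jet_bundle P r))"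
    then obtain U \<phi> V \<psi> where c: "((U, \<phi>), (V, \<psi>)) \<in> adapted_charts P"
      "S = {\<gamma> \<in> jets P r. jet_rep \<gamma> (fst \<gamma>) \<in> V}" "\<theta> = jet_chart_coords P r U \<phi> \<psi>"
      unfolding jet_bundle_simps by blast
    show "inj_on \<theta> S \<and> \<theta> ` S \<subseteq>
      (indices (base P) <+> fibre_indices P \<times> multi_indices (indices (base P)) r) \<rightarrow>\<^sub>E UNIV"
      unfolding c(2,3) using jet_chart_inj[OF P c(1)]
      by (auto simp: jet_chart_coords_def)
  qed
qed

section \<open>Fibre products and their sections\<close>

lemma fibre_product_simps:
  "base (fibre_product P Q) = base P" "proj (fibre_product P Q) (p, q) = proj P p"
  "points (total (fibre_product P Q)) =
    {(p, q). p \<in> points (total P) \<and> q \<in> points (total Q) \<and> proj P p = proj Q q}"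
  "indices (total (fibre_product P Q)) = indices (base P) <+> (fibre_indices P <+> fibre_indices Q)"
  "fibre_indices (fibre_product P Q) = fibre_indices P <+> fibre_indices Q"
  "c \<in> atlas (total (fibre_product P Q)) \<longleftrightarrow> (\<exists>U \<phi> V \<psi>. (U, \<phi>) \<in> atlas (total P) \<and>
     (V, \<psi>) \<in> atlas (total Q) \<and> c = ({(p, q). p \<in> U \<and> q \<in> V \<and> proj P p = proj Q q},
       \<lambda>(p, q). case_sum (\<lambda>i. \<phi> p (Inl i)) (case_sum (\<lambda>j. \<phi> p (Inr j)) (\<lambda>k. \<psi> q (Inr k)))))"
  unfolding fibre_product_def by (auto simp: fibre_indices_def)


text \<open>A chart of the fibre product records the base coordinates of the first component only.
  Those of the second are recovered from the common base point, which is why the charts of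
  \<open>Q\<close> have to be adapted.\<close>

lemma injective_atlas_fibre_product:
  assumes P: "injective_atlas (total P)" "indices (total P) = indices (base P) <+> fibre_indices P"
    and Q: "injective_atlas (total Q)" "indices (total Q) = indices (base P) <+> fibre_indices Q"
    and ad: "\<And>V \<psi>. (V, \<psi>) \<in> atlas (total Q) \<Longrightarrow> \<exists>b. (b, (V, \<psi>)) \<in> adapted_charts Q"
    and b: "base Q = base P"
  shows "injective_atlas (total (fibre_product P Q))"
  unfolding injective_atlas_def fibre_product_simps(4)
proof (intro conjI)
  have "finite (indices (total P))" "finite (indices (total Q))"
    using P(1) Q(1) by (simp_all add: injective_atlas_def)
  then show "finite (indices (base P) <+> (fibre_indices P <+> fibre_indices Q))"
    unfolding P(2) Q(2) by simp
  show "\<Union> (fst ` atlas (total (fibre_product P Q))) = points (total (fibre_product P Q))"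
  proof (intro equalityI subsetI)
    fix x assume x: "x \<in> points (total (fibre_product P Q))"
    then obtain p q where pq: "x = (p, q)" "p \<in> points (total P)" "q \<in> points (total Q)" "proj P p = proj Q q"
      unfolding fibre_product_simps by blast
    obtain U \<phi> V \<psi> where "(U, \<phi>) \<in> atlas (total P)" "p \<in> U" "(V, \<psi>) \<in> atlas (total Q)" "q \<in> V"
      using injective_atlas_points[OF P(1)] injective_atlas_points[OF Q(1)] pq by blast
    then have "({(p, q). p \<in> U \<and> q \<in> V \<and> proj P p = proj Q q},
       \<lambda>(p, q). case_sum (\<lambda>i. \<phi> p (Inl i)) (case_sum (\<lambda>j. \<phi> p (Inr j)) (\<lambda>k. \<psi> q (Inr k))))
         \<in> atlas (total (fibre_product P Q))" "x \<in> {(p, q). p \<in> U \<and> q \<in> V \<and> proj P p = proj Q q}"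
      unfolding fibre_product_simps using pq by blast+
    then show "x \<in> \<Union> (fst ` atlas (total (fibre_product P Q)))" by force
  next
    fix x assume "x \<in> \<Union> (fst ` atlas (total (fibre_product P Q)))"
    then obtain S \<theta> where "(S, \<theta>) \<in> atlas (total (fibre_product P Q))" "x \<in> S" by force
    then show "x \<in> points (total (fibre_product P Q))"
      unfolding fibre_product_simps using injective_atlas_points[OF P(1)] injective_atlas_points[OF Q(1)] by blast
  qed
  have chart: "inj_on \<theta> S \<and> \<theta> ` S \<subseteq> (indices (base P) <+> (fibre_indices P <+> fibre_indices Q)) \<rightarrow>\<^sub>E UNIV"
    if "(S, \<theta>) \<in> atlas (total (fibre_product P Q))" for S \<theta>
  proof -
    from that obtain U \<phi> V \<psi> where c: "(U, \<phi>) \<in> atlas (total P)" "(V, \<psi>) \<in> atlas (total Q)"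
      and S: "S = {(p, q). p \<in> U \<and> q \<in> V \<and> proj P p = proj Q q}"
      and \<theta>: "\<theta> = (\<lambda>(p, q). case_sum (\<lambda>i. \<phi> p (Inl i)) (case_sum (\<lambda>j. \<phi> p (Inr j)) (\<lambda>k. \<psi> q (Inr k))))"
      unfolding fibre_product_simps by blast
    note eP = injective_atlas_chart(2)[OF P(1) c(1), unfolded P(2)]
      and eQ = injective_atlas_chart(2)[OF Q(1) c(2), unfolded Q(2)]
    obtain B \<beta> where B: "((B, \<beta>), (V, \<psi>)) \<in> adapted_charts Q" using ad[OF c(2)] by force
    have "inj_on \<theta> S"
    proof (rule inj_onI)
      fix x y assume x: "x \<in> S" and y: "y \<in> S" and eq: "\<theta> x = \<theta> y"
      obtain p q p' q' where pq: "x = (p, q)" "y = (p', q')" by (metis surj_pair)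
      have m: "p \<in> U" "q \<in> V" "proj P p = proj Q q" "p' \<in> U" "q' \<in> V" "proj P p' = proj Q q'"
        using x y by (auto simp: S pq)
      have e: "\<phi> p (Inl i) = \<phi> p' (Inl i)" "\<phi> p (Inr j) = \<phi> p' (Inr j)" "\<psi> q (Inr k) = \<psi> q' (Inr k)" for i j k
        using fun_cong[OF eq, of "Inl i"] fun_cong[OF eq, of "Inr (Inl j)"] fun_cong[OF eq, of "Inr (Inr k)"]
        by (simp_all add: \<theta> pq)
      have "\<phi> p = \<phi> p'"
      proof
        show "\<phi> p i = \<phi> p' i" for i using e by (cases i) auto
      qed
      then have pp: "p = p'" using inj_onD[OF injective_atlas_chart(1)[OF P(1) c(1)]] m by blast
      have "\<psi> q i = \<psi> q' i" if "i \<in> indices (base P) <+> fibre_indices Q" for i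
      proof (cases i)
        case (Inl i')
        then have "i' \<in> indices (base Q)" using that b by auto
        then show ?thesis
          unfolding Inl using adapted_chartsD(4)[OF B m(2)] adapted_chartsD(4)[OF B m(5)] m pp by simp
      qed (simp add: e)
      then have "\<psi> q = \<psi> q'" by (rule PiE_ext[OF eQ[OF m(2)] eQ[OF m(5)]])
      then have "q = q'" using inj_onD[OF injective_atlas_chart(1)[OF Q(1) c(2)]] m by blast
      then show "x = y" using pp pq by simp
    qed
    moreover have "\<theta> x \<in> (indices (base P) <+> (fibre_indices P <+> fibre_indices Q)) \<rightarrow>\<^sub>E UNIV" if x: "x \<in> S" for x
    proof -
      obtain p q where pq: "x = (p, q)" "p \<in> U" "q \<in> V" using x S by blast
      have ep: "\<phi> p i = undefined" if "i \<notin> indices (base P) <+> fibre_indices P" for i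
        by (rule PiE_arb[OF eP[OF pq(2)] that])
      have eq: "\<psi> q i = undefined" if "i \<notin> indices (base P) <+> fibre_indices Q" for i
        by (rule PiE_arb[OF eQ[OF pq(3)] that])
      have "\<theta> x i = undefined" if "i \<notin> indices (base P) <+> (fibre_indices P <+> fibre_indices Q)" for i
        using that ep eq unfolding \<theta> pq(1) by (cases i rule: sum.exhaust[case_names l r]) (auto split: sum.splits)
      then show ?thesis by (simp add: PiE_iff extensional_def)
    qed
    ultimately show ?thesis by blast
  qed
  then show "\<forall>(U, \<phi>)\<in>atlas (total (fibre_product P Q)). inj_on \<phi> U \<and>
      \<phi> ` U \<subseteq> (indices (base P) <+> (fibre_indices P <+> fibre_indices Q)) \<rightarrow>\<^sub>E UNIV"
    by blast
qed

lemma smooth_map_on_subset: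
  assumes M: "smooth_atlas M" and f: "smooth_map_on M N W f"
    and W': "openin (mfd_topology M) W'" "W' \<subseteq> W"
  shows "smooth_map_on M N W' f"
proof -
  have "ropen (indices M) (\<phi> ` (U \<inter> W' \<inter> f -` V)) \<and>
      (\<forall>j\<in>indices N. Cinf_on (indices M) (\<phi> ` (U \<inter> W' \<inter> f -` V)) (\<lambda>v. \<psi> (f (inv_into U \<phi> v)) j))"
    if c: "(U, \<phi>) \<in> atlas M" "(V, \<psi>) \<in> atlas N" for U \<phi> V \<psi>
  proof -
    have "\<phi> ` (U \<inter> W' \<inter> f -` V) = \<phi> ` (U \<inter> W') \<inter> \<phi> ` (U \<inter> W \<inter> f -` V)"
      using smooth_atlas_chart(1)[OF M c(1)] W'(2) by (auto simp: inj_on_def)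
    then show ?thesis
      using smooth_map_onD[OF f c] chart_image_openin[OF M W'(1) c(1)]
      by (auto intro: Cinf_on_subset[OF smooth_map_onD(2)[OF f c]])
  qed
  then show ?thesis using f W' unfolding smooth_map_on_def by (auto simp: image_subset_iff)
qed

lemma smooth_map_on_cong:
  assumes M: "smooth_atlas M" and f: "smooth_map_on M N W f" and eq: "\<And>x. x \<in> W \<Longrightarrow> f x = g x"
  shows "smooth_map_on M N W g"
proof -
  have "ropen (indices M) (\<phi> ` (U \<inter> W \<inter> g -` V)) \<and>
      (\<forall>j\<in>indices N. Cinf_on (indices M) (\<phi> ` (U \<inter> W \<inter> g -` V)) (\<lambda>v. \<psi> (g (inv_into U \<phi> v)) j))"
    if c: "(U, \<phi>) \<in> atlas M" "(V, \<psi>) \<in> atlas N" for U \<phi> V \<psi>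
  proof -
    have D: "U \<inter> W \<inter> g -` V = U \<inter> W \<inter> f -` V" using eq by auto
    note f' = smooth_map_onD[OF f c]
    have "Cinf_on (indices M) (\<phi> ` (U \<inter> W \<inter> f -` V)) (\<lambda>v. \<psi> (g (inv_into U \<phi> v)) j)"
      if "j \<in> indices N" for j
      by (rule Cinf_on_eq[OF smooth_atlas_finite[OF M] f'(1) f'(2)[OF that]])
        (use inv_chart(2)[OF smooth_atlas_chart(1)[OF M c(1)]] eq in \<open>auto simp: Int_assoc\<close>)
    then show ?thesis using f'(1) unfolding D by blast
  qed
  then show ?thesis using f eq unfolding smooth_map_on_def by (auto simp: image_subset_iff)
qed

lemma section_on_points:
  assumes "smooth_atlas (base P)" "section_on P W s" "z \<in> W"
  shows "z \<in> points (base P)" "s z \<in> points (total P)" "proj P (s z) = z"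
  using assms openin_subset[of "mfd_topology (base P)" W] topspace_mfd_topology[OF assms(1)]
  unfolding section_on_def by (auto dest: smooth_map_on_openin smooth_map_on_image)

lemma section_on_openin: "section_on P W s \<Longrightarrow> openin (mfd_topology (base P)) W"
  by (auto simp: section_on_def dest: smooth_map_on_openin)

lemma section_on_local: "section_on P W s \<Longrightarrow> z \<in> W \<Longrightarrow> s \<in> local_sections P z"
  by (auto simp: local_sections_def)

lemma section_on_cong:
  assumes "smooth_atlas (base P)" "section_on P W s" "\<And>x. x \<in> W \<Longrightarrow> s x = s' x"
  shows "section_on P W s'"
  using assms smooth_map_on_cong[OF assms(1), of "total P" W s s'] unfolding section_on_def by simp

lemma section_on_subset:
  assumes "smooth_atlas (base P)" "section_on P W s" "openin (mfd_topology (base P)) W'" "W' \<subseteq> W"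
  shows "section_on P W' s"
  using assms smooth_map_on_subset[OF assms(1)] unfolding section_on_def by blast

lemma section_on_pair:
  assumes P: "fibre_bundle P F" and b: "base Q = base P"
    and s: "section_on P W s" and t: "section_on Q W t"
  shows "section_on (fibre_product P Q) W (\<lambda>z. (s z, t z))"
proof -
  note X = fibre_bundleD(1)[OF P]
  have XQ: "smooth_atlas (base Q)" using X b by simp
  have s': "smooth_map_on (base P) (total P) W s" and t': "smooth_map_on (base P) (total Q) W t"
    using s t b by (simp_all add: section_on_def)
  have "smooth_map_on (base P) (total (fibre_product P Q)) W (\<lambda>z. (s z, t z))"
  proof (rule smooth_map_onI[OF X section_on_openin[OF s]])
    show "(s x, t x) \<in> points (total (fibre_product P Q))" if "x \<in> W" for x
      using section_on_points[OF X s that] section_on_points[OF XQ t that] by (simp add: fibre_product_simps)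
    fix p C \<theta> assume p: "p \<in> W" and C: "(C, \<theta>) \<in> atlas (total (fibre_product P Q))" "(s p, t p) \<in> C"
    then obtain V \<psi> V2 \<psi>2 where V: "(V, \<psi>) \<in> atlas (total P)" "(V2, \<psi>2) \<in> atlas (total Q)"
      and Cd: "C = {(p, q). p \<in> V \<and> q \<in> V2 \<and> proj P p = proj Q q}"
      and \<theta>: "\<theta> = (\<lambda>(p, q). case_sum (\<lambda>i. \<psi> p (Inl i)) (case_sum (\<lambda>j. \<psi> p (Inr j)) (\<lambda>k. \<psi>2 q (Inr k))))"
      unfolding fibre_product_simps by blast
    have pV: "s p \<in> V" "t p \<in> V2" using C(2) by (auto simp: Cd)
    obtain U \<phi> where c: "((U, \<phi>), (V, \<psi>)) \<in> adapted_charts P" using fibre_bundleD(4)[OF P V(1)] by force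
    note u = adapted_chartsD(1)[OF c]
    have pU: "p \<in> U" using adapted_chartsD(3)[OF c pV(1)] section_on_points(3)[OF X s p] by simp
    let ?D = "\<phi> ` (U \<inter> W \<inter> s -` V)" and ?B = "\<phi> ` (U \<inter> W \<inter> t -` V2)"
    note D = smooth_map_onD[OF s' u V(1)] and B = smooth_map_onD[OF t' u V(2)]
    note inj = smooth_atlas_chart(1)[OF X u]
    have z: "inv_into U \<phi> v \<in> W" "s (inv_into U \<phi> v) \<in> V" "t (inv_into U \<phi> v) \<in> V2"
      "inv_into U \<phi> v \<in> U" "\<phi> (inv_into U \<phi> v) = v" if "v \<in> ?D \<inter> ?B" for v
      using that inv_chart[OF inj, of v "W \<inter> s -` V"] inv_chart[OF inj, of v "W \<inter> t -` V2"] by (auto simp: Int_assoc)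
    have "Cinf_on (indices (base P)) (?D \<inter> ?B) (\<lambda>v. \<theta> (s (inv_into U \<phi> v), t (inv_into U \<phi> v)) j)"
      if j: "j \<in> indices (total (fibre_product P Q))" for j
    proof -
      consider i where "j = Inl i" "Inl i \<in> indices (total P)" | i where "j = Inr (Inl i)" "Inr i \<in> indices (total P)"
        | i where "j = Inr (Inr i)" "Inr i \<in> indices (total Q)"
        using j fibre_bundleD(3)[OF P] unfolding fibre_product_simps by (auto simp: fibre_indices_iff)
      then show ?thesis
        using D(2) B(2) by cases (auto simp: \<theta> intro: Cinf_on_subset)
    qed
    moreover have "?D \<inter> ?B \<subseteq> \<phi> ` (U \<inter> W \<inter> (\<lambda>z. (s z, t z)) -` C)"
    proof
      fix v assume v: "v \<in> ?D \<inter> ?B"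
      show "v \<in> \<phi> ` (U \<inter> W \<inter> (\<lambda>z. (s z, t z)) -` C)"
        using z[OF v] section_on_points(3)[OF X s z(1)[OF v]] section_on_points(3)[OF XQ t z(1)[OF v]]
        by (intro image_eqI[of _ _ "inv_into U \<phi> v"]) (auto simp: Cd)
    qed
    moreover have "\<phi> p \<in> ?D \<inter> ?B" using p pU pV by blast
    ultimately show "smooth_in_chart (base P) (total (fibre_product P Q)) W (\<lambda>z. (s z, t z)) p C \<theta>"
      using u pU openin_Int[OF D(1) B(1)] by blast
  qed
  then show ?thesis
    using section_on_points(3)[OF X s] by (simp add: section_on_def fibre_product_simps)
qed

text \<open>All coordinates of the components occur in the chart of the fibre product, except the
  base coordinates of the second; these are coordinate functions when the base chart is well
  chosen.\<close>

lemma section_on_components: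
  assumes P: "fibre_bundle P F" and Q: "fibre_bundle Q F'" and b: "base Q = base P"
    and s: "section_on (fibre_product P Q) W s"
  shows "section_on P W (fst \<circ> s)" "section_on Q W (snd \<circ> s)"
proof -
  note X = fibre_bundleD(1)[OF P]
  have s': "smooth_map_on (base P) (total (fibre_product P Q)) W s"
    and W: "openin (mfd_topology (base P)) W"
    using s section_on_openin[OF s] by (simp_all add: section_on_def fibre_product_simps)
  have pt: "fst (s z) \<in> points (total P)" "snd (s z) \<in> points (total Q)" "proj P (fst (s z)) = z"
    "proj Q (snd (s z)) = z" if "z \<in> W" for z
  proof -
    have "s z \<in> points (total (fibre_product P Q))" "proj (fibre_product P Q) (s z) = z"
      using s that smooth_map_on_image[OF s' that] by (auto simp: section_on_def)
    then show "fst (s z) \<in> points (total P)" "snd (s z) \<in> points (total Q)" "proj P (fst (s z)) = z"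
      "proj Q (snd (s z)) = z"
      by (cases "s z"; simp add: fibre_product_simps)+
  qed
  have loc: "\<exists>U \<phi> S. (U, \<phi>) \<in> atlas (base P) \<and> p \<in> U \<and> ropen (indices (base P)) S \<and> \<phi> p \<in> S \<and>
        S \<subseteq> \<phi> ` (U \<inter> W \<inter> (fst \<circ> s) -` V) \<and> S \<subseteq> \<phi> ` (U \<inter> W \<inter> (snd \<circ> s) -` V2) \<and>
        (\<forall>j\<in>indices (total P). Cinf_on (indices (base P)) S (\<lambda>v. \<psi> ((fst \<circ> s) (inv_into U \<phi> v)) j)) \<and>
        (\<forall>j\<in>indices (total Q). Cinf_on (indices (base P)) S (\<lambda>v. \<psi>2 ((snd \<circ> s) (inv_into U \<phi> v)) j))"
    if p: "p \<in> W" and V: "(V, \<psi>) \<in> atlas (total P)" "(V2, \<psi>2) \<in> atlas (total Q)"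
      "fst (s p) \<in> V" "snd (s p) \<in> V2" for p V \<psi> V2 \<psi>2
  proof -
    \<comment> \<open>The base chart to which \<open>V2\<close> is adapted, so that the base
      coordinates of the second component become the coordinate functions
      \<open>v i\<close>.\<close>
    obtain U \<phi> where c: "((U, \<phi>), (V2, \<psi>2)) \<in> adapted_charts Q" using fibre_bundleD(4)[OF Q V(2)] by force
    note u = adapted_chartsD(1)[OF c, unfolded b]
    define C where "C = {(p, q). p \<in> V \<and> q \<in> V2 \<and> proj P p = proj Q q}"
    define \<theta> where "\<theta> = (\<lambda>(p, q). case_sum (\<lambda>i. \<psi> p (Inl i)) (case_sum (\<lambda>j. \<psi> p (Inr j)) (\<lambda>k. \<psi>2 q (Inr k))))"
    have C: "(C, \<theta>) \<in> atlas (total (fibre_product P Q))"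
      using V(1,2) unfolding C_def \<theta>_def fibre_product_simps by blast
    have pU: "p \<in> U" using adapted_chartsD(3)[OF c V(4)] pt[OF p] by simp
    have pC: "s p \<in> C" using V pt[OF p] by (cases "s p") (simp add: C_def)
    let ?D = "\<phi> ` (U \<inter> W \<inter> s -` C)"
    note D = smooth_map_onD[OF s' u C]
    note inj = smooth_atlas_chart(1)[OF X u] and fin = smooth_atlas_finite[OF X]
    have z: "inv_into U \<phi> v \<in> W" "fst (s (inv_into U \<phi> v)) \<in> V" "snd (s (inv_into U \<phi> v)) \<in> V2"
      "inv_into U \<phi> v \<in> U" "\<phi> (inv_into U \<phi> v) = v" if "v \<in> ?D" for v
      using that inv_chart[OF inj, of v "W \<inter> s -` C"] by (auto simp: Int_assoc C_def)
    have \<theta>s: "\<theta> y (Inl i) = \<psi> (fst y) (Inl i)" "\<theta> y (Inr (Inl j)) = \<psi> (fst y) (Inr j)"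
      "\<theta> y (Inr (Inr k)) = \<psi>2 (snd y) (Inr k)" for y i j k
      by (simp_all add: \<theta>_def case_prod_unfold)
    have C1: "Cinf_on (indices (base P)) ?D (\<lambda>v. \<psi> ((fst \<circ> s) (inv_into U \<phi> v)) j)" if "j \<in> indices (total P)" for j
    proof (cases j)
      case (Inl i)
      then show ?thesis using D(2)[of "Inl i"] that fibre_bundleD(3)[OF P] by (auto simp: \<theta>s fibre_product_simps)
    next
      case (Inr i)
      then show ?thesis using D(2)[of "Inr (Inl i)"] that fibre_bundleD(3)[OF P] by (auto simp: \<theta>s fibre_product_simps)
    qed
    have C2: "Cinf_on (indices (base P)) ?D (\<lambda>v. \<psi>2 ((snd \<circ> s) (inv_into U \<phi> v)) j)" if "j \<in> indices (total Q)" for j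
    proof (cases j)
      case (Inl i)
      then have i: "i \<in> indices (base P)" using that fibre_bundleD(3)[OF Q] b by auto
      show ?thesis
      proof (rule Cinf_on_eq[OF fin D(1) Cinf_on_coord[OF fin D(1) i]])
        fix v assume v: "v \<in> ?D"
        show "v i = \<psi>2 ((snd \<circ> s) (inv_into U \<phi> v)) j"
          using adapted_chartsD(4)[OF c z(3)[OF v]] i b pt(4)[OF z(1)[OF v]] z(5)[OF v] by (simp add: Inl)
      qed
    next
      case (Inr i)
      then show ?thesis using D(2)[of "Inr (Inr i)"] that fibre_bundleD(3)[OF Q] by (auto simp: \<theta>s fibre_product_simps)
    qed
    have "?D \<subseteq> \<phi> ` (U \<inter> W \<inter> (fst \<circ> s) -` V)" "?D \<subseteq> \<phi> ` (U \<inter> W \<inter> (snd \<circ> s) -` V2)"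
      by (auto simp: C_def intro!: imageI)
    moreover have "\<phi> p \<in> ?D" using p pU pC by blast
    ultimately show ?thesis using u pU D(1) C1 C2 by blast
  qed
  have "smooth_map_on (base P) (total P) W (fst \<circ> s)"
  proof (rule smooth_map_onI[OF X W])
    show "(fst \<circ> s) x \<in> points (total P)" if "x \<in> W" for x using pt[OF that] by simp
    fix p V \<psi> assume p: "p \<in> W" and V: "(V, \<psi>) \<in> atlas (total P)" "(fst \<circ> s) p \<in> V"
    obtain V2 \<psi>2 where V2: "(V2, \<psi>2) \<in> atlas (total Q)" "snd (s p) \<in> V2"
      using smooth_atlas_point_chart[OF fibre_bundleD(2)[OF Q] pt(2)[OF p]] .
    show "smooth_in_chart (base P) (total P) W (fst \<circ> s) p V \<psi>"
      using loc[OF p V(1) V2(1) _ V2(2)] V(2) by (simp only: comp_apply) blast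
  qed
  then show "section_on P W (fst \<circ> s)" using pt(3) by (simp add: section_on_def)
  have "smooth_map_on (base P) (total Q) W (snd \<circ> s)"
  proof (rule smooth_map_onI[OF X W])
    show "(snd \<circ> s) x \<in> points (total Q)" if "x \<in> W" for x using pt[OF that] by simp
    fix p V2 \<psi>2 assume p: "p \<in> W" and V2: "(V2, \<psi>2) \<in> atlas (total Q)" "(snd \<circ> s) p \<in> V2"
    obtain V \<psi> where V: "(V, \<psi>) \<in> atlas (total P)" "fst (s p) \<in> V"
      using smooth_atlas_point_chart[OF fibre_bundleD(2)[OF P] pt(1)[OF p]] .
    show "smooth_in_chart (base P) (total Q) W (snd \<circ> s) p V2 \<psi>2"
      using loc[OF p V(1) V2(1) V(2)] V2(2) by (simp only: comp_apply) blast
  qed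
  then show "section_on Q W (snd \<circ> s)" using pt(4) by (simp add: section_on_def b)
qed


section \<open>The transformed field depends on finitely many derivatives\<close>

lemma Cinf_on_partials:
  assumes "Cinf_on I U f" "\<alpha> \<in> multi_indices I r"
  shows "Cinf_on I U (partials \<alpha> f)"
  using assms unfolding partials_def by (intro Cinf_on_foldr_partial) (auto simp: multi_indices_def)

lemma same_jet_of_partials:
  assumes "same_jet I (k + r) v f g" "\<alpha> \<in> multi_indices I k"
  shows "same_jet I r v (partials \<alpha> f) (partials \<alpha> g)"
proof -
  have "length (sorted_list_of_multiset \<alpha>) = size \<alpha>"
    by (metis mset_sorted_list_of_multiset size_mset)
  then show ?thesis
    unfolding partials_def using assms
    by (intro same_jet_foldr same_jet_mono[OF assms(1)]) (auto simp: multi_indices_def)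
qed

abbreviation gauged where
  "gauged E Y k a s \<equiv> gauge_map E Y k a (fst \<circ> s) \<circ> (snd \<circ> s)"

abbreviation jet_pairs where
  "jet_pairs E k Y \<equiv> total (fibre_product (jet_bundle E k) Y)"

lemma injective_atlas_jet_fibre_product:
  assumes E: "fibre_bundle E F_E" and Y: "fibre_bundle Y F_Y" and b: "base Y = base E"
  shows "injective_atlas (jet_pairs E k Y)"
  using fibre_bundleD(3,4)[OF Y] b
  by (intro injective_atlas_fibre_product injective_atlas_jet_bundle[OF E]
      smooth_atlas_injective[OF fibre_bundleD(2)[OF Y]]) (simp_all add: jet_bundle_simps)

text \<open>With \<open>jet_pair_coords\<close>, this names the charts of \<open>jet_pairs\<close>
  with both layers of the construction, jet bundle and fibre product, unfolded, so that coordinates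
  can be read off from a section.\<close>

definition jet_pair_dom where
  "jet_pair_dom E Y k V V2 =
     {(\<gamma>, y). \<gamma> \<in> {\<gamma> \<in> jets E k. jet_rep \<gamma> (fst \<gamma>) \<in> V} \<and> y \<in> V2 \<and> fst \<gamma> = proj Y y}"

definition jet_pair_coords where
  "jet_pair_coords E k U \<phi> \<psi> \<psi>2 = (\<lambda>(\<gamma>, y). case_sum (\<lambda>i. jet_chart_coords E k U \<phi> \<psi> \<gamma> (Inl i))
     (case_sum (\<lambda>j. jet_chart_coords E k U \<phi> \<psi> \<gamma> (Inr j)) (\<lambda>m. \<psi>2 y (Inr m))))"

lemma jet_pair_atlas:
  "c \<in> atlas (jet_pairs E k Y) \<longleftrightarrow> (\<exists>U \<phi> V \<psi> V2 \<psi>2.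
     ((U, \<phi>), (V, \<psi>)) \<in> adapted_charts E \<and> (V2, \<psi>2) \<in> atlas (total Y) \<and>
     c = (jet_pair_dom E Y k V V2, jet_pair_coords E k U \<phi> \<psi> \<psi>2))"
  unfolding fibre_product_simps jet_bundle_simps jet_pair_dom_def jet_pair_coords_def by blast

lemma jet_pair_dom_iff:
  assumes "z \<in> points (base E)" "\<eta> \<in> local_sections E z" "proj Y y = z"
  shows "(jet E k \<eta> z, y) \<in> jet_pair_dom E Y k V V2 \<longleftrightarrow> \<eta> z \<in> V \<and> y \<in> V2"
  using assms jet_in_jets[OF assms(1,2), of k]
  by (simp add: jet_pair_dom_def fst_jet jet_rep_jet_value)

lemma jet_pair_points:
  assumes "z \<in> points (base E)" "\<eta> \<in> local_sections E z" "y \<in> points (total Y)" "proj Y y = z"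
  shows "(jet E k \<eta> z, y) \<in> points (jet_pairs E k Y)"
  using assms jet_in_jets[OF assms(1,2), of k]
  by (simp add: fibre_product_simps jet_bundle_simps fst_jet)

lemma jet_pair_coords_jet:
  assumes s: "\<eta> \<in> local_sections E z" and c: "((U, \<phi>), (V, \<psi>)) \<in> adapted_charts E" "\<eta> z \<in> V"
  shows "i \<in> indices (base E) \<Longrightarrow> jet_pair_coords E k U \<phi> \<psi> \<psi>2 (jet E k \<eta> z, y) (Inl i) = \<phi> z i"
    "j \<in> fibre_indices E \<Longrightarrow> \<alpha> \<in> multi_indices (indices (base E)) k \<Longrightarrow>
      jet_pair_coords E k U \<phi> \<psi> \<psi>2 (jet E k \<eta> z, y) (Inr (Inl (j, \<alpha>))) =
      partials \<alpha> (\<lambda>v. \<psi> (\<eta> (inv_into U \<phi> v)) (Inr j)) (\<phi> z)"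
    "jet_pair_coords E k U \<phi> \<psi> \<psi>2 (jet E k \<eta> z, y) (Inr (Inr m)) = \<psi>2 y (Inr m)"
  using jet_chart_coords_jet[OF assms] by (simp_all add: jet_pair_coords_def)

lemma jet_pair_index_cases:
  assumes "i \<in> indices (jet_pairs E k Y)"
  obtains (base) i' where "i = Inl i'" "i' \<in> indices (base E)"
    | (jet) j \<alpha> where "i = Inr (Inl (j, \<alpha>))" "j \<in> fibre_indices E" "\<alpha> \<in> multi_indices (indices (base E)) k"
    | (fibre) m where "i = Inr (Inr m)" "m \<in> fibre_indices Y"
  using assms by (auto simp: fibre_product_simps jet_bundle_simps)

text \<open>The coordinates of the k-jet of \<eta> are its partial derivatives of order at most
  \<open>k\<close>; if the sections agree to order \<open>k + r\<close>, these coordinates still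
  agree to order \<open>r\<close>. Pushing forward along the smooth law \<open>a\<close> keeps that
  order.\<close>

lemma gauge_map_determined_by_jet:
  fixes E :: "('x, 'i::linorder, 'e, 'l) fibred" and Y :: "('x, 'i, 'y, 'j) fibred"
  assumes E: "fibre_bundle E F_E" and Y: "fibre_bundle Y F_Y" and b: "base Y = base E"
    and a: "smooth_map (jet_pairs E k Y) (total Y) (\<lambda>(\<gamma>, y). a \<gamma> y)"
    and pr: "\<forall>(\<gamma>, y)\<in>points (jet_pairs E k Y). proj Y (a \<gamma> y) = proj Y y"
    and s: "s \<in> local_sections (fibre_product E Y) x" "s' \<in> local_sections (fibre_product E Y) x"
    and eq: "jet_eq (fibre_product E Y) (k + r) x s s'"
  shows "jet_eq Y r x (gauged E Y k a s) (gauged E Y k a s')"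
proof -
  note X = fibre_bundleD(1)[OF E] and XY = fibre_bundleD(1)[OF Y]
  note fin = smooth_atlas_finite[OF X]
  define I where "I = indices (base E)"
  \<comment> \<open>The curve of arguments fed to the law \<open>a\<close>: near \<open>x\<close>,
    applying \<open>a\<close> to it gives the transformed field.\<close>
  define \<sigma> where "\<sigma> s z = (jet E k (fst \<circ> s) z, snd (s z))" for s :: "'x \<Rightarrow> 'e \<times> 'y" and z
  obtain W W' where W: "x \<in> W" "section_on (fibre_product E Y) W s"
      and W': "x \<in> W'" "section_on (fibre_product E Y) W' s'"
    using s unfolding local_sections_def by blast
  note sE = section_on_components(1)[OF E Y b W(2)] and sY = section_on_components(2)[OF E Y b W(2)]
  note sE' = section_on_components(1)[OF E Y b W'(2)] and sY' = section_on_components(2)[OF E Y b W'(2)]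
  note pE = section_on_points[OF X sE] and pY = section_on_points[OF XY sY]
  note pE' = section_on_points[OF X sE'] and pY' = section_on_points[OF XY sY']
  have \<sigma>p: "\<sigma> s z \<in> points (jet_pairs E k Y)" if "z \<in> W" for z
    unfolding \<sigma>_def using pE(1)[OF that] section_on_local[OF sE that] pY(2,3)[OF that] by (intro jet_pair_points) auto
  have \<sigma>p': "\<sigma> s' z \<in> points (jet_pairs E k Y)" if "z \<in> W'" for z
    unfolding \<sigma>_def using pE'(1)[OF that] section_on_local[OF sE' that] pY'(2,3)[OF that] by (intro jet_pair_points) auto
  define g where "g = (\<lambda>(\<gamma>, y). a \<gamma> y)"
  have g: "smooth_map_on (jet_pairs E k Y) (total Y)
      (points (jet_pairs E k Y)) g"
    using a by (simp add: smooth_map_def g_def)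
  have gg: "g (\<sigma> s z) = (gauged E Y k a s) z" if "z \<in> W" for z
    using pY(3)[OF that] by (simp add: g_def \<sigma>_def gauge_map_def)
  have gg': "g (\<sigma> s' z) = (gauged E Y k a s') z" if "z \<in> W'" for z
    using pY'(3)[OF that] by (simp add: g_def \<sigma>_def gauge_map_def)
  have pg: "proj Y (g (\<sigma> s x)) = x"
  proof -
    have "proj Y (g (\<sigma> s x)) = proj Y (snd (\<sigma> s x))"
      using pr \<sigma>p[OF W(1)] by (cases "\<sigma> s x") (auto simp: g_def)
    then show ?thesis using pY(3)[OF W(1)] by (simp add: \<sigma>_def)
  qed
  have sx: "s x = s' x" using eq by (simp add: jet_eq_def)
  obtain U \<phi> V \<psi> where c: "((U, \<phi>), (V, \<psi>)) \<in> adapted_charts E" "fst (s x) \<in> V"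
    using fibre_bundle_adapted_chart[OF E pE(2)[OF W(1), unfolded comp_apply]] .
  obtain V2 \<psi>2 where V2: "(V2, \<psi>2) \<in> atlas (total Y)" "snd (s x) \<in> V2"
    using smooth_atlas_point_chart[OF fibre_bundleD(2)[OF Y], of "snd (s x)"] pY(2)[OF W(1)] by auto
  note u = adapted_chartsD(1)[OF c(1)]
  note inj = smooth_atlas_chart(1)[OF X u]
  have xU: "x \<in> U" using adapted_chartsD(3)[OF c] pE(3)[OF W(1)] by simp
  let ?D = "\<phi> ` (U \<inter> W \<inter> (fst \<circ> s) -` V)" and ?D' = "\<phi> ` (U \<inter> W' \<inter> (fst \<circ> s') -` V)"
  let ?B = "\<phi> ` (U \<inter> W \<inter> (snd \<circ> s) -` V2)" and ?B' = "\<phi> ` (U \<inter> W' \<inter> (snd \<circ> s') -` V2)"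
  define S where "S = (?D \<inter> ?D') \<inter> (?B \<inter> ?B')"
  note D = section_coords[OF E sE c(1)] and D' = section_coords[OF E sE' c(1)]
  have smY: "smooth_map_on (base E) (total Y) W (snd \<circ> s)" "smooth_map_on (base E) (total Y) W' (snd \<circ> s')"
    using sY sY' by (simp_all add: section_on_def b)
  note B = smooth_map_onD[OF smY(1) u V2(1)] and B' = smooth_map_onD[OF smY(2) u V2(1)]
  have S: "ropen I S"
    unfolding S_def I_def by (intro openin_Int D(1) D'(1) B(1) B'(1))
  have xS: "\<phi> x \<in> S" unfolding S_def using xU W(1) W'(1) c(2) V2(2) sx by auto
  have zS: "inv_into U \<phi> v \<in> W" "inv_into U \<phi> v \<in> W'" "fst (s (inv_into U \<phi> v)) \<in> V" "fst (s' (inv_into U \<phi> v)) \<in> V"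
      "snd (s (inv_into U \<phi> v)) \<in> V2" "snd (s' (inv_into U \<phi> v)) \<in> V2" "\<phi> (inv_into U \<phi> v) = v" if "v \<in> S" for v
    using that D(3)[of v] D'(3)[of v] inv_chart[OF inj, of v "W \<inter> (snd \<circ> s) -` V2"]
      inv_chart[OF inj, of v "W' \<inter> (snd \<circ> s') -` V2"] by (auto simp: S_def Int_assoc)
  have CE: "Cinf_on I S (\<lambda>v. \<psi> (fst (s (inv_into U \<phi> v))) (Inr j))"
      "Cinf_on I S (\<lambda>v. \<psi> (fst (s' (inv_into U \<phi> v))) (Inr j))" if "j \<in> fibre_indices E" for j
    using Cinf_on_subset[OF D(2), of "Inr j" S] Cinf_on_subset[OF D'(2), of "Inr j" S] that
    by (auto simp: S_def I_def fibre_indices_iff)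
  have CY: "Cinf_on I S (\<lambda>v. \<psi>2 (snd (s (inv_into U \<phi> v))) (Inr j))"
      "Cinf_on I S (\<lambda>v. \<psi>2 (snd (s' (inv_into U \<phi> v))) (Inr j))" if "j \<in> fibre_indices Y" for j
    using Cinf_on_subset[OF B(2), of "Inr j" S] Cinf_on_subset[OF B'(2), of "Inr j" S] that
    by (auto simp: S_def I_def fibre_indices_iff)
  define C where "C = {(p, q). p \<in> V \<and> q \<in> V2 \<and> proj E p = proj Y q}"
  define \<theta> where "\<theta> = (\<lambda>(p, q). case_sum (\<lambda>i. \<psi> p (Inl i)) (case_sum (\<lambda>j. \<psi> p (Inr j)) (\<lambda>k. \<psi>2 q (Inr k))))"
  have \<theta>s: "\<theta> y (Inl i) = \<psi> (fst y) (Inl i)" "\<theta> y (Inr (Inl j)) = \<psi> (fst y) (Inr j)"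
      "\<theta> y (Inr (Inr k)) = \<psi>2 (snd y) (Inr k)" for y i j k
    by (simp_all add: \<theta>_def case_prod_unfold)
  \<comment> \<open>The chart of the fibre product built over the same base chart; it converts the
    hypothesis on pairs into \<open>same_jet\<close> for each component separately.\<close>
  have ad: "((U, \<phi>), (C, \<theta>)) \<in> adapted_charts (fibre_product E Y)"
    unfolding adapted_charts_def
  proof (clarify, intro conjI)
    show "(C, \<theta>) \<in> atlas (total (fibre_product E Y))"
      unfolding fibre_product_simps C_def \<theta>_def using adapted_chartsD(2)[OF c(1)] V2(1) by blast
    show "proj (fibre_product E Y) ` C \<subseteq> U"
      using adapted_chartsD(3)[OF c(1)] by (force simp: C_def fibre_product_simps)
    show "\<forall>y\<in>C. \<forall>i\<in>indices (base (fibre_product E Y)). \<theta> y (Inl i) = \<phi> (proj (fibre_product E Y) y) i"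
      using adapted_chartsD(4)[OF c(1)] by (auto simp: C_def fibre_product_simps \<theta>s)
  qed (simp add: fibre_product_simps u)
  have xC: "s x \<in> C" using c(2) V2(2) pE(3)[OF W(1)] pY(3)[OF W(1)] by (cases "s x") (simp add: C_def)
  have JE: "same_jet I (k + r) (\<phi> x) (\<lambda>v. \<psi> (fst (s (inv_into U \<phi> v))) (Inr j))
      (\<lambda>v. \<psi> (fst (s' (inv_into U \<phi> v))) (Inr j))" if "j \<in> fibre_indices E" for j
    unfolding same_jet_iff_partials[OF fin[folded I_def] S xS CE[OF that]]
    using jet_eq_chartD[OF eq ad xC, of "Inl j"] that by (auto simp: fibre_product_simps \<theta>s I_def)
  have JY: "same_jet I (k + r) (\<phi> x) (\<lambda>v. \<psi>2 (snd (s (inv_into U \<phi> v))) (Inr j))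
      (\<lambda>v. \<psi>2 (snd (s' (inv_into U \<phi> v))) (Inr j))" if "j \<in> fibre_indices Y" for j
    unfolding same_jet_iff_partials[OF fin[folded I_def] S xS CY[OF that]]
    using jet_eq_chartD[OF eq ad xC, of "Inr j"] that by (auto simp: fibre_product_simps \<theta>s I_def)
  \<comment> \<open>Push-forward requires the two arguments of \<open>a\<close> at \<open>x\<close>
    to be the same point, that is, equal k-jets as sets and not merely equal coordinates.\<close>
  have "jet_eq E k x (fst \<circ> s) (fst \<circ> s')"
  proof (rule jet_eq_single_chart[OF E section_on_local[OF sE W(1)] section_on_local[OF sE' W'(1)] _ c(1)])
    show "partials \<alpha> (\<lambda>v. \<psi> ((fst \<circ> s) (inv_into U \<phi> v)) (Inr j)) (\<phi> x) =
        partials \<alpha> (\<lambda>v. \<psi> ((fst \<circ> s') (inv_into U \<phi> v)) (Inr j)) (\<phi> x)"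
      if "j \<in> fibre_indices E" "\<alpha> \<in> multi_indices (indices (base E)) k" for j \<alpha>
      using same_jet_partials[OF same_jet_mono[OF JE[OF that(1)], of k]] that(2) by (simp add: I_def)
  qed (use sx c(2) in auto)
  from jet_eq_imp_jet_eq[OF this] have \<sigma>x: "\<sigma> s x = \<sigma> s' x" by (simp add: \<sigma>_def sx)
  let ?N = "jet_pairs E k Y"
  let ?\<Theta> = "jet_pair_coords E k U \<phi> \<psi> \<psi>2" and ?C = "jet_pair_dom E Y k V V2"
  have N: "(?C, ?\<Theta>) \<in> atlas ?N" unfolding jet_pair_atlas using c(1) V2(1) by blast
  have co: "?\<Theta> (\<sigma> s (inv_into U \<phi> v)) (Inl i) = v i" "?\<Theta> (\<sigma> s' (inv_into U \<phi> v)) (Inl i) = v i"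
    if "v \<in> S" "i \<in> I" for v i
    using jet_pair_coords_jet(1)[OF section_on_local[OF sE zS(1)[OF that(1)]] c(1)]
      jet_pair_coords_jet(1)[OF section_on_local[OF sE' zS(2)[OF that(1)]] c(1)] zS[OF that(1)] that(2)
    by (simp_all add: \<sigma>_def I_def)
  have coE: "?\<Theta> (\<sigma> s (inv_into U \<phi> v)) (Inr (Inl (j, \<alpha>))) =
      partials \<alpha> (\<lambda>v. \<psi> (fst (s (inv_into U \<phi> v))) (Inr j)) v"
     "?\<Theta> (\<sigma> s' (inv_into U \<phi> v)) (Inr (Inl (j, \<alpha>))) =
      partials \<alpha> (\<lambda>v. \<psi> (fst (s' (inv_into U \<phi> v))) (Inr j)) v"
    if "v \<in> S" "j \<in> fibre_indices E" "\<alpha> \<in> multi_indices I k" for v j \<alpha>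
    using jet_pair_coords_jet(2)[OF section_on_local[OF sE zS(1)[OF that(1)]] c(1)]
      jet_pair_coords_jet(2)[OF section_on_local[OF sE' zS(2)[OF that(1)]] c(1)] zS[OF that(1)] that(2,3)
    by (simp_all add: \<sigma>_def I_def)
  have coY: "?\<Theta> (\<sigma> s z) (Inr (Inr m)) = \<psi>2 (snd (s z)) (Inr m)" for s z m
    by (simp add: \<sigma>_def jet_pair_coords_def)
  have "jet_eq Y r x (\<lambda>z. g (\<sigma> s z)) (\<lambda>z. g (\<sigma> s' z))"
  proof (rule jet_eq_push_forward[where s = "\<sigma> s" and s' = "\<sigma> s'", OF Y injective_atlas_jet_fibre_product[OF E Y b] N g u[folded b] xU pg
        S[unfolded I_def, folded b] xS])
    show "S \<subseteq> \<phi> ` U" by (auto simp: S_def)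
    fix v assume v: "v \<in> S"
    let ?z = "inv_into U \<phi> v"
    show "\<sigma> s ?z \<in> ?C \<inter> points ?N"
      using \<sigma>p[OF zS(1)[OF v]] jet_pair_dom_iff[OF pE(1)[OF zS(1)[OF v]] section_on_local[OF sE zS(1)[OF v]] pY(3)[OF zS(1)[OF v]]]
        zS[OF v] by (simp add: \<sigma>_def)
    show "\<sigma> s' ?z \<in> ?C \<inter> points ?N"
      using \<sigma>p'[OF zS(2)[OF v]] jet_pair_dom_iff[OF pE'(1)[OF zS(2)[OF v]] section_on_local[OF sE' zS(2)[OF v]] pY'(3)[OF zS(2)[OF v]]]
        zS[OF v] by (simp add: \<sigma>_def)
  next
    fix i assume "i \<in> indices ?N"
    then have "Cinf_on I S (\<lambda>v. ?\<Theta> (\<sigma> s (inv_into U \<phi> v)) i) \<and> Cinf_on I S (\<lambda>v. ?\<Theta> (\<sigma> s' (inv_into U \<phi> v)) i) \<and>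
      same_jet I r (\<phi> x) (\<lambda>v. ?\<Theta> (\<sigma> s (inv_into U \<phi> v)) i) (\<lambda>v. ?\<Theta> (\<sigma> s' (inv_into U \<phi> v)) i)"
    proof (cases rule: jet_pair_index_cases)
      case (base i')
      note co = co[OF _ base(2)[folded I_def]] and fin = fin[folded I_def]
      note cc = Cinf_on_coord[OF fin S base(2)[folded I_def]]
      show ?thesis unfolding base(1)
        by (intro conjI Cinf_on_eq[OF fin S cc] same_jet_eqI[OF fin S xS]) (simp_all add: co)
    next
      case (jet j \<alpha>)
      note fin = fin[folded I_def] and \<alpha> = jet(3)[folded I_def]
      note co = coE[OF _ jet(2) \<alpha>]
      show ?thesis unfolding jet(1)
        using Cinf_on_eq[OF fin S Cinf_on_partials[OF CE(1)[OF jet(2)] \<alpha>] co(1)[symmetric]]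
          Cinf_on_eq[OF fin S Cinf_on_partials[OF CE(2)[OF jet(2)] \<alpha>] co(2)[symmetric]]
          same_jet_transfer[OF fin S xS same_jet_of_partials[OF JE[OF jet(2)] \<alpha>] co[symmetric]]
        by blast
    next
      case (fibre m)
      show ?thesis unfolding fibre(1) coY using CY[OF fibre(2)] same_jet_mono[OF JY[OF fibre(2)], of r] by simp
    qed
    then show "Cinf_on (indices (base Y)) S (\<lambda>v. ?\<Theta> (\<sigma> s (inv_into U \<phi> v)) i)"
      "Cinf_on (indices (base Y)) S (\<lambda>v. ?\<Theta> (\<sigma> s' (inv_into U \<phi> v)) i)"
      "same_jet (indices (base Y)) r (\<phi> x) (\<lambda>v. ?\<Theta> (\<sigma> s (inv_into U \<phi> v)) i) (\<lambda>v. ?\<Theta> (\<sigma> s' (inv_into U \<phi> v)) i)"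
      by (simp_all add: I_def b)
  qed (rule \<sigma>x)
  \<comment> \<open>Outside the domain of the section nothing ties \<open>proj Y\<close> of its
    second component to the base point, so the two descriptions of the transformed field are matched
    as germs.\<close>
  moreover have "jet_eq Y r x (\<lambda>z. g (\<sigma> s z)) (gauged E Y k a s)"
    by (rule jet_eq_germ[OF XY section_on_openin[OF sY] W(1)]) (use gg pg in auto)
  moreover have "jet_eq Y r x (\<lambda>z. g (\<sigma> s' z)) (gauged E Y k a s')"
    by (rule jet_eq_germ[OF XY section_on_openin[OF sY'] W'(1)]) (use gg' pg \<sigma>x in auto)
  ultimately show ?thesis using jet_eq_trans jet_eq_sym by meson
qed

section \<open>Jets of families with a parameter\<close>

lemma foldr_partial_slice:
  "foldr partial l (\<lambda>v. H (case_sum u v)) v = foldr partial (map Inr l) H (case_sum u v)"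
proof (induction l arbitrary: v)
  case (Cons i l)
  \<comment> \<open>Moving a base coordinate with the parameter frozen is moving the corresponding
    \<open>Inr\<close> coordinate of the joint space.\<close>
  have upd: "case_sum u (v(i := t)) = (case_sum u v)(Inr i := t)" for t
    by (rule ext) (simp split: sum.split)
  have "partial i (\<lambda>v. h (case_sum u v)) v = partial (Inr i) h (case_sum u v)" for h
    by (simp add: partial_def upd)
  moreover have "foldr partial l (\<lambda>v. H (case_sum u v)) = (\<lambda>v. foldr partial (map Inr l) H (case_sum u v))"
    using Cons.IH by (rule ext)
  ultimately show ?case by simp
qed simp

text \<open>The jet coordinates of the member \<open>F \<epsilon>\<close> at \<open>x\<close> are
  derivatives in the base directions of the joint coordinate function of the family, and these are
  smooth in parameter and base point together.\<close>

lemma smooth_jet_family: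
  assumes E: "fibre_bundle E F_E" and Y: "fibre_bundle Y F_Y" and b: "base Y = base E"
    and F: "smooth_map_on (prod_mfd real_line (base E)) (total E) (J \<times> points (base E)) (\<lambda>(\<epsilon>, x). F \<epsilon> x)"
    and pF: "\<And>\<epsilon> x. \<epsilon> \<in> J \<Longrightarrow> x \<in> points (base E) \<Longrightarrow> proj E (F \<epsilon> x) = x"
    and \<phi>: "\<phi> \<in> sections Y"
  shows "smooth_map_on (prod_mfd real_line (base E)) (jet_pairs E k Y)
    (J \<times> points (base E)) (\<lambda>(\<epsilon>, x). (jet E k (F \<epsilon>) x, \<phi> x))"
proof -
  note X = fibre_bundleD(1)[OF E]
  note R = smooth_atlas_prod_mfd[OF smooth_atlas_real_line X]
  define I where "I = indices (base E)"
  have fin: "finite I" using smooth_atlas_finite[OF X] by (simp add: I_def)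
  have \<phi>': "smooth_map_on (base E) (total Y) (points (base E)) \<phi>"
    and p\<phi>: "\<And>x. x \<in> points (base E) \<Longrightarrow> proj Y (\<phi> x) = x"
    using \<phi> by (auto simp: sections_def section_on_def b)
  have sF: "section_on E (points (base E)) (F \<epsilon>)" if "\<epsilon> \<in> J" for \<epsilon>
    using smooth_map_on_slice[OF X openin_mfd_points[OF X] that F] pF[OF that] by (simp add: section_on_def)
  note lF = section_on_local[OF sF]
  show ?thesis
  proof (rule smooth_map_onI[OF R smooth_map_on_openin[OF F]])
    fix q assume "q \<in> J \<times> points (base E)"
    then show "(case q of (\<epsilon>, x) \<Rightarrow> (jet E k (F \<epsilon>) x, \<phi> x)) \<in> points (jet_pairs E k Y)"
      using lF p\<phi> smooth_map_on_image[OF \<phi>'] by (auto intro!: jet_pair_points)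
  next
    fix q C \<Theta> assume q: "q \<in> J \<times> points (base E)"
      and C: "(C, \<Theta>) \<in> atlas (jet_pairs E k Y)"
      and qC: "(case q of (\<epsilon>, x) \<Rightarrow> (jet E k (F \<epsilon>) x, \<phi> x)) \<in> C"
    obtain \<epsilon>0 x0 where q0: "q = (\<epsilon>0, x0)" "\<epsilon>0 \<in> J" "x0 \<in> points (base E)" using q by blast
    obtain U \<beta> V \<psi> V2 \<psi>2 where c: "((U, \<beta>), (V, \<psi>)) \<in> adapted_charts E" "(V2, \<psi>2) \<in> atlas (total Y)"
      and Cd: "C = jet_pair_dom E Y k V V2" "\<Theta> = jet_pair_coords E k U \<beta> \<psi> \<psi>2"
      using C unfolding jet_pair_atlas by blast
    have dom: "(jet E k (F \<epsilon>) x, \<phi> x) \<in> C \<longleftrightarrow> F \<epsilon> x \<in> V \<and> \<phi> x \<in> V2" if "\<epsilon> \<in> J" "x \<in> points (base E)" for \<epsilon> x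
      unfolding Cd using that(2) lF[OF that] p\<phi>[OF that(2)] by (rule jet_pair_dom_iff)
    have q1: "F \<epsilon>0 x0 \<in> V" "\<phi> x0 \<in> V2" using qC dom[OF q0(2,3)] by (auto simp: q0(1))
    note u = adapted_chartsD(1)[OF c(1)] and e = adapted_chartsD(2)[OF c(1)]
    note inj = smooth_atlas_chart(1)[OF X u]
    have x0U: "x0 \<in> U" using adapted_chartsD(3)[OF c(1) q1(1)] pF[OF q0(2,3)] by simp
    let ?R = "prod_mfd real_line (base E)"
    define \<rho> where "\<rho> = (\<lambda>(t::real, q). case_sum (\<lambda>u::unit. t) (\<beta> q))"
    have r: "(UNIV \<times> U, \<rho>) \<in> atlas ?R" unfolding prod_real_line_chart \<rho>_def using u by blast
    define D where "D = \<rho> ` ((UNIV \<times> U) \<inter> (J \<times> points (base E)) \<inter> (\<lambda>(\<epsilon>, x). F \<epsilon> x) -` V)"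
    define B where "B = \<beta> ` (U \<inter> points (base E) \<inter> \<phi> -` V2)"
    note D = smooth_map_onD[OF F r e, folded D_def] and B = smooth_map_onD[OF \<phi>' u c(2), folded B_def]
    have ind: "indices ?R = {()} <+> I" by (simp add: prod_mfd_simps real_line_simps I_def)
    note finR = smooth_atlas_finite[OF R, unfolded ind]
    \<comment> \<open>\<open>D\<close> controls the family and lives on R x X, \<open>B\<close>
      controls the fixed field \<open>\<phi>\<close> and lives on X; hence the projection by
      \<open>Inr\<close>.\<close>
    define S where "S = {w \<in> D. w \<circ> Inr \<in> B}"
    have S: "ropen ({()} <+> I) S"
      unfolding S_def
    proof (rule openin_preimage[OF D(1)[unfolded ind] B(1)[folded I_def]])
      show "cont_on ({()} <+> I) D (\<lambda>w. (w \<circ> Inr) j)" if "j \<in> I" for j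
        unfolding comp_apply using that by (intro cont_on_coord) auto
      show "w \<circ> Inr \<in> euc I" if "w \<in> D" for w
        using openin_powertop_extensional[OF D(1)[unfolded ind] that] by (auto simp: PiE_iff extensional_def)
    qed
    have SD: "S \<subseteq> D" by (auto simp: S_def)
    have inv: "inv_into (UNIV \<times> U) \<rho> w = (w (Inl ()), inv_into U \<beta> (w \<circ> Inr))" if "w \<circ> Inr \<in> \<beta> ` U" for w
    proof -
      have i: "inj_on (\<lambda>(t::real) (u::unit). t) UNIV" by (auto simp: inj_on_def dest: fun_cong)
      have "w \<circ> Inl = (\<lambda>u. w (Inl ()))" by (rule ext) simp
      moreover have "inv_into UNIV (\<lambda>(t::real) (u::unit). t) (\<lambda>u. w (Inl ())) = w (Inl ())"
        by (rule inv_into_f_f[OF i]) simp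
      moreover have "(\<lambda>u. w (Inl ())) \<in> range (\<lambda>(t::real) (u::unit). t)" by blast
      ultimately show ?thesis
        using inv_into_prod_chart[OF i inj, of w] that unfolding \<rho>_def by simp
    qed
    have zS: "w (Inl ()) \<in> J" "inv_into U \<beta> (w \<circ> Inr) \<in> points (base E)" "F (w (Inl ())) (inv_into U \<beta> (w \<circ> Inr)) \<in> V"
       "\<phi> (inv_into U \<beta> (w \<circ> Inr)) \<in> V2" "\<beta> (inv_into U \<beta> (w \<circ> Inr)) = w \<circ> Inr" "w \<circ> Inr \<in> \<beta> ` U"
       "w \<in> \<rho> ` ((UNIV \<times> U) \<inter> (J \<times> points (base E)) \<inter> (\<lambda>(\<epsilon>, x). (jet E k (F \<epsilon>) x, \<phi> x)) -` C)" if w: "w \<in> S" for w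
    proof -
      obtain t x where tx: "x \<in> U" "t \<in> J" "x \<in> points (base E)" "F t x \<in> V" "w = case_sum (\<lambda>u. t) (\<beta> x)"
        using w by (auto simp: S_def D_def \<rho>_def)
      have wi: "w (Inl ()) = t" "w \<circ> Inr = \<beta> x" using tx(5) by (auto simp: case_sum_o_inj)
      have ix: "inv_into U \<beta> (\<beta> x) = x" using inj tx(1) by (rule inv_into_f_f)
      obtain y where "y \<in> U" "\<phi> y \<in> V2" "\<beta> y = \<beta> x" using w wi by (auto simp: S_def B_def)
      then have x2: "\<phi> x \<in> V2" using inj_onD[OF inj] tx(1) by metis
      show "w (Inl ()) \<in> J" "inv_into U \<beta> (w \<circ> Inr) \<in> points (base E)" "F (w (Inl ())) (inv_into U \<beta> (w \<circ> Inr)) \<in> V"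
       "\<phi> (inv_into U \<beta> (w \<circ> Inr)) \<in> V2" "\<beta> (inv_into U \<beta> (w \<circ> Inr)) = w \<circ> Inr" "w \<circ> Inr \<in> \<beta> ` U"
        using tx x2 unfolding wi ix by auto
      show "w \<in> \<rho> ` ((UNIV \<times> U) \<inter> (J \<times> points (base E)) \<inter> (\<lambda>(\<epsilon>, x). (jet E k (F \<epsilon>) x, \<phi> x)) -` C)"
        using tx x2 dom[OF tx(2,3)] by (intro image_eqI[of _ _ "(t, x)"]) (auto simp: \<rho>_def)
    qed
    have qS: "\<rho> q \<in> S"
      using q0 q1 x0U by (auto simp: S_def D_def B_def \<rho>_def case_sum_o_inj intro!: image_eqI[of _ _ "(\<epsilon>0, x0)"])
    define G where "G w = (case inv_into (UNIV \<times> U) \<rho> w of (\<epsilon>, x) \<Rightarrow> (jet E k (F \<epsilon>) x, \<phi> x))" for w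
    have G: "G w = (jet E k (F (w (Inl ()))) (inv_into U \<beta> (w \<circ> Inr)), \<phi> (inv_into U \<beta> (w \<circ> Inr)))" if "w \<in> S" for w
      using inv[OF zS(6)[OF that]] by (simp add: G_def)
    have "Cinf_on ({()} <+> I) S (\<lambda>w. \<Theta> (G w) i)"
      if "i \<in> indices (jet_pairs E k Y)" for i
      using that
    proof (cases rule: jet_pair_index_cases)
      case (base i')
      have "Inr i' \<in> {()} <+> I" using base(2) by (auto simp: I_def)
      note coord = Cinf_on_coord[OF finR S this]
      show ?thesis
      proof (rule Cinf_on_eq[OF finR S coord])
        fix w assume w: "w \<in> S"
        show "w (Inr i') = \<Theta> (G w) i"
          unfolding G[OF w] base(1) Cd(2)
          using fun_cong[OF zS(5)[OF w], of i']
          by (simp add: jet_pair_coords_jet(1)[OF lF[OF zS(1,2)[OF w]] c(1) zS(3)[OF w] base(2)])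
      qed
    next
      case (jet j \<alpha>)
      define l where "l = sorted_list_of_multiset \<alpha>"
      have l: "set l \<subseteq> I" using jet(3) by (simp add: l_def multi_indices_def I_def)
      \<comment> \<open>The fibre coordinate \<open>j\<close> of the whole family as one function of
        parameter and base point.\<close>
      define H where "H w = \<psi> (case inv_into (UNIV \<times> U) \<rho> w of (\<epsilon>, x) \<Rightarrow> F \<epsilon> x) (Inr j)" for w
      have "Cinf_on ({()} <+> I) D H"
        unfolding H_def using D(2)[of "Inr j"] jet(2) by (simp add: fibre_indices_iff ind)
      then have HC: "Cinf_on ({()} <+> I) S (foldr partial (map Inr l) H)"
        using l by (intro Cinf_on_foldr_partial Cinf_on_subset[OF _ SD]) auto
      show ?thesis
      proof (rule Cinf_on_eq[OF finR S HC])
        fix w assume w: "w \<in> S"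
        let ?t = "w (Inl ())" and ?v = "w \<circ> Inr"
        have wt: "w = case_sum (\<lambda>u. ?t) ?v"
          by (rule ext) (simp split: sum.split)
        \<comment> \<open>Read backwards: the jet coordinate differentiates the slice at fixed
          parameter, which equals the \<open>Inr\<close> derivative of \<open>H\<close>.\<close>
        have "foldr partial (map Inr l) H w = foldr partial l (\<lambda>v. H (case_sum (\<lambda>u. ?t) v)) ?v"
          unfolding foldr_partial_slice wt[symmetric] ..
        also have "\<dots> = foldr partial l (\<lambda>v. \<psi> (F ?t (inv_into U \<beta> v)) (Inr j)) ?v"
        proof (rule foldr_partial_cong[OF fin smooth_atlas_chart(2)[OF X u, folded I_def] _ l zS(6)[OF w]])
          show "H (case_sum (\<lambda>u. ?t) v) = \<psi> (F ?t (inv_into U \<beta> v)) (Inr j)" if "v \<in> \<beta> ` U" for v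
            using inv[of "case_sum (\<lambda>u. ?t) v"] that by (simp add: H_def case_sum_o_inj)
        qed
        also have "\<dots> = \<Theta> (G w) i"
          unfolding G[OF w] jet(1) Cd(2)
          using zS(5)[OF w]
          by (simp add: partials_def l_def jet_pair_coords_jet(2)[OF lF[OF zS(1,2)[OF w]] c(1) zS(3)[OF w] jet(2,3)])
        finally show "foldr partial (map Inr l) H w = \<Theta> (G w) i" .
      qed
    next
      case (fibre m)
      have "Cinf_on I B (\<lambda>v. \<psi>2 (\<phi> (inv_into U \<beta> v)) (Inr m))"
        using B(2) fibre(2) by (simp add: fibre_indices_iff I_def)
      then have "Cinf_on ({()} <+> I) S (\<lambda>w. \<psi>2 (\<phi> (inv_into U \<beta> (w \<circ> Inr))) (Inr m))"
        by (intro Cinf_on_Inr[OF _ fin S B(1)[folded I_def]]) (auto simp: S_def)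
      then show ?thesis
        by (rule Cinf_on_eq[OF finR S]) (simp add: G Cd(2) fibre(1) jet_pair_coords_def)
    qed
    then show "smooth_in_chart ?R (jet_pairs E k Y) (J \<times> points (base E)) (\<lambda>(\<epsilon>, x). (jet E k (F \<epsilon>) x, \<phi> x)) q C \<Theta>"
      using r S qS zS(7) x0U q0(1) unfolding ind G_def
      by (intro exI[of _ "UNIV \<times> U"] exI[of _ \<rho>] exI[of _ S]) auto
  qed
qed

section \<open>The covariant density\<close>

lemma gauge_actionD:
  assumes "gauge_action E G Y k a"
  shows "smooth_map_on (jet_pairs E k Y) (total Y)
      (points (jet_pairs E k Y)) (\<lambda>(\<gamma>, y). a \<gamma> y)"
    and "(\<gamma>, y) \<in> points (jet_pairs E k Y) \<Longrightarrow> proj Y (a \<gamma> y) = proj Y y"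
    and "x \<in> points (base E) \<Longrightarrow> \<eta> \<in> local_sections E x \<Longrightarrow> \<sigma> \<in> local_sections E x \<Longrightarrow> y \<in> fibre Y x \<Longrightarrow>
      gauge_map E Y k a (\<lambda>z. \<eta> z \<otimes>\<^bsub>G z\<^esub> \<sigma> z) y = gauge_map E Y k a \<eta> (gauge_map E Y k a \<sigma> y)"
    and "\<eta> \<in> sections E \<Longrightarrow> vertical_automorphism Y (gauge_map E Y k a \<eta>)"
  using assms unfolding gauge_action_def smooth_map_def by blast+

text \<open>Well-definedness: the representative chosen inside \<open>covariant_density\<close> has
  the same jet as \<open>s\<close>, so its transformed field has the same r-jet.\<close>

lemma covariant_density_jet:
  assumes E: "fibre_bundle E F_E" and Y: "fibre_bundle Y F_Y" and b: "base Y = base E"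
    and a: "gauge_action E G Y k a" and s: "s \<in> local_sections (fibre_product E Y) x"
  shows "covariant_density E Y k a r L (jet (fibre_product E Y) (k + r) s x) =
    L (jet Y r (gauged E Y k a s) x)"
proof -
  have "jet_eq Y r x (gauged E Y k a s)
     (gauge_map E Y k a (fst \<circ> jet_rep (jet (fibre_product E Y) (k + r) s x)) \<circ>
       (snd \<circ> jet_rep (jet (fibre_product E Y) (k + r) s x)))"
    by (rule gauge_map_determined_by_jet[OF E Y b _ _ s jet_rep_jet[OF s]])
      (use a in \<open>simp_all add: gauge_action_def\<close>)
  from jet_eq_imp_jet_eq[OF this] show ?thesis
    by (simp add: covariant_density_def Let_def fst_jet)
qed

section \<open>Invariance of the covariant density\<close>

lemma gauge_map_germ:
  assumes X: "smooth_atlas (base E)" and W: "openin (mfd_topology (base E)) W" "z \<in> W"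
    and eq: "\<And>w. w \<in> W \<Longrightarrow> \<eta> w = \<eta>' w" and \<eta>: "proj E (\<eta> z) = z" and y: "proj Y y = z"
  shows "gauge_map E Y k a \<eta> y = gauge_map E Y k a \<eta>' y"
proof -
  have "jet_eq E k z \<eta> \<eta>'" using X W eq \<eta> by (rule jet_eq_germ)
  from jet_eq_imp_jet_eq[OF this] show ?thesis by (simp add: gauge_map_def y)
qed

text \<open>The representative of the jet is a section over some open \<open>W\<close> only, so the
  cancellation of \<sigma> takes place among local sections, using the multiplicativity of
  \<open>a\<close> on their jets.\<close>

lemma covariant_density_invariant:
  assumes E: "fibre_bundle E F_E" and Y: "fibre_bundle Y F_Y" and b: "base Y = base E"
    and G: "group_bundle E G" and a: "gauge_action E G Y k a"
    and \<sigma>: "\<sigma> \<in> sections E" and \<gamma>: "\<gamma> \<in> jets (fibre_product E Y) (k + r)"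
  shows "covariant_density E Y k a r L
      (jet_prolongation (fibre_product E Y) (k + r) (covariant_gauge_map E G Y k a \<sigma>) \<gamma>) =
    covariant_density E Y k a r L \<gamma>"
proof -
  note X = fibre_bundleD(1)[OF E] and TE = fibre_bundleD(2)[OF E] and XY = fibre_bundleD(1)[OF Y]
  define s x where "s = jet_rep \<gamma>" and "x = fst \<gamma>"
  obtain W where W: "x \<in> W" "section_on (fibre_product E Y) W s"
    using jetsD(1)[OF \<gamma>] unfolding local_sections_def s_def x_def by blast
  note sE = section_on_components(1)[OF E Y b W(2)] and sY = section_on_components(2)[OF E Y b W(2)]
  note Wo = section_on_openin[OF sE]
  note pE = section_on_points[OF X sE] and pY = section_on_points[OF XY sY]
  have grp: "group (G z)" "carrier (G z) = fibre E z" if "z \<in> points (base E)" for z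
    using G that by (auto simp: group_bundle_def)
  have \<sigma>W: "section_on E W \<sigma>"
    using \<sigma> pE(1) by (intro section_on_subset[OF X _ Wo]) (auto simp: sections_def)
  note p\<sigma> = section_on_points[OF X \<sigma>W]
  have car: "fst (s z) \<in> carrier (G z)" "\<sigma> z \<in> carrier (G z)" if "z \<in> W" for z
    using grp[OF pE(1)[OF that]] pE(2,3)[OF that] p\<sigma>(2,3)[OF that] by (auto simp: fibre_def)
  define i where "i z = inv\<^bsub>G z\<^esub> \<sigma> z" for z
  \<comment> \<open>The covariance field after the action of \<open>\<sigma>\<close>; multiplying it
    by \<open>\<sigma>\<close> on the right gives back the original one.\<close>
  define \<tau> where "\<tau> z = fst (s z) \<otimes>\<^bsub>G z\<^esub> i z" for z
  have icar: "i z \<in> carrier (G z)" if "z \<in> W" for z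
    unfolding i_def using grp(1)[OF pE(1)[OF that]] car(2)[OF that] by (rule group.inv_closed)
  have ip: "i z \<in> points (total E)" "proj E (i z) = z" if "z \<in> W" for z
    using icar[OF that] grp(2)[OF pE(1)[OF that]] by (auto simp: fibre_def)
  have "\<tau> z \<in> carrier (G z)" if "z \<in> W" for z
    unfolding \<tau>_def
    by (rule monoid.m_closed[OF group.is_monoid[OF grp(1)[OF pE(1)[OF that]]] car(1)[OF that] icar[OF that]])
  then have \<tau>p: "proj E (\<tau> z) = z" if "z \<in> W" for z
    using grp(2)[OF pE(1)[OF that]] that by (auto simp: fibre_def)
  have \<tau>\<sigma>: "\<tau> z \<otimes>\<^bsub>G z\<^esub> \<sigma> z = fst (s z)" if "z \<in> W" for z
  proof -
    interpret group "G z" by (rule grp(1)[OF pE(1)[OF that]])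
    show ?thesis using car[OF that] by (simp add: \<tau>_def i_def m_assoc)
  qed
  have smi: "smooth_map_on (total E) (total E) (points (total E)) (\<lambda>e. inv\<^bsub>G (proj E e)\<^esub> e)"
    and smm: "smooth_map_on (total (fibre_product E E)) (total E) (points (total (fibre_product E E)))
      (\<lambda>(e, e'). e \<otimes>\<^bsub>G (proj E e)\<^esub> e')"
    using G by (auto simp: group_bundle_def smooth_map_def)
  \<comment> \<open>Multiplicativity is available for smooth local sections, so the inverse and the
    product have to be shown smooth, by composing with the fibrewise group operations.\<close>
  have i: "section_on E W i"
  proof -
    have "smooth_map_on (base E) (total E) W (\<lambda>z. inv\<^bsub>G (proj E (\<sigma> z))\<^esub> \<sigma> z)"
      using \<sigma>W p\<sigma>(2)
      by (intro smooth_map_on_compose[OF X smooth_atlas_injective[OF TE] _ smi])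
        (auto simp: section_on_def)
    then have "smooth_map_on (base E) (total E) W i"
      by (rule smooth_map_on_cong[OF X]) (simp add: i_def p\<sigma>(3))
    then show ?thesis using ip(2) by (simp add: section_on_def)
  qed
  have \<tau>: "section_on E W \<tau>"
  proof -
    have EE: "injective_atlas (total (fibre_product E E))"
      using fibre_bundleD(3,4)[OF E] smooth_atlas_injective[OF TE]
      by (intro injective_atlas_fibre_product) simp_all
    have pr: "section_on (fibre_product E E) W (\<lambda>z. ((fst \<circ> s) z, i z))"
      by (rule section_on_pair[OF E refl sE i])
    have "smooth_map_on (base E) (total E) W (\<lambda>z. (\<lambda>(e, e'). e \<otimes>\<^bsub>G (proj E e)\<^esub> e') ((fst \<circ> s) z, i z))"
    proof (rule smooth_map_on_compose[OF X EE _ smm])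
      show "smooth_map_on (base E) (total (fibre_product E E)) W (\<lambda>z. ((fst \<circ> s) z, i z))"
        using pr by (simp add: section_on_def fibre_product_simps)
      show "(\<lambda>z. ((fst \<circ> s) z, i z)) ` W \<subseteq> points (total (fibre_product E E))"
        using pE(2,3) ip by (auto simp: fibre_product_simps)
    qed
    then have "smooth_map_on (base E) (total E) W \<tau>"
      by (rule smooth_map_on_cong[OF X]) (use pE(3) in \<open>simp add: \<tau>_def\<close>)
    then show ?thesis using \<tau>p by (simp add: section_on_def)
  qed
  define h where "h = gauge_map E Y k a \<sigma>"
  have h: "smooth_map_on (total Y) (total Y) (points (total Y)) h"
      "\<And>y. y \<in> points (total Y) \<Longrightarrow> proj Y (h y) = proj Y y"
    using gauge_actionD(4)[OF a \<sigma>] by (auto simp: vertical_automorphism_def diffeo_on_def h_def)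
  have hs: "section_on Y W (\<lambda>z. h ((snd \<circ> s) z))"
  proof -
    have "smooth_map_on (base Y) (total Y) W (\<lambda>z. h ((snd \<circ> s) z))"
    proof (rule smooth_map_on_compose[OF XY smooth_atlas_injective[OF fibre_bundleD(2)[OF Y]] _ h(1)])
      show "smooth_map_on (base Y) (total Y) W (snd \<circ> s)" using sY by (simp add: section_on_def)
    qed (use pY(2) in auto)
    then show ?thesis using h(2) pY(2,3) by (auto simp: section_on_def)
  qed
  let ?f = "covariant_gauge_map E G Y k a \<sigma>"
  have fs: "(?f \<circ> s) z = (\<tau> z, h ((snd \<circ> s) z))" if "z \<in> W" for z
    using pE(3)[OF that] by (cases "s z") (simp add: covariant_gauge_map_def \<tau>_def i_def h_def)
  have "section_on (fibre_product E Y) W (\<lambda>z. (\<tau> z, h ((snd \<circ> s) z)))"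
    by (rule section_on_pair[OF E b \<tau> hs])
  have "section_on (fibre_product E Y) W (?f \<circ> s)"
    by (rule section_on_cong[OF _ \<open>section_on _ W (\<lambda>z. (\<tau> z, h _))\<close>])
      (use X fs in \<open>simp_all only: fibre_product_simps\<close>)
  then have loc: "?f \<circ> s \<in> local_sections (fibre_product E Y) x" using W(1) by (rule section_on_local)
  \<comment> \<open>On \<open>W\<close>: the transformation of \<open>\<tau>\<close> after that of
    \<open>\<sigma>\<close> is that of the product, which is the first component of
    \<open>s\<close>. Each replacement of a field by one equal to it on \<open>W\<close> is a germ
    argument.\<close>
  have key: "(gauged E Y k a (?f \<circ> s)) z =
      (gauged E Y k a s) z" if z: "z \<in> W" for z
  proof -
    let ?y = "snd (s z)"
    have y: "?y \<in> fibre Y z" "proj Y (h ?y) = z" "proj Y ?y = z"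
      using pY(2,3)[OF z] h(2)[of ?y] by (auto simp: fibre_def)
    have "gauge_map E Y k a (fst \<circ> (?f \<circ> s)) (h ?y) = gauge_map E Y k a \<tau> (h ?y)"
    proof (rule gauge_map_germ[OF X Wo z _ _ y(2)])
      show *: "(fst \<circ> (?f \<circ> s)) w = \<tau> w" if "w \<in> W" for w
        using fs[OF that] by simp
      show "proj E ((fst \<circ> (?f \<circ> s)) z) = z" unfolding *[OF z] by (rule \<tau>p[OF z])
    qed
    also have "\<dots> = gauge_map E Y k a (\<lambda>z. \<tau> z \<otimes>\<^bsub>G z\<^esub> \<sigma> z) ?y"
      using gauge_actionD(3)[OF a pE(1)[OF z] section_on_local[OF \<tau> z] section_on_local[OF \<sigma>W z] y(1)]
      by (simp only: h_def)
    also have "\<dots> = gauge_map E Y k a (fst \<circ> s) ?y"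
    proof (rule gauge_map_germ[OF X Wo z _ _ y(3)])
      show "proj E (\<tau> z \<otimes>\<^bsub>G z\<^esub> \<sigma> z) = z" using \<tau>\<sigma>[OF z] pE(3)[OF z] by simp
    qed (simp add: \<tau>\<sigma>)
    finally show ?thesis using fs[OF z] by simp
  qed
  have "jet_eq Y r x (gauged E Y k a (?f \<circ> s))
      (gauged E Y k a s)"
  proof (rule jet_eq_germ[OF XY section_on_openin[OF sY] W(1) key])
    have "(jet E k (fst \<circ> s) x, snd (s x)) \<in> points (jet_pairs E k Y)"
      using pE(1)[OF W(1)] section_on_local[OF sE W(1)] pY(2,3)[OF W(1)] by (intro jet_pair_points) auto
    from gauge_actionD(2)[OF a this]
    show "proj Y ((gauged E Y k a (?f \<circ> s)) x) = x"
      unfolding key[OF W(1)] using pY(3)[OF W(1)] by (simp add: gauge_map_def)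
  qed
  \<comment> \<open>The density at \<open>\<gamma>\<close> unfolds to its value on
    \<open>jet_rep \<gamma>\<close>, which is \<open>s\<close>; only the transformed jet needs
    independence of the representative.\<close>
  from jet_eq_imp_jet_eq[OF this] covariant_density_jet[OF E Y b a loc, of r L]
  show ?thesis
    unfolding jet_prolongation_def s_def[symmetric] x_def[symmetric]
    by (simp add: covariant_density_def Let_def s_def x_def)
qed

section \<open>Variations and the Euler--Lagrange equations\<close>

lemma compact_variation_push_forward:
  assumes P: "fibre_bundle P F'" and v: "compact_variation P s K \<delta> F"
    and h: "smooth_map_on (total P) (total P) (points (total P)) h"
      "\<And>y. y \<in> points (total P) \<Longrightarrow> proj P (h y) = proj P y"
  shows "compact_variation P (\<lambda>x. h (s x)) K \<delta> (\<lambda>\<epsilon> x. h (F \<epsilon> x))"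
proof -
  note X = fibre_bundleD(1)[OF P]
  have F: "smooth_map_on (prod_mfd real_line (base P)) (total P)
       ({-\<delta><..<\<delta>} \<times> points (base P)) (\<lambda>(\<epsilon>, x). F \<epsilon> x)"
    using v by (simp add: compact_variation_def)
  have Fp: "F \<epsilon> x \<in> points (total P)" if "\<epsilon> \<in> {-\<delta><..<\<delta>}" "x \<in> points (base P)" for \<epsilon> x
    using smooth_map_on_image[OF F, of "(\<epsilon>, x)"] that by simp
  have "smooth_map_on (prod_mfd real_line (base P)) (total P) ({-\<delta><..<\<delta>} \<times> points (base P))
      (\<lambda>p. h ((\<lambda>(\<epsilon>, x). F \<epsilon> x) p))"
    by (rule smooth_map_on_compose[OF smooth_atlas_prod_mfd[OF smooth_atlas_real_line X]
        smooth_atlas_injective[OF fibre_bundleD(2)[OF P]] F h(1)]) (use Fp in auto)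
  then have "smooth_map_on (prod_mfd real_line (base P)) (total P) ({-\<delta><..<\<delta>} \<times> points (base P))
      (\<lambda>(\<epsilon>, x). h (F \<epsilon> x))"
    by (simp add: case_prod_unfold)
  then show ?thesis using v h(2) Fp unfolding compact_variation_def by simp
qed

lemma compact_variation_cong:
  assumes "\<And>x. x \<in> points (base P) \<Longrightarrow> s x = s' x"
  shows "compact_variation P s K \<delta> F \<longleftrightarrow> compact_variation P s' K \<delta> F"
  using assms unfolding compact_variation_def by simp

lemma compact_variation_section:
  assumes X: "smooth_atlas (base P)" and v: "compact_variation P s K \<delta> F" and \<epsilon>: "\<epsilon> \<in> {-\<delta><..<\<delta>}"
  shows "section_on P (points (base P)) (F \<epsilon>)"
  using v \<epsilon> smooth_map_on_slice[OF X openin_mfd_points[OF X] \<epsilon>, of "total P" F]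
  by (simp add: compact_variation_def section_on_def)

lemma compact_variation_subset:
  assumes "smooth_atlas (base P)" "compact_variation P s K \<delta> F"
  shows "K \<subseteq> points (base P)" "\<delta> > 0"
  using assms(2) compactin_subset_topspace[of "mfd_topology (base P)" K] topspace_mfd_topology[OF assms(1)]
  by (simp_all add: compact_variation_def)

text \<open>The derivative at 0 sees only parameters in the interval on which a variation is
  controlled, and the integral only points of \<open>K\<close>.\<close>

lemma action_derivative_cong:
  assumes X: "smooth_atlas M" and \<delta>: "\<delta> > 0"
    and eq: "\<And>\<epsilon> x. \<epsilon> \<in> {-\<delta><..<\<delta>} \<Longrightarrow> x \<in> K \<Longrightarrow> \<Phi> \<epsilon> x = \<Psi> \<epsilon> x"
  shows "((\<lambda>\<epsilon>. form_integral M K (\<Phi> \<epsilon>)) has_real_derivative D) (at 0) \<longleftrightarrow>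
    ((\<lambda>\<epsilon>. form_integral M K (\<Psi> \<epsilon>)) has_real_derivative D) (at 0)"
proof (rule DERIV_cong_ev[OF refl _ refl])
  have "eventually (\<lambda>\<epsilon>. \<epsilon> \<in> {-\<delta><..<\<delta>}) (nhds (0::real))"
    by (rule eventually_nhds_in_open) (use \<delta> in auto)
  then show "eventually (\<lambda>\<epsilon>. form_integral M K (\<Phi> \<epsilon>) = form_integral M K (\<Psi> \<epsilon>)) (nhds 0)"
    by eventually_elim (rule form_integral_cong[OF eq X])
qed

lemma covariant_density_pair:
  assumes E: "fibre_bundle E F_E" and Y: "fibre_bundle Y F_Y" and b: "base Y = base E"
    and a: "gauge_action E G Y k a"
    and \<eta>: "section_on E W \<eta>" and \<phi>: "section_on Y W \<phi>" and x: "x \<in> W"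
  shows "covariant_density E Y k a r L (jet (fibre_product E Y) (k + r) (\<lambda>z. (\<eta> z, \<phi> z)) x) =
    L (jet Y r (gauge_map E Y k a \<eta> \<circ> \<phi>) x)"
  using covariant_density_jet[OF E Y b a section_on_local[OF section_on_pair[OF E b \<eta> \<phi>] x], of r L]
  by (simp add: comp_def)

lemma euler_lagrange_snd_iff:
  assumes E: "fibre_bundle E F_E" and Y: "fibre_bundle Y F_Y" and b: "base Y = base E"
    and a: "gauge_action E G Y k a" and \<eta>: "\<eta> \<in> sections E" and \<phi>: "\<phi> \<in> sections Y"
  shows "euler_lagrange_snd E Y (k + r) (covariant_density E Y k a r L) \<eta> \<phi> \<longleftrightarrow>
    euler_lagrange Y r L (gauge_map E Y k a \<eta> \<circ> \<phi>)"
proof -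
  note X = fibre_bundleD(1)[OF Y]
  let ?D = "\<lambda>K F. ((\<lambda>\<epsilon>. form_integral (base Y) K (\<lambda>x. covariant_density E Y k a r L
    (jet (fibre_product E Y) (k + r) (\<lambda>z. (\<eta> z, F \<epsilon> z)) x))) has_real_derivative 0) (at 0)"
  let ?D' = "\<lambda>K F. ((\<lambda>\<epsilon>. form_integral (base Y) K (\<lambda>x. L (jet Y r (F \<epsilon>) x))) has_real_derivative 0) (at 0)"
  define h where "h = gauge_map E Y k a \<eta>"
  define h' where "h' = inv_into (points (total Y)) h"
  have "vertical_automorphism Y h" using gauge_actionD(4)[OF a \<eta>] by (simp add: h_def)
  then have bij: "bij_betw h (points (total Y)) (points (total Y))"
    and h: "smooth_map_on (total Y) (total Y) (points (total Y)) h"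
      "\<And>y. y \<in> points (total Y) \<Longrightarrow> proj Y (h y) = proj Y y"
    and h's: "smooth_map_on (total Y) (total Y) (points (total Y)) h'"
    by (auto simp: vertical_automorphism_def diffeo_on_def h'_def)
  have hh': "h (h' y) = y" "h' y \<in> points (total Y)" "h' (h y) = y" if "y \<in> points (total Y)" for y
    using bij_betw_inv_into_right[OF bij that] bij_betw_inv_into_left[OF bij that]
      bij_betwE[OF bij_betw_inv_into[OF bij]] that by (auto simp: h'_def)
  have h': "proj Y (h' y) = proj Y y" if "y \<in> points (total Y)" for y
    using h(2)[OF hh'(2)[OF that]] hh'(1)[OF that] by simp
  have \<eta>s: "section_on E (points (base Y)) \<eta>" using \<eta> by (simp add: sections_def b)
  have \<phi>p: "\<phi> x \<in> points (total Y)" if "x \<in> points (base Y)" for x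
    using section_on_points(2)[OF X _ that] \<phi> by (simp add: sections_def)
  \<comment> \<open>Along a variation of \<open>\<phi>\<close> with \<eta> fixed, the new action
    equals the original action along the pushed-forward variation, parameter by parameter.\<close>
  have Lt: "?D K F \<longleftrightarrow>
      ?D' K (\<lambda>\<epsilon> z. h (F \<epsilon> z))"
    if v: "compact_variation Y \<phi> K \<delta> F" for K \<delta> F
  proof (rule action_derivative_cong[OF X compact_variation_subset(2)[OF X v]])
    fix \<epsilon> x assume \<epsilon>: "\<epsilon> \<in> {-\<delta><..<\<delta>}" "x \<in> K"
    then have "x \<in> points (base Y)" using compact_variation_subset(1)[OF X v] by blast
    from covariant_density_pair[OF E Y b a \<eta>s compact_variation_section[OF X v \<epsilon>(1)] this, of r L]
    show "covariant_density E Y k a r L (jet (fibre_product E Y) (k + r) (\<lambda>z. (\<eta> z, F \<epsilon> z)) x) =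
        L (jet Y r (\<lambda>z. h (F \<epsilon> z)) x)" by (simp add: h_def comp_def)
  qed
  have hvar: "compact_variation Y (h \<circ> \<phi>) K \<delta> (\<lambda>\<epsilon> x. h (F \<epsilon> x))"
    if "compact_variation Y \<phi> K \<delta> F" for K \<delta> F
    using compact_variation_push_forward[OF Y that h] by (simp add: comp_def)
  show ?thesis
    unfolding euler_lagrange_snd_def euler_lagrange_def stationary_def h_def[symmetric]
  proof (intro iffI allI impI)
    fix K \<delta> F
    assume EL: "\<forall>K \<delta> F. compact_variation Y \<phi> K \<delta> F \<longrightarrow>
        ?D K F"
      and v: "compact_variation Y (h \<circ> \<phi>) K \<delta> F"
    \<comment> \<open>Surjectivity on variations: pull the given one back by the inverse
      diffeomorphism, with the same \<open>K\<close> and \<open>\<delta>\<close>.\<close>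
    have "compact_variation Y (\<lambda>x. h' ((h \<circ> \<phi>) x)) K \<delta> (\<lambda>\<epsilon> x. h' (F \<epsilon> x))"
      using h' by (rule compact_variation_push_forward[OF Y v h's])
    then have v': "compact_variation Y \<phi> K \<delta> (\<lambda>\<epsilon> x. h' (F \<epsilon> x))"
      by (subst (asm) compact_variation_cong[where s' = \<phi>]) (simp_all add: hh'(3) \<phi>p)
    have "?D' K (\<lambda>\<epsilon> z. h (h' (F \<epsilon> z)))"
      using EL v' Lt[OF v'] by blast
    \<comment> \<open>\<open>h\<close> after \<open>h'\<close> is the identity only on the points of
      the total space, so the two families are compared as germs over the base and not as
      functions.\<close>
    moreover have "L (jet Y r (\<lambda>z. h (h' (F \<epsilon> z))) x) = L (jet Y r (F \<epsilon>) x)"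
      if "\<epsilon> \<in> {-\<delta><..<\<delta>}" "x \<in> K" for \<epsilon> x
    proof -
      have x: "x \<in> points (base Y)" using compact_variation_subset(1)[OF X v] that(2) by blast
      note p = section_on_points[OF X compact_variation_section[OF X v that(1)]]
      have "jet_eq Y r x (\<lambda>z. h (h' (F \<epsilon> z))) (F \<epsilon>)"
        by (rule jet_eq_germ[OF X openin_mfd_points[OF X] x]) (use hh'(1) p x in auto)
      then show ?thesis by (simp add: jet_eq_imp_jet_eq)
    qed
    ultimately show "?D' K F"
      by (subst (asm) action_derivative_cong[OF X compact_variation_subset(2)[OF X v]])
  next
    fix K \<delta> F
    assume EL: "\<forall>K \<delta> F. compact_variation Y (h \<circ> \<phi>) K \<delta> F \<longrightarrow>
        ?D' K F"
      and v: "compact_variation Y \<phi> K \<delta> F"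
    show "?D K F"
      unfolding Lt[OF v] using EL hvar[OF v] by blast
  qed
qed

text \<open>Smoothness in parameter and base point comes from feeding the smooth family of jets into
  the law \<open>a\<close>. Unlike a push-forward by a fixed bundle map, this involves derivatives
  of the varied field, so the support condition is a statement about germs.\<close>

lemma compact_variation_gauge:
  assumes E: "fibre_bundle E F_E" and Y: "fibre_bundle Y F_Y" and b: "base Y = base E"
    and a: "gauge_action E G Y k a" and \<phi>: "\<phi> \<in> sections Y"
    and v: "compact_variation E \<eta> K \<delta> F"
  shows "compact_variation Y (gauge_map E Y k a \<eta> \<circ> \<phi>) K \<delta> (\<lambda>\<epsilon>. gauge_map E Y k a (F \<epsilon>) \<circ> \<phi>)"
proof -
  note X = fibre_bundleD(1)[OF E]
  let ?J = "{-\<delta><..<\<delta>}" and ?N = "jet_pairs E k Y"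
  have p\<phi>: "\<phi> x \<in> points (total Y)" "proj Y (\<phi> x) = x" if "x \<in> points (base E)" for x
    using section_on_points(2,3)[of Y "points (base Y)" \<phi> x] \<phi> that X by (auto simp: sections_def b)
  have F: "smooth_map_on (prod_mfd real_line (base E)) (total E) (?J \<times> points (base E)) (\<lambda>(\<epsilon>, x). F \<epsilon> x)"
    "\<And>\<epsilon> x. \<epsilon> \<in> ?J \<Longrightarrow> x \<in> points (base E) \<Longrightarrow> proj E (F \<epsilon> x) = x"
    "\<And>x. x \<in> points (base E) \<Longrightarrow> F 0 x = \<eta> x"
    "\<And>\<epsilon> x. \<epsilon> \<in> ?J \<Longrightarrow> x \<in> points (base E) - K \<Longrightarrow> F \<epsilon> x = \<eta> x"
    and \<delta>: "0 < \<delta>" and K: "compactin (mfd_topology (base E)) K"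
    using v by (auto simp: compact_variation_def)
  have g: "gauge_map E Y k a \<zeta> (\<phi> x) = a (jet E k \<zeta> x) (\<phi> x)" if "x \<in> points (base E)" for \<zeta> x
    using p\<phi>(2)[OF that] by (simp add: gauge_map_def)
  note sF = section_on_local[OF compact_variation_section[OF X v]]
  have pt: "(jet E k (F \<epsilon>) x, \<phi> x) \<in> points ?N" if "\<epsilon> \<in> ?J" "x \<in> points (base E)" for \<epsilon> x
    using that sF p\<phi> by (intro jet_pair_points) auto
  note sm = smooth_jet_family[OF E Y b F(1,2) \<phi>, of k]
  note R = smooth_atlas_prod_mfd[OF smooth_atlas_real_line X]
  have "smooth_map_on (prod_mfd real_line (base E)) (total Y) (?J \<times> points (base E))
      (\<lambda>p. (\<lambda>(\<gamma>, y). a \<gamma> y) ((\<lambda>(\<epsilon>, x). (jet E k (F \<epsilon>) x, \<phi> x)) p))"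
  proof (rule smooth_map_on_compose[OF R injective_atlas_jet_fibre_product[OF E Y b] _ gauge_actionD(1)[OF a]])
    show "smooth_map_on (prod_mfd real_line (base E)) ?N (?J \<times> points (base E)) (\<lambda>(\<epsilon>, x). (jet E k (F \<epsilon>) x, \<phi> x))"
      by (rule sm)
  qed (use pt in auto)
  then have 1: "smooth_map_on (prod_mfd real_line (base E)) (total Y) (?J \<times> points (base E))
      (\<lambda>(\<epsilon>, x). (gauge_map E Y k a (F \<epsilon>) \<circ> \<phi>) x)"
    by (rule smooth_map_on_cong[OF R]) (auto simp: g)
  have 2: "proj Y ((gauge_map E Y k a (F \<epsilon>) \<circ> \<phi>) x) = x" if "\<epsilon> \<in> ?J" "x \<in> points (base E)" for \<epsilon> x
    using gauge_actionD(2)[OF a pt[OF that]] p\<phi>(2)[OF that(2)] that(2) by (simp add: g)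
  have 3: "(gauge_map E Y k a (F 0) \<circ> \<phi>) x = (gauge_map E Y k a \<eta> \<circ> \<phi>) x" if "x \<in> points (base E)" for x
    using gauge_map_germ[OF X openin_mfd_points[OF X] that F(3) _ p\<phi>(2)[OF that]] F(2)[of 0 x] \<delta> that by simp
  \<comment> \<open>A compact set in a Hausdorff space is closed, so each point outside
    \<open>K\<close> has a neighbourhood on which \<open>F \<epsilon>\<close> equals
    \<open>\<eta>\<close>; hence their k-jets agree there.\<close>
  have "Hausdorff_space (mfd_topology (base E))"
    using E by (simp add: fibre_bundle_def smooth_manifold_def)
  then have "closedin (mfd_topology (base E)) K" using K by (rule compactin_imp_closedin)
  then have "openin (mfd_topology (base E)) (points (base E) - K)"
    using openin_diff[OF openin_mfd_points[OF X]] by blast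
  then have 4: "(gauge_map E Y k a (F \<epsilon>) \<circ> \<phi>) x = (gauge_map E Y k a \<eta> \<circ> \<phi>) x"
    if "\<epsilon> \<in> ?J" "x \<in> points (base E) - K" for \<epsilon> x
    using gauge_map_germ[OF X _ that(2) F(4)[OF that(1)] _ p\<phi>(2)] F(2)[OF that(1)] that(2) by simp
  show ?thesis using K \<delta> 1 2 3 4 unfolding compact_variation_def b by blast
qed

lemma euler_lagrange_fst_gauge:
  assumes E: "fibre_bundle E F_E" and Y: "fibre_bundle Y F_Y" and b: "base Y = base E"
    and a: "gauge_action E G Y k a" and \<phi>: "\<phi> \<in> sections Y"
    and EL: "euler_lagrange Y r L (gauge_map E Y k a \<eta> \<circ> \<phi>)"
  shows "euler_lagrange_fst E Y (k + r) (covariant_density E Y k a r L) \<eta> \<phi>"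
  unfolding euler_lagrange_fst_def stationary_def
proof (intro allI impI)
  fix K \<delta> F assume v: "compact_variation E \<eta> K \<delta> F"
  note X = fibre_bundleD(1)[OF E]
  have "((\<lambda>\<epsilon>. form_integral (base E) K (\<lambda>x. L (jet Y r (gauge_map E Y k a (F \<epsilon>) \<circ> \<phi>) x))) has_real_derivative 0) (at 0)"
    using EL compact_variation_gauge[OF E Y b a \<phi> v]
    unfolding euler_lagrange_def stationary_def b by blast
  moreover have "covariant_density E Y k a r L (jet (fibre_product E Y) (k + r) (\<lambda>z. (F \<epsilon> z, \<phi> z)) x) =
      L (jet Y r (gauge_map E Y k a (F \<epsilon>) \<circ> \<phi>) x)" if "\<epsilon> \<in> {-\<delta><..<\<delta>}" "x \<in> K" for \<epsilon> x
    using \<phi> compact_variation_subset(1)[OF X v] that(2)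
    by (intro covariant_density_pair[OF E Y b a compact_variation_section[OF X v that(1)]])
      (auto simp: sections_def b)
  ultimately show "((\<lambda>\<epsilon>. form_integral (base E) K (\<lambda>x. covariant_density E Y k a r L
      (jet (fibre_product E Y) (k + r) (\<lambda>z. (F \<epsilon> z, \<phi> z)) x))) has_real_derivative 0) (at 0)"
    by (subst action_derivative_cong[OF X compact_variation_subset(2)[OF X v]])
qed

theorem mainTheorem6:
  fixes X :: "('x, nat) mfd"
    and Y :: "('x, nat, 'y, 'j) fibred"
    and E :: "('x, nat, 'e, 'l) fibred"
    and F_Y :: "('f, 'm) mfd"
    and F_E :: "('g, 'o) mfd"
    and G :: "'x \<Rightarrow> 'e monoid"
    and a :: "('x, 'e) jet \<Rightarrow> 'y \<Rightarrow> 'y"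
    and L :: "('x, 'y) jet \<Rightarrow> 'x \<times> ('x, nat) form"
    and n k r :: nat
  assumes X: "oriented_manifold (n + 1) X"
    and Y: "fibre_bundle Y F_Y" "base Y = X"
    and E: "fibre_bundle E F_E" "base E = X" "group_bundle E G"
    and L: "lagrangian_density Y r L"
    and action: "gauge_action E G Y k a"
  shows "let Lt = covariant_density E Y k a r L; YY = fibre_product E Y in
           (\<forall>\<sigma>\<in>sections E. \<forall>\<gamma>\<in>jets YY (k + r).
              Lt (jet_prolongation YY (k + r) (covariant_gauge_map E G Y k a \<sigma>) \<gamma>) = Lt \<gamma>) \<and>
           (\<forall>\<eta> \<phi>. (\<lambda>x. (\<eta> x, \<phi> x)) \<in> sections YY \<longrightarrow>
              (euler_lagrange_snd E Y (k + r) Lt \<eta> \<phi> \<longleftrightarrow>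
               euler_lagrange Y r L (gauge_map E Y k a \<eta> \<circ> \<phi>)) \<and>
              (euler_lagrange_snd E Y (k + r) Lt \<eta> \<phi> \<longrightarrow>
               euler_lagrange_fst E Y (k + r) Lt \<eta> \<phi>))"
proof -
  have b: "base Y = base E" using Y(2) E(2) by simp
  have sec: "\<eta> \<in> sections E" "\<phi> \<in> sections Y"
    if "(\<lambda>x. (\<eta> x, \<phi> x)) \<in> sections (fibre_product E Y)" for \<eta> \<phi>
    using section_on_components[OF E(1) Y(1) b, of "points (base E)" "\<lambda>x. (\<eta> x, \<phi> x)"] that
    by (simp_all add: sections_def fibre_product_simps b comp_def)
  show ?thesis
    unfolding Let_def
    using covariant_density_invariant[OF E(1) Y(1) b E(3) action]
      euler_lagrange_snd_iff[OF E(1) Y(1) b action sec]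
      euler_lagrange_fst_gauge[OF E(1) Y(1) b action sec(2)] by blast
qed

end
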